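(* A map in canonical form is uniquely determined by the two invariants $$\Sigma=\theta+\eta\in\mathbb R/(2\mathbb Z)\qquad\text{and}\qquad \Delta=\theta-\eta\in(0,1).$$ Therefore the moduli space $\mathcal M$, consisting of all conjugacy classes of quadratic maps with real coefficients and real critical points, is diffeomorphic to the cylinder $(\mathbb R/2\mathbb Z)\times(0,1)$ (via $\langle f\rangle\mapsto(\Sigma,\Delta)$).
   Context: A real quadratic map is a degree two rational map with real coefficients and with both critical points in $\mathbb R\cup\{\infty\}$. Two such maps are conjugate if $g=L\circ f\circ L^{-1}$ with $L(x)=(ax+b)/(cx+d)$ real, $ad-bc>0$; $\langle f\rangle$ is the conjugacy class. Every such map is conjugate to one and only one map in canonical form $f(x)=\frac{Ax^2+B}{Cx^2+D}$ with $A,B,C,D$ real, $A^2+C^2=B^2+D^2$ and $AD-BC>0$, where $A,B,C,D$ are unique up to a common non-zero factor. Normalize so that $A^2+C^2=B^2+D^2=1$ and choose real numbers $\theta,\eta$ with $$A=\sin(\pi\theta),\quad C=\cos(\pi\theta),\quad B=\sin(\pi\eta),\quad D=\cos(\pi\eta).$$ Then $AD-BC=\sin(\pi(\theta-\eta))>0$, and $\theta,\eta$ are chosen so that $0<\theta-\eta<1$. The pair $(\theta,\eta)$ is then well defined up to adding a common integer to both (multiplying $A,B,C,D$ by $-1$ adds one to both). The smooth structure on $\mathcal M$ is that of the set of canonical forms $(A:B:C:D)$, regarded as a smooth surface in real projective 3-space. *)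

theory Defs
  imports "HOL-Analysis.Analysis" "HOL-Computational_Algebra.Computational_Algebra"
begin

section \<open>Rational maps of the Riemann sphere\<close>

datatype riemann_sphere = Fin complex | Infty

definition extended_reals :: "riemann_sphere set" where
  "extended_reals = insert Infty (range (\<lambda>x::real. Fin (complex_of_real x)))"

text \<open>The rational map \<open>p / q\<close> with real coefficients as a self-map of the sphere. The value at
  infinity is that of the homogenization of degree \<open>max (degree p) (degree q)\<close>. This is meaningful
  for coprime \<open>p\<close>, \<open>q\<close>.\<close>

definition rational_map :: "real poly \<Rightarrow> real poly \<Rightarrow> riemann_sphere \<Rightarrow> riemann_sphere" where
  "rational_map p q w =
    (case w of
       Fin z \<Rightarrow>
         (let a = poly (map_poly complex_of_real p) z; b = poly (map_poly complex_of_real q) z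
          in if b = 0 then Infty else Fin (a / b))
     | Infty \<Rightarrow>
         (let d = max (degree p) (degree q); a = coeff p d; b = coeff q d
          in if b = 0 then Infty else Fin (complex_of_real (a / b))))"

fun recip :: "riemann_sphere \<Rightarrow> riemann_sphere" where
  "recip (Fin z) = (if z = 0 then Infty else Fin (1 / z))"
| "recip Infty = Fin 0"

fun finite_part :: "riemann_sphere \<Rightarrow> complex" where
  "finite_part (Fin z) = z"
| "finite_part Infty = 0"

text \<open>The derivative vanishes in local coordinates; at infinity, in the source as well as in the
  target, the coordinate is \<open>1 / z\<close>.\<close>

definition critical_point :: "(riemann_sphere \<Rightarrow> riemann_sphere) \<Rightarrow> riemann_sphere \<Rightarrow> bool" where
  "critical_point f w \<longleftrightarrow>
    (let src = (if w = Infty then recip else id);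
         tgt = (if f w = Infty then recip else id)
     in ((\<lambda>z. finite_part (tgt (f (src (Fin z))))) has_field_derivative 0)
          (at (finite_part (src w))))"

definition real_quadratic_maps :: "(riemann_sphere \<Rightarrow> riemann_sphere) set" where
  "real_quadratic_maps =
    {f. (\<exists>p q. coprime p q \<and> max (degree p) (degree q) = 2 \<and> f = rational_map p q) \<and>
        (\<forall>w. critical_point f w \<longrightarrow> w \<in> extended_reals)}"

definition real_moebius_maps :: "(riemann_sphere \<Rightarrow> riemann_sphere) set" where
  "real_moebius_maps = {rational_map [:b, a:] [:d, c:] | a b c d. a * d - b * c > 0}"

definition conjugacy ::
  "((riemann_sphere \<Rightarrow> riemann_sphere) \<times> (riemann_sphere \<Rightarrow> riemann_sphere)) set" where
  "conjugacy = {(f, g). f \<in> real_quadratic_maps \<and> g \<in> real_quadratic_maps \<and>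
                        (\<exists>L\<in>real_moebius_maps. g = L \<circ> f \<circ> inv L)}"

definition moduli_space :: "(riemann_sphere \<Rightarrow> riemann_sphere) set set" where
  "moduli_space = real_quadratic_maps // conjugacy"


section \<open>Canonical forms and the invariants\<close>

definition canonical_map :: "real \<Rightarrow> real \<Rightarrow> real \<Rightarrow> real \<Rightarrow> riemann_sphere \<Rightarrow> riemann_sphere" where
  "canonical_map A B C D = rational_map [:B, 0, A:] [:D, 0, C:]"

definition canonical_maps :: "(riemann_sphere \<Rightarrow> riemann_sphere) set" where
  "canonical_maps = {canonical_map A B C D | A B C D.
                       A\<^sup>2 + C\<^sup>2 = B\<^sup>2 + D\<^sup>2 \<and> A * D - B * C > 0}"

definition canonical_rep :: "(riemann_sphere \<Rightarrow> riemann_sphere) set \<Rightarrow> (riemann_sphere \<Rightarrow> riemann_sphere)"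
  where "canonical_rep c = (THE f. f \<in> c \<and> f \<in> canonical_maps)"

text \<open>Points of \<open>\<real>/2\<int>\<close> are represented as cosets.\<close>

definition circle_point :: "real \<Rightarrow> real set" where
  "circle_point t = {u. \<exists>k::int. u = t + 2 * of_int k}"

definition circle :: "real set set" where
  "circle = range circle_point"

definition has_invariants :: "(riemann_sphere \<Rightarrow> riemann_sphere) \<Rightarrow> real set \<times> real \<Rightarrow> bool" where
  "has_invariants f x \<longleftrightarrow>
    (\<exists>\<theta> \<eta>. 0 < \<theta> - \<eta> \<and> \<theta> - \<eta> < 1 \<and>
       f = canonical_map (sin (pi * \<theta>)) (sin (pi * \<eta>)) (cos (pi * \<theta>)) (cos (pi * \<eta>)) \<and>
       x = (circle_point (\<theta> + \<eta>), \<theta> - \<eta>))"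

definition invariants :: "(riemann_sphere \<Rightarrow> riemann_sphere) \<Rightarrow> real set \<times> real" where
  "invariants f = (THE x. has_invariants f x)"


section \<open>Smooth manifolds\<close>

primrec Ck_on :: "nat \<Rightarrow> ('a::euclidean_space \<Rightarrow> 'b::euclidean_space) \<Rightarrow> 'a set \<Rightarrow> bool" where
  "Ck_on 0 f S = continuous_on S f"
| "Ck_on (Suc k) f S =
     (f differentiable_on S \<and> (\<forall>v\<in>Basis. Ck_on k (\<lambda>x. frechet_derivative f (at x) v) S))"

definition smooth_on :: "('a::euclidean_space \<Rightarrow> 'b::euclidean_space) \<Rightarrow> 'a set \<Rightarrow> bool" where
  "smooth_on f S \<longleftrightarrow> open S \<and> (\<forall>k. Ck_on k f S)"

type_synonym ('a, 'e) chart = "'a set \<times> ('a \<Rightarrow> 'e)"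

text \<open>Since \<^const>\<open>smooth_on\<close> includes openness of the domain, this says that \<open>U \<inter> V\<close> has open image
  under both charts and that both coordinate changes are smooth. The two model spaces may be
  different types.\<close>

fun compatible :: "('a, 'e::euclidean_space) chart \<Rightarrow> ('a, 'f::euclidean_space) chart \<Rightarrow> bool" where
  "compatible (U, \<phi>) (V, \<psi>) \<longleftrightarrow>
     smooth_on (\<psi> \<circ> inv_into U \<phi>) (\<phi> ` (U \<inter> V)) \<and>
     smooth_on (\<phi> \<circ> inv_into V \<psi>) (\<psi> ` (U \<inter> V))"

definition chart_on :: "'a set \<Rightarrow> ('a, 'e::euclidean_space) chart \<Rightarrow> bool" where
  "chart_on X c \<longleftrightarrow> fst c \<subseteq> X \<and> inj_on (snd c) (fst c) \<and> open (snd c ` fst c)"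

definition smooth_atlas :: "'a set \<Rightarrow> ('a, 'e::euclidean_space) chart set \<Rightarrow> bool" where
  "smooth_atlas X \<A> \<longleftrightarrow>
     (\<Union>c\<in>\<A>. fst c) = X \<and> (\<forall>c\<in>\<A>. chart_on X c) \<and> (\<forall>c\<in>\<A>. \<forall>c'\<in>\<A>. compatible c c')"

definition atlas_topology :: "'a set \<Rightarrow> ('a, 'e::euclidean_space) chart set \<Rightarrow> 'a topology" where
  "atlas_topology X \<A> = topology (\<lambda>W. W \<subseteq> X \<and> (\<forall>(U, \<phi>)\<in>\<A>. open (\<phi> ` (U \<inter> W))))"

definition smooth_manifold :: "'a set \<Rightarrow> ('a, 'e::euclidean_space) chart set \<Rightarrow> bool" where
  "smooth_manifold X \<A> \<longleftrightarrow>
     smooth_atlas X \<A> \<and> Hausdorff_space (atlas_topology X \<A>) \<and> second_countable (atlas_topology X \<A>)"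

definition smooth_map ::
  "'a set \<Rightarrow> ('a, 'e::euclidean_space) chart set \<Rightarrow>
   'b set \<Rightarrow> ('b, 'f::euclidean_space) chart set \<Rightarrow> ('a \<Rightarrow> 'b) \<Rightarrow> bool" where
  "smooth_map X \<A> Y \<B> f \<longleftrightarrow>
     f ` X \<subseteq> Y \<and>
     (\<forall>(U, \<phi>)\<in>\<A>. \<forall>(V, \<psi>)\<in>\<B>. smooth_on (\<psi> \<circ> f \<circ> inv_into U \<phi>) (\<phi> ` (U \<inter> f -` V)))"

definition diffeomorphism ::
  "'a set \<Rightarrow> ('a, 'e::euclidean_space) chart set \<Rightarrow>
   'b set \<Rightarrow> ('b, 'f::euclidean_space) chart set \<Rightarrow> ('a \<Rightarrow> 'b) \<Rightarrow> bool" where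
  "diffeomorphism X \<A> Y \<B> f \<longleftrightarrow>
     smooth_manifold X \<A> \<and> smooth_manifold Y \<B> \<and> bij_betw f X Y \<and>
     smooth_map X \<A> Y \<B> f \<and> smooth_map Y \<B> X \<A> (inv_into X f)"

text \<open>The smooth structure of an embedded surface \<open>S\<close> in a 3-manifold: all charts of the ambient
  maximal atlas that flatten \<open>S\<close> to the plane \<open>\<real>\<^sup>2 \<times> {0}\<close>, restricted to \<open>S\<close>. They cover \<open>S\<close> if and
  only if \<open>S\<close> is an embedded surface.\<close>

definition surface_atlas ::
  "'a set \<Rightarrow> ('a, 'e::euclidean_space) chart set \<Rightarrow> 'a set \<Rightarrow> ('a, real \<times> real) chart set" where
  "surface_atlas X \<A> S =
     {(U \<inter> S, fst \<circ> \<phi>) | U (\<phi> :: 'a \<Rightarrow> (real \<times> real) \<times> real).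
        chart_on X (U, \<phi>) \<and> (\<forall>c\<in>\<A>. compatible (U, \<phi>) c) \<and>
        \<phi> ` (U \<inter> S) = \<phi> ` U \<inter> (UNIV \<times> {0})}"

definition transported_atlas ::
  "('a \<Rightarrow> 'b) \<Rightarrow> 'a set \<Rightarrow> ('a, 'e) chart set \<Rightarrow> ('b, 'e) chart set" where
  "transported_atlas h X \<A> = {(h ` U, \<phi> \<circ> inv_into X h) | U \<phi>. (U, \<phi>) \<in> \<A>}"

definition product_atlas ::
  "('a, 'e) chart set \<Rightarrow> ('b, 'f) chart set \<Rightarrow> ('a \<times> 'b, 'e \<times> 'f) chart set" where
  "product_atlas \<A> \<B> = {(U \<times> V, map_prod \<phi> \<psi>) | U \<phi> V \<psi>. (U, \<phi>) \<in> \<A> \<and> (V, \<psi>) \<in> \<B>}"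


section \<open>The cylinder\<close>

definition circle_atlas :: "(real set, real) chart set" where
  "circle_atlas = {(circle_point ` {c<..<c + 2}, \<lambda>P. the_elem (P \<inter> {c<..<c + 2})) | c. True}"

definition cylinder :: "(real set \<times> real) set" where
  "cylinder = circle \<times> {0<..<1}"

definition cylinder_atlas :: "(real set \<times> real, real \<times> real) chart set" where
  "cylinder_atlas = product_atlas circle_atlas {({0<..<1}, id)}"


section \<open>Projective 3-space and the smooth structure of the moduli space\<close>

type_synonym homogeneous = "real \<times> real \<times> real \<times> real"

definition proj_point :: "homogeneous \<Rightarrow> homogeneous set" where
  "proj_point v = {t *\<^sub>R v | t. t \<noteq> 0}"

definition proj_space :: "homogeneous set set" where
  "proj_space = proj_point ` (UNIV - {0})"

text \<open>Given a function of homogeneous coordinates that is invariant under scaling, the induced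
  function of points.\<close>

definition on_points :: "(homogeneous \<Rightarrow> 'b) \<Rightarrow> homogeneous set \<Rightarrow> 'b" where
  "on_points g P = the_elem (g ` P)"

definition proj_atlas :: "(homogeneous set, real \<times> real \<times> real) chart set" where
  "proj_atlas =
    {(proj_point ` {(A, B, C, D). A \<noteq> 0}, on_points (\<lambda>(A, B, C, D). (B / A, C / A, D / A))),
     (proj_point ` {(A, B, C, D). B \<noteq> 0}, on_points (\<lambda>(A, B, C, D). (A / B, C / B, D / B))),
     (proj_point ` {(A, B, C, D). C \<noteq> 0}, on_points (\<lambda>(A, B, C, D). (A / C, B / C, D / C))),
     (proj_point ` {(A, B, C, D). D \<noteq> 0}, on_points (\<lambda>(A, B, C, D). (A / D, B / D, C / D)))}"

definition canonical_surface :: "homogeneous set set" where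
  "canonical_surface = proj_point ` {(A, B, C, D). A\<^sup>2 + C\<^sup>2 = B\<^sup>2 + D\<^sup>2 \<and> A * D - B * C > 0}"

definition class_of_point :: "homogeneous set \<Rightarrow> (riemann_sphere \<Rightarrow> riemann_sphere) set" where
  "class_of_point = on_points (\<lambda>(A, B, C, D). conjugacy `` {canonical_map A B C D})"

definition moduli_atlas :: "((riemann_sphere \<Rightarrow> riemann_sphere) set, real \<times> real) chart set" where
  "moduli_atlas = transported_atlas class_of_point canonical_surface
                    (surface_atlas proj_space proj_atlas canonical_surface)"

end

theory Submission
  imports Defs
begin

text \<open>A canonical form corresponds to a pair of planar vectors \<open>(A, C)\<close>, \<open>(B, D)\<close> of equal length and
  positive orientation, up to a common factor; their polar angles \<open>\<pi> \<theta>\<close>, \<open>\<pi> \<eta>\<close> parametrize it by the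
  cylinder. Letting the ratio of the two lengths vary as a third coordinate gives charts of projective
  space that flatten the surface of canonical forms, and in these coordinates the map from the surface
  to the cylinder is the identity. Every other chart of the surface is compared
  with these through the affine charts of projective space.

  For the canonical forms themselves, a Moebius map that sends the two critical points, which are the
  zeros of the Wronskian, to \<open>\<infinity>\<close> and \<open>0\<close> removes the linear terms; the order of the two points
  fixes the sign of \<open>AD - BC\<close>, and a dilation equalizes the lengths. Uniqueness holds since the
  critical points are the points that are alone in their fibres, so that a conjugating Moebius map
  permutes \<open>0\<close> and \<open>\<infinity>\<close>.\<close>


section \<open>Smooth functions\<close>

text \<open>For \<open>p / q\<close> of degree two the Wronskian \<open>p' q - p q'\<close> is
  \<alpha> z^2 + 2 \<beta> z + \<gamma>, where \<alpha>, \<beta>, \<gamma> are minors of the two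
  rows of coefficients, and \<open>\<beta>\<^sup>2 - \<alpha> * \<gamma>\<close> is, up to a factor,
  its discriminant and also the resultant of \<open>p\<close> and \<open>q\<close>. So coprimality
  makes the critical points distinct, and their reality makes this number positive. The sum of the
  angles is circular with period 2, and the difference is not, because negating
  \<open>(A, B, C, D)\<close> adds 1 to both \<theta> and \<eta>; the bound on the difference rules
  out all other shifts. The cylinder and the surface are therefore both quotients of one plane strip
  by translations by \<open>(2, 0)\<close>. On the geometric side, \<open>surface_atlas\<close>
  contains every flattening chart, and \<open>diffeomorphism\<close> demands that both sides be
  Hausdorff and second countable. The first difficulty is met by composing smooth representatives
  through a covering family of charts; the second by proving these properties for the cylinder only
  and carrying them back along the homeomorphism.\<close>

lemma Ck_on_cong:
  fixes f g :: "'a::euclidean_space \<Rightarrow> 'b::euclidean_space"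
  assumes "open S" "\<And>x. x \<in> S \<Longrightarrow> f x = g x" "Ck_on k f S"
  shows "Ck_on k g S"
  using assms
proof (induction k arbitrary: f g)
  case 0
  then show ?case by (auto cong: continuous_on_cong)
next
  case (Suc k)
  have der: "(g has_derivative frechet_derivative f (at x)) (at x)" if "x \<in> S" for x
  proof -
    have "f differentiable (at x)"
      using Suc.prems that by (simp add: differentiable_on_eq_differentiable_at)
    then have "(f has_derivative frechet_derivative f (at x)) (at x)"
      by (simp add: frechet_derivative_works)
    then show ?thesis
      by (rule has_derivative_transform_within_open[OF _ \<open>open S\<close> that]) (use Suc.prems in auto)
  qed
  have "g differentiable_on S"
    using der \<open>open S\<close> by (auto simp: differentiable_on_eq_differentiable_at differentiable_def)
  moreover have "Ck_on k (\<lambda>x. frechet_derivative g (at x) v) S" if "v \<in> Basis" for v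
  proof (rule Suc.IH)
    show "Ck_on k (\<lambda>x. frechet_derivative f (at x) v) S" using Suc.prems that by simp
    show "frechet_derivative f (at x) v = frechet_derivative g (at x) v" if "x \<in> S" for x
      using frechet_derivative_at[OF der[OF that]] by simp
  qed fact
  ultimately show ?case by simp
qed

text \<open>Admits an explicit derivative in place of \<open>frechet_derivative\<close>. Most
  closure properties below follow one pattern: a differentiation rule expresses the partial
  derivatives through functions to which the induction hypothesis applies.\<close>

lemma Ck_on_SucI:
  fixes f :: "'a::euclidean_space \<Rightarrow> 'b::euclidean_space"
  assumes S: "open S" and d: "\<And>x. x \<in> S \<Longrightarrow> (f has_derivative f' x) (at x)"
    and C: "\<And>v. v \<in> Basis \<Longrightarrow> Ck_on k (\<lambda>x. f' x v) S"
  shows "Ck_on (Suc k) f S"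
proof -
  have "Ck_on k (\<lambda>x. frechet_derivative f (at x) v) S" if "v \<in> Basis" for v
    using frechet_derivative_at[OF d] by (intro Ck_on_cong[OF S _ C[OF that]]) simp
  then show ?thesis
    using d S by (auto simp: differentiable_on_eq_differentiable_at differentiable_def)
qed

lemma Ck_on_Suc_has_derivative:
  fixes f :: "'a::euclidean_space \<Rightarrow> 'b::euclidean_space"
  assumes "open S" "Ck_on (Suc k) f S" "x \<in> S"
  shows "(f has_derivative frechet_derivative f (at x)) (at x)"
  using assms by (simp add: differentiable_on_eq_differentiable_at frechet_derivative_works)

lemma Ck_on_SucD:
  fixes f :: "'a::euclidean_space \<Rightarrow> 'b::euclidean_space"
  assumes "Ck_on (Suc k) f S"
  shows "Ck_on k f S"
  using assms
proof (induction k arbitrary: f)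
  case 0
  then show ?case by (simp add: differentiable_imp_continuous_on)
next
  case (Suc k)
  then show ?case by (metis Ck_on.simps(2))
qed

lemma Ck_on_subset:
  fixes f :: "'a::euclidean_space \<Rightarrow> 'b::euclidean_space"
  assumes "Ck_on k f S" "T \<subseteq> S"
  shows "Ck_on k f T"
  using assms
proof (induction k arbitrary: f)
  case 0
  then show ?case by (auto intro: continuous_on_subset)
next
  case (Suc k)
  then show ?case by (auto intro: differentiable_on_subset)
qed

lemma Ck_on_local:
  fixes f :: "'a::euclidean_space \<Rightarrow> 'b::euclidean_space"
  assumes "\<And>x. x \<in> S \<Longrightarrow> \<exists>T. open T \<and> x \<in> T \<and> Ck_on k f T"
  shows "Ck_on k f S"
  using assms
proof (induction k arbitrary: f)
  case 0
  then show ?case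
    by (metis Ck_on.simps(1) continuous_at_imp_continuous_on continuous_on_eq_continuous_at)
next
  case (Suc k)
  have "f differentiable_on S"
    unfolding differentiable_on_def
  proof
    fix x assume "x \<in> S"
    then obtain T where "open T" "x \<in> T" "Ck_on (Suc k) f T" using Suc.prems by blast
    then have "f differentiable (at x)"
      by (simp add: differentiable_on_eq_differentiable_at)
    then show "f differentiable (at x within S)" by (rule differentiable_at_withinI)
  qed
  moreover have "Ck_on k (\<lambda>x. frechet_derivative f (at x) v) S" if "v \<in> Basis" for v
    using Suc.prems that by (intro Suc.IH) (metis Ck_on.simps(2))
  ultimately show ?case by simp
qed

lemma Ck_on_const: "Ck_on k (\<lambda>x::'a::euclidean_space. c::'b::euclidean_space) S"
  by (induction k arbitrary: c) auto

lemma Ck_on_bounded_linear: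
  fixes f :: "'a::euclidean_space \<Rightarrow> 'b::euclidean_space"
  assumes "bounded_linear f" "open S"
  shows "Ck_on k f S"
proof (cases k)
  case 0
  then show ?thesis using assms by (simp add: linear_continuous_on)
next
  case (Suc n)
  show ?thesis unfolding Suc
    by (rule Ck_on_SucI[OF assms(2) bounded_linear_imp_has_derivative[OF assms(1)]])
      (rule Ck_on_const)
qed

lemma Ck_on_linear_compose:
  fixes f :: "'a::euclidean_space \<Rightarrow> 'b::euclidean_space" and g :: "'b \<Rightarrow> 'c::euclidean_space"
  assumes "open S" "bounded_linear g" "Ck_on k f S"
  shows "Ck_on k (\<lambda>x. g (f x)) S"
  using assms(3)
proof (induction k arbitrary: f)
  case 0
  then show ?case using assms(2) by (auto intro: bounded_linear.continuous_on)
next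
  case (Suc k)
  show ?case
  proof (rule Ck_on_SucI[OF assms(1)])
    show "((\<lambda>x. g (f x)) has_derivative (\<lambda>h. g (frechet_derivative f (at x) h))) (at x)"
      if "x \<in> S" for x
      by (rule bounded_linear.has_derivative[OF assms(2)
            Ck_on_Suc_has_derivative[OF assms(1) Suc.prems that]])
    show "Ck_on k (\<lambda>x. g (frechet_derivative f (at x) v)) S" if "v \<in> Basis" for v
      using Suc.prems that by (intro Suc.IH) simp
  qed
qed

lemma Ck_on_add:
  fixes f g :: "'a::euclidean_space \<Rightarrow> 'b::euclidean_space"
  assumes "open S" "Ck_on k f S" "Ck_on k g S"
  shows "Ck_on k (\<lambda>x. f x + g x) S"
  using assms(2,3)
proof (induction k arbitrary: f g)
  case 0
  then show ?case by (auto intro: continuous_intros)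
next
  case (Suc k)
  show ?case
  proof (rule Ck_on_SucI[OF assms(1)])
    show "((\<lambda>x. f x + g x) has_derivative
        (\<lambda>h. frechet_derivative f (at x) h + frechet_derivative g (at x) h)) (at x)"
      if "x \<in> S" for x
      by (intro has_derivative_add Ck_on_Suc_has_derivative[OF assms(1) Suc.prems(1)]
          Ck_on_Suc_has_derivative[OF assms(1) Suc.prems(2)] that)
    show "Ck_on k (\<lambda>x. frechet_derivative f (at x) v + frechet_derivative g (at x) v) S"
      if "v \<in> Basis" for v
      using Suc.prems that by (intro Suc.IH) auto
  qed
qed

lemma Ck_on_scaleR:
  fixes f :: "'a::euclidean_space \<Rightarrow> real" and g :: "'a \<Rightarrow> 'b::euclidean_space"
  assumes "open S" "Ck_on k f S" "Ck_on k g S"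
  shows "Ck_on k (\<lambda>x. f x *\<^sub>R g x) S"
  using assms(2,3)
proof (induction k arbitrary: f g)
  case 0
  then show ?case by (auto intro: continuous_intros)
next
  case (Suc k)
  show ?case
  proof (rule Ck_on_SucI[OF assms(1)])
    show "((\<lambda>x. f x *\<^sub>R g x) has_derivative
        (\<lambda>h. f x *\<^sub>R frechet_derivative g (at x) h + frechet_derivative f (at x) h *\<^sub>R g x)) (at x)"
      if "x \<in> S" for x
      by (intro has_derivative_scaleR Ck_on_Suc_has_derivative[OF assms(1) Suc.prems(1)]
          Ck_on_Suc_has_derivative[OF assms(1) Suc.prems(2)] that)
    show "Ck_on k (\<lambda>x. f x *\<^sub>R frechet_derivative g (at x) v + frechet_derivative f (at x) v *\<^sub>R g x) S"
      if "v \<in> Basis" for v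
      using Suc.prems that by (intro Ck_on_add[OF assms(1)] Suc.IH Ck_on_SucD[OF Suc.prems(1)]
          Ck_on_SucD[OF Suc.prems(2)]) auto
  qed
qed

lemma Ck_on_sum:
  fixes f :: "'i \<Rightarrow> 'a::euclidean_space \<Rightarrow> 'b::euclidean_space"
  assumes "open S" "\<And>i. i \<in> I \<Longrightarrow> Ck_on k (f i) S"
  shows "Ck_on k (\<lambda>x. \<Sum>i\<in>I. f i x) S"
  using assms(2)
proof (induction I rule: infinite_finite_induct)
  case (insert i I)
  have "Ck_on k (\<lambda>x. f i x + (\<Sum>i\<in>I. f i x)) S"
    by (rule Ck_on_add[OF assms(1)]) (use insert in auto)
  then show ?case by (simp add: insert.hyps)
qed (auto intro: Ck_on_const)

text \<open>In the chain rule the derivative of \<open>g\<close> is applied to a direction that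
  varies with the point. Expanding that direction in \<open>Basis\<close> leaves only partial
  derivatives of \<open>g\<close> in fixed directions, so the induction runs over \<open>g\<close>
  while \<open>f\<close> stays the same.\<close>

lemma Ck_on_compose:
  fixes f :: "'a::euclidean_space \<Rightarrow> 'b::euclidean_space" and g :: "'b \<Rightarrow> 'c::euclidean_space"
  assumes "open S" "open T" "Ck_on k f S" "Ck_on k g T" "f ` S \<subseteq> T"
  shows "Ck_on k (\<lambda>x. g (f x)) S"
  using assms(3,4)
proof (induction k arbitrary: g)
  case 0
  then show ?case using assms(5) by (auto intro: continuous_on_compose2)
next
  case (Suc k)
  let ?D = "\<lambda>x v. \<Sum>b\<in>Basis. (frechet_derivative f (at x) v \<bullet> b) *\<^sub>R frechet_derivative g (at (f x)) b"
  show ?case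
  proof (rule Ck_on_SucI[OF assms(1)])
    fix x assume x: "x \<in> S"
    have g: "(g has_derivative frechet_derivative g (at (f x))) (at (f x))"
      using Ck_on_Suc_has_derivative[OF assms(2) Suc.prems(2)] x assms(5) by auto
    then interpret bounded_linear "frechet_derivative g (at (f x))"
      by (rule has_derivative_bounded_linear)
    have "((\<lambda>x. g (f x)) has_derivative
        (\<lambda>h. frechet_derivative g (at (f x)) (frechet_derivative f (at x) h))) (at x)"
      by (rule has_derivative_compose[OF Ck_on_Suc_has_derivative[OF assms(1) Suc.prems(1) x] g])
    also have "(\<lambda>h. frechet_derivative g (at (f x)) (frechet_derivative f (at x) h)) = ?D x"
    proof
      fix h
      have "frechet_derivative g (at (f x)) (frechet_derivative f (at x) h) =
        frechet_derivative g (at (f x)) (\<Sum>b\<in>Basis. (frechet_derivative f (at x) h \<bullet> b) *\<^sub>R b)"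
        by (simp add: euclidean_representation)
      also have "\<dots> = ?D x h" by (simp add: sum scaleR)
      finally show "frechet_derivative g (at (f x)) (frechet_derivative f (at x) h) = ?D x h" .
    qed
    finally show "((\<lambda>x. g (f x)) has_derivative ?D x) (at x)" .
  next
    fix v :: 'a assume v: "v \<in> Basis"
    show "Ck_on k (\<lambda>x. ?D x v) S"
    proof (intro Ck_on_sum Ck_on_scaleR assms(1))
      fix b :: 'b assume b: "b \<in> Basis"
      show "Ck_on k (\<lambda>x. frechet_derivative f (at x) v \<bullet> b) S"
        using Suc.prems v
        by (intro Ck_on_linear_compose[OF assms(1) bounded_linear_inner_left]) simp
      show "Ck_on k (\<lambda>x. frechet_derivative g (at (f x)) b) S"
        using Suc.prems b by (intro Suc.IH Ck_on_SucD[OF Suc.prems(1)]) simp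
    qed
  qed
qed

lemma smooth_on_cong:
  assumes "smooth_on f S" "\<And>x. x \<in> S \<Longrightarrow> f x = g x"
  shows "smooth_on g S"
  using assms Ck_on_cong unfolding smooth_on_def by blast

lemma smooth_on_subset:
  assumes "smooth_on f S" "open T" "T \<subseteq> S"
  shows "smooth_on f T"
  using assms Ck_on_subset unfolding smooth_on_def by blast

text \<open>The working criterion for coordinate changes: they have closed formulas only near a
  point (one branch of an angle, one integer translation), and \<open>g\<close> is such a formula.
  Openness of \<open>S\<close> comes out as well, since the sets \<open>T\<close> are open.\<close>

lemma smooth_on_locally:
  assumes "\<And>x. x \<in> S \<Longrightarrow> \<exists>T g. x \<in> T \<and> T \<subseteq> S \<and> smooth_on g T \<and> (\<forall>y\<in>T. g y = f y)"
  shows "smooth_on f S"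
proof -
  have *: "\<exists>T. x \<in> T \<and> T \<subseteq> S \<and> smooth_on f T" if "x \<in> S" for x
    using assms[OF that] smooth_on_cong by metis
  have "open S"
    unfolding open_subopen[of S] using * unfolding smooth_on_def by blast
  moreover have "Ck_on k f S" for k
    using * unfolding smooth_on_def by (intro Ck_on_local) blast
  ultimately show ?thesis by (simp add: smooth_on_def)
qed

lemma smooth_on_imp_continuous_on: "smooth_on f S \<Longrightarrow> continuous_on S f"
  unfolding smooth_on_def using Ck_on.simps(1) by blast

lemma smooth_on_open_vimage:
  assumes "smooth_on f S" "open T"
  shows "open (S \<inter> f -` T)"
  using assms smooth_on_imp_continuous_on[OF assms(1)]
  by (auto simp: smooth_on_def intro: continuous_open_preimage)

lemma smooth_on_compose:
  fixes f :: "'a::euclidean_space \<Rightarrow> 'b::euclidean_space" and g :: "'b \<Rightarrow> 'c::euclidean_space"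
  assumes "smooth_on g T" "smooth_on f S" "f ` S \<subseteq> T"
  shows "smooth_on (\<lambda>x. g (f x)) S"
  using assms Ck_on_compose[of S T] unfolding smooth_on_def by blast

lemma smooth_on_const: "open S \<Longrightarrow> smooth_on (\<lambda>x. c) S"
  by (simp add: smooth_on_def Ck_on_const)

lemma smooth_on_bounded_linear: "open S \<Longrightarrow> bounded_linear f \<Longrightarrow> smooth_on f S"
  by (simp add: smooth_on_def Ck_on_bounded_linear)

lemma smooth_on_linear_compose:
  "bounded_linear g \<Longrightarrow> smooth_on f S \<Longrightarrow> smooth_on (\<lambda>x. g (f x)) S"
  by (simp add: smooth_on_def Ck_on_linear_compose)

lemma smooth_on_add: "smooth_on f S \<Longrightarrow> smooth_on g S \<Longrightarrow> smooth_on (\<lambda>x. f x + g x) S"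
  by (simp add: smooth_on_def Ck_on_add)

lemma smooth_on_mult:
  fixes f g :: "'a::euclidean_space \<Rightarrow> real"
  shows "smooth_on f S \<Longrightarrow> smooth_on g S \<Longrightarrow> smooth_on (\<lambda>x. f x * g x) S"
  using Ck_on_scaleR[of S _ f g] by (simp add: smooth_on_def)

lemma smooth_on_minus: "smooth_on f S \<Longrightarrow> smooth_on (\<lambda>x. - f x) S"
  by (rule smooth_on_linear_compose[OF bounded_linear_minus[OF bounded_linear_ident]])

lemma smooth_on_diff: "smooth_on f S \<Longrightarrow> smooth_on g S \<Longrightarrow> smooth_on (\<lambda>x. f x - g x) S"
  using smooth_on_add[OF _ smooth_on_minus] by fastforce

lemma smooth_on_Pair:
  assumes "smooth_on f S" "smooth_on g S"
  shows "smooth_on (\<lambda>x. (f x, g x)) S"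
proof -
  have "smooth_on (\<lambda>x. (f x, 0) + (0, g x)) S"
    by (intro smooth_on_add smooth_on_linear_compose[OF _ assms(1)]
        smooth_on_linear_compose[OF _ assms(2)] bounded_linear_Pair bounded_linear_ident
        bounded_linear_zero)
  then show ?thesis by simp
qed

lemma smooth_on_fst: "smooth_on f S \<Longrightarrow> smooth_on (\<lambda>x. fst (f x)) S"
  by (rule smooth_on_linear_compose[OF bounded_linear_fst])

lemma smooth_on_snd: "smooth_on f S \<Longrightarrow> smooth_on (\<lambda>x. snd (f x)) S"
  by (rule smooth_on_linear_compose[OF bounded_linear_snd])

lemma smooth_on_ident: "open S \<Longrightarrow> smooth_on (\<lambda>x. x) S"
  by (rule smooth_on_bounded_linear[OF _ bounded_linear_ident])

section \<open>Elementary functions of one real variable\<close>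

lemma Ck_on_real_SucI:
  fixes f :: "real \<Rightarrow> real"
  assumes "open S" "\<And>x. x \<in> S \<Longrightarrow> (f has_real_derivative f' x) (at x)" "Ck_on k f' S"
  shows "Ck_on (Suc k) f S"
  by (rule Ck_on_SucI[OF assms(1) assms(2)[unfolded has_field_derivative_def]])
    (use assms(3) in auto)

text \<open>Each function is the derivative of the other up to sign, so the induction treats both at
  once.\<close>

lemma Ck_on_sin_cos: "Ck_on k (sin :: real \<Rightarrow> real) UNIV \<and> Ck_on k (cos :: real \<Rightarrow> real) UNIV"
proof (induction k)
  case 0
  then show ?case by (auto intro: continuous_intros)
next
  case (Suc k)
  have "Ck_on (Suc k) (sin :: real \<Rightarrow> real) UNIV"
    by (rule Ck_on_real_SucI[of _ _ cos]) (use Suc in \<open>auto intro: derivative_eq_intros\<close>)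
  moreover have "Ck_on k (\<lambda>x::real. - sin x) UNIV"
    by (rule Ck_on_linear_compose[OF _ bounded_linear_minus[OF bounded_linear_ident]])
      (use Suc in auto)
  then have "Ck_on (Suc k) (cos :: real \<Rightarrow> real) UNIV"
    by (intro Ck_on_real_SucI[of _ _ "\<lambda>x. - sin x"]) (auto intro: derivative_eq_intros)
  ultimately show ?case by simp
qed

lemma Ck_on_inverse: "Ck_on k (inverse :: real \<Rightarrow> real) (- {0})"
proof (induction k)
  case 0
  then show ?case by (auto intro!: continuous_intros)
next
  case (Suc k)
  have op: "open (- {0::real})" by auto
  have "Ck_on k (\<lambda>x::real. - (inverse x * inverse x)) (- {0})"
    using Ck_on_scaleR[OF op Suc Suc]
    by (intro Ck_on_linear_compose[OF op bounded_linear_minus[OF bounded_linear_ident]]) simp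
  then show ?case
    by (intro Ck_on_real_SucI[OF op, of _ "\<lambda>x. - (inverse x * inverse x)"])
      (auto intro!: derivative_eq_intros)
qed

lemma smooth_on_sin: "smooth_on f S \<Longrightarrow> smooth_on (\<lambda>x. sin (f x :: real)) S"
  by (rule smooth_on_compose[of sin UNIV]) (auto simp: smooth_on_def Ck_on_sin_cos)

lemma smooth_on_cos: "smooth_on f S \<Longrightarrow> smooth_on (\<lambda>x. cos (f x :: real)) S"
  by (rule smooth_on_compose[of cos UNIV]) (auto simp: smooth_on_def Ck_on_sin_cos)

lemma smooth_on_divide:
  fixes f g :: "'a::euclidean_space \<Rightarrow> real"
  assumes "smooth_on f S" "smooth_on g S" "\<And>x. x \<in> S \<Longrightarrow> g x \<noteq> 0"
  shows "smooth_on (\<lambda>x. f x / g x) S"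
  unfolding divide_inverse
  by (intro smooth_on_mult assms(1) smooth_on_compose[of inverse "- {0}" g])
    (use assms in \<open>auto simp: smooth_on_def Ck_on_inverse\<close>)

text \<open>The derivative is a rational function, already known to be smooth, so a single
  application of \<open>Ck_on_real_SucI\<close> suffices.\<close>

lemma smooth_on_arctan:
  assumes "smooth_on f S"
  shows "smooth_on (\<lambda>x. arctan (f x)) S"
proof (rule smooth_on_compose[OF _ assms])
  have nz: "1 + x * x \<noteq> 0" for x :: real
    by (smt (verit) zero_le_square)
  have "smooth_on (\<lambda>x::real. 1 / (1 + x * x)) UNIV"
    by (intro smooth_on_divide smooth_on_add smooth_on_mult smooth_on_const smooth_on_ident) (auto simp: nz)
  then have "Ck_on (Suc k) arctan UNIV" for k
    by (intro Ck_on_real_SucI[of _ _ "\<lambda>x::real. 1 / (1 + x * x)"])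
      (auto intro!: derivative_eq_intros simp: smooth_on_def power2_eq_square inverse_eq_divide)
  then show "smooth_on arctan UNIV"
    unfolding smooth_on_def using Ck_on_SucD by blast
qed simp

lemmas smooth_on_intros =
  smooth_on_const smooth_on_ident smooth_on_add smooth_on_diff smooth_on_minus smooth_on_mult
  smooth_on_divide smooth_on_Pair smooth_on_fst smooth_on_snd smooth_on_sin smooth_on_cos
  smooth_on_arctan


section \<open>Smooth maps between charts\<close>

text \<open>A common form of two notions: coordinate changes are the case \<open>f = id\<close>, and
  \<open>smooth_map\<close> asks this for all pairs of charts. One composition lemma then serves
  both.\<close>

definition smooth_in_charts ::
  "('a \<Rightarrow> 'b) \<Rightarrow> ('a, 'e::euclidean_space) chart \<Rightarrow> ('b, 'f::euclidean_space) chart \<Rightarrow> bool" where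
  "smooth_in_charts f c d \<longleftrightarrow>
     smooth_on (snd d \<circ> f \<circ> inv_into (fst c) (snd c)) (snd c ` (fst c \<inter> f -` fst d))"

lemma compatible_iff_smooth_in_charts:
  "compatible c d \<longleftrightarrow> smooth_in_charts id c d \<and> smooth_in_charts id d c"
  by (cases c; cases d) (simp add: smooth_in_charts_def Int_commute)

lemma smooth_map_iff_smooth_in_charts:
  "smooth_map X \<A> Y \<B> f \<longleftrightarrow> f ` X \<subseteq> Y \<and> (\<forall>c\<in>\<A>. \<forall>d\<in>\<B>. smooth_in_charts f c d)"
  by (simp add: smooth_map_def smooth_in_charts_def case_prod_unfold)

text \<open>The local representative of a composition factors through an intermediate chart. No
  single chart of \<open>\<B>\<close> has to contain the image of \<open>fst c\<close>, so the
  factorization is made near each point separately.\<close>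

lemma smooth_in_charts_compose:
  fixes c :: "('a, 'e::euclidean_space) chart" and \<B> :: "('b, 'f::euclidean_space) chart set"
    and e :: "('c, 'g::euclidean_space) chart"
  assumes c: "inj_on (snd c) (fst c)" and \<B>: "\<And>d. d \<in> \<B> \<Longrightarrow> inj_on (snd d) (fst d)"
    and h: "\<And>x. x \<in> fst c \<Longrightarrow> h x = g (f x)"
    and cover: "\<And>x. x \<in> fst c \<Longrightarrow> h x \<in> fst e \<Longrightarrow> \<exists>d\<in>\<B>. f x \<in> fst d"
    and f: "\<And>d. d \<in> \<B> \<Longrightarrow> smooth_in_charts f c d"
    and g: "\<And>d. d \<in> \<B> \<Longrightarrow> smooth_in_charts g d e"
  shows "smooth_in_charts h c e"
  unfolding smooth_in_charts_def
proof (rule smooth_on_locally)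
  fix y assume "y \<in> snd c ` (fst c \<inter> h -` fst e)"
  then obtain x where x: "x \<in> fst c" "h x \<in> fst e" "y = snd c x" by auto
  then obtain d where d: "d \<in> \<B>" "f x \<in> fst d" using cover by blast
  let ?F = "snd d \<circ> f \<circ> inv_into (fst c) (snd c)" and ?G = "snd e \<circ> g \<circ> inv_into (fst d) (snd d)"
  let ?D = "snd c ` (fst c \<inter> f -` fst d)" and ?E = "snd d ` (fst d \<inter> g -` fst e)"
  \<comment> \<open>The coordinates of the points that \<open>f\<close> sends into
    \<open>fst d\<close> and \<open>g\<close> from there into \<open>fst e\<close>; here
    \<open>?G (?F y)\<close> is defined. That membership in \<open>?E\<close> really gives
    \<open>g (f x') \<in> fst e\<close> uses the injectivity of the chart \<open>d\<close>.\<close>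
  let ?T = "?D \<inter> ?F -` ?E"
  have F: "smooth_on ?F ?D" and G: "smooth_on ?G ?E"
    using f[OF d(1)] g[OF d(1)] by (simp_all add: smooth_in_charts_def)
  have T: "open ?T"
    using smooth_on_open_vimage[OF F] G by (simp add: smooth_on_def)
  have Fc: "?F (snd c x') = snd d (f x')" if "x' \<in> fst c" for x'
    using that c by (simp add: inv_into_f_f)
  have T_eq: "\<exists>x'. x' \<in> fst c \<and> f x' \<in> fst d \<and> g (f x') \<in> fst e \<and> y' = snd c x'" if "y' \<in> ?T" for y'
  proof -
    from that obtain x' where x': "x' \<in> fst c" "f x' \<in> fst d" "y' = snd c x'" by auto
    with that Fc have "snd d (f x') \<in> ?E" by auto
    then have "f x' \<in> g -` fst e"
      using \<B>[OF d(1)] x' by (auto dest: inj_onD)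
    then show ?thesis using x' by auto
  qed
  show "\<exists>T k. y \<in> T \<and> T \<subseteq> snd c ` (fst c \<inter> h -` fst e) \<and> smooth_on k T \<and>
      (\<forall>y\<in>T. k y = (snd e \<circ> h \<circ> inv_into (fst c) (snd c)) y)"
  proof (intro exI conjI ballI)
    show "y \<in> ?T" using x d h Fc by auto
    show "?T \<subseteq> snd c ` (fst c \<inter> h -` fst e)" using T_eq h by fastforce
    show "smooth_on (\<lambda>y. ?G (?F y)) ?T"
      by (rule smooth_on_compose[OF G smooth_on_subset[OF F T]]) auto
    fix y' assume "y' \<in> ?T"
    then obtain x' where "x' \<in> fst c" "f x' \<in> fst d" "y' = snd c x'" using T_eq by blast
    then show "?G (?F y') = (snd e \<circ> h \<circ> inv_into (fst c) (snd c)) y'"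
      using c \<B>[OF d(1)] h by (simp add: inv_into_f_f)
  qed
qed

text \<open>Compatibility is not transitive in general, as the middle chart may miss part of the
  overlap; a family that covers the overlap repairs this.\<close>

lemma compatible_trans_cover:
  fixes c :: "('a, 'e::euclidean_space) chart" and \<B> :: "('a, 'f::euclidean_space) chart set"
    and e :: "('a, 'g::euclidean_space) chart"
  assumes "inj_on (snd c) (fst c)" "inj_on (snd e) (fst e)" "\<And>d. d \<in> \<B> \<Longrightarrow> inj_on (snd d) (fst d)"
    and "fst c \<inter> fst e \<subseteq> (\<Union>d\<in>\<B>. fst d)"
    and "\<And>d. d \<in> \<B> \<Longrightarrow> compatible c d" "\<And>d. d \<in> \<B> \<Longrightarrow> compatible e d"
  shows "compatible c e"
proof -
  have "smooth_in_charts id c e"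
    by (rule smooth_in_charts_compose[where \<B>=\<B> and f=id and g=id])
      (use assms in \<open>auto simp: compatible_iff_smooth_in_charts\<close>)
  moreover have "smooth_in_charts id e c"
    by (rule smooth_in_charts_compose[where \<B>=\<B> and f=id and g=id])
      (use assms in \<open>auto simp: compatible_iff_smooth_in_charts\<close>)
  ultimately show ?thesis by (simp add: compatible_iff_smooth_in_charts)
qed

section \<open>The topology defined by an atlas\<close>

lemma openin_atlas_topology:
  assumes "\<And>c. c \<in> \<A> \<Longrightarrow> inj_on (snd c) (fst c)"
  shows "openin (atlas_topology X \<A>) W \<longleftrightarrow> W \<subseteq> X \<and> (\<forall>c\<in>\<A>. open (snd c ` (fst c \<inter> W)))"
proof -
  \<comment> \<open>\<open>topology\<close> has a meaning only for predicates that satisfy the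
    axioms. Closure under intersection is where injectivity of the charts enters, since images must
    commute with intersections.\<close>
  have "istopology (\<lambda>W. W \<subseteq> X \<and> (\<forall>c\<in>\<A>. open (snd c ` (fst c \<inter> W))))" (is "istopology ?P")
    unfolding istopology_def
  proof (rule conjI; intro allI impI)
    fix S T assume S: "?P S" and T: "?P T"
    have "snd c ` (fst c \<inter> (S \<inter> T)) = snd c ` (fst c \<inter> S) \<inter> snd c ` (fst c \<inter> T)"
      if "c \<in> \<A>" for c
      using assms[OF that] by (auto dest: inj_onD)
    then show "?P (S \<inter> T)" using S T by auto
  next
    fix \<K> assume "\<forall>K\<in>\<K>. ?P K"
    moreover have "snd c ` (fst c \<inter> \<Union>\<K>) = (\<Union>K\<in>\<K>. snd c ` (fst c \<inter> K))" for c
      by auto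
    ultimately show "?P (\<Union>\<K>)" by (metis (no_types, lifting) Union_least open_UN)
  qed
  then show ?thesis
    by (simp add: atlas_topology_def case_prod_unfold)
qed

lemma topspace_atlas_topology:
  assumes "\<And>c. c \<in> \<A> \<Longrightarrow> chart_on X c"
  shows "topspace (atlas_topology X \<A>) = X"
proof -
  have inj: "\<And>c. c \<in> \<A> \<Longrightarrow> inj_on (snd c) (fst c)" using assms by (simp add: chart_on_def)
  have "open (snd c ` (fst c \<inter> X))" if "c \<in> \<A>" for c
    using assms[OF that] by (simp add: chart_on_def Int_absorb2)
  then have "openin (atlas_topology X \<A>) X"
    by (simp add: openin_atlas_topology[OF inj])
  moreover have "topspace (atlas_topology X \<A>) \<subseteq> X"
    using openin_atlas_topology[OF inj] openin_topspace by metis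
  ultimately show ?thesis by (simp add: openin_subset subset_antisym)
qed

text \<open>Applied to a map and to its inverse, this gives a homeomorphism of the atlas topologies.
  Continuity is tested near each point, where the preimage of \<open>W\<close> is that of an open
  set under a local representative.\<close>

lemma continuous_map_smooth_map:
  assumes \<A>: "\<And>c. c \<in> \<A> \<Longrightarrow> chart_on X c" and \<B>: "\<And>d. d \<in> \<B> \<Longrightarrow> chart_on Y d"
    and cover: "(\<Union>d\<in>\<B>. fst d) = Y" and f: "smooth_map X \<A> Y \<B> f"
  shows "continuous_map (atlas_topology X \<A>) (atlas_topology Y \<B>) f"
proof -
  have top: "topspace (atlas_topology X \<A>) = X" "topspace (atlas_topology Y \<B>) = Y"
    using \<A> \<B> by (simp_all add: topspace_atlas_topology)
  show ?thesis
    unfolding continuous_map top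
  proof (rule conjI)
    have injA: "\<And>c. c \<in> \<A> \<Longrightarrow> inj_on (snd c) (fst c)"
      and injB: "\<And>c. c \<in> \<B> \<Longrightarrow> inj_on (snd c) (fst c)"
      using \<A> \<B> by (simp_all add: chart_on_def)
    show "f ` X \<subseteq> Y" using f by (simp add: smooth_map_def)
    show "\<forall>W. openin (atlas_topology Y \<B>) W \<longrightarrow> openin (atlas_topology X \<A>) {x \<in> X. f x \<in> W}"
    proof (intro allI impI)
      fix W assume W: "openin (atlas_topology Y \<B>) W"
      have "open (snd c ` (fst c \<inter> {x \<in> X. f x \<in> W}))" if c: "c \<in> \<A>" for c
      proof (subst open_subopen, intro ballI)
        fix y assume "y \<in> snd c ` (fst c \<inter> {x \<in> X. f x \<in> W})"
        then obtain x where x: "x \<in> fst c" "x \<in> X" "f x \<in> W" "y = snd c x" by auto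
        then obtain d where d: "d \<in> \<B>" "f x \<in> fst d"
          using f cover by (force simp: smooth_map_def)
        let ?F = "snd d \<circ> f \<circ> inv_into (fst c) (snd c)" and ?D = "snd c ` (fst c \<inter> f -` fst d)"
        let ?T = "?D \<inter> ?F -` (snd d ` (fst d \<inter> W))"
        have "smooth_on ?F ?D"
          using f c d by (simp add: smooth_map_iff_smooth_in_charts smooth_in_charts_def)
        moreover have "open (snd d ` (fst d \<inter> W))"
          using W d by (simp add: openin_atlas_topology[OF injB])
        ultimately have "open ?T" by (rule smooth_on_open_vimage)
        moreover have "y \<in> ?T" using x d injA[OF c] by (auto simp: inv_into_f_f)
        moreover have "?T \<subseteq> snd c ` (fst c \<inter> {x \<in> X. f x \<in> W})"
        proof
          fix y' assume y': "y' \<in> ?T"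
          then obtain x' where x': "x' \<in> fst c" "f x' \<in> fst d" "y' = snd c x'" by auto
          with y' have "snd d (f x') \<in> snd d ` (fst d \<inter> W)" using injA[OF c] by (auto simp: inv_into_f_f)
          then have "f x' \<in> W" using injB[OF d(1)] x' by (auto dest: inj_onD)
          then show "y' \<in> snd c ` (fst c \<inter> {x \<in> X. f x \<in> W})"
            using x' \<A>[OF c] by (auto simp: chart_on_def)
        qed
        ultimately show "\<exists>T. open T \<and> y \<in> T \<and> T \<subseteq> snd c ` (fst c \<inter> {x \<in> X. f x \<in> W})" by blast
      qed
      then show "openin (atlas_topology X \<A>) {x \<in> X. f x \<in> W}"
        by (auto simp: openin_atlas_topology[OF injA])
    qed
  qed
qed

text \<open>That \<open>X\<close> is a manifold is a conclusion here, not an assumption: its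
  coordinate changes factor through the charts of \<open>Y\<close>, and the two topological
  properties are invariant under homeomorphism.\<close>

lemma diffeomorphism_to_manifold:
  assumes Y: "smooth_manifold Y \<B>" and bij: "bij_betw f X Y"
    and \<A>: "\<And>c. c \<in> \<A> \<Longrightarrow> chart_on X c" and cover: "(\<Union>c\<in>\<A>. fst c) = X"
    and f: "\<And>c d. c \<in> \<A> \<Longrightarrow> d \<in> \<B> \<Longrightarrow> smooth_in_charts f c d"
    and g: "\<And>c d. c \<in> \<A> \<Longrightarrow> d \<in> \<B> \<Longrightarrow> smooth_in_charts (inv_into X f) d c"
  shows "diffeomorphism X \<A> Y \<B> f"
proof -
  have \<B>: "\<And>d. d \<in> \<B> \<Longrightarrow> chart_on Y d" and coverY: "(\<Union>d\<in>\<B>. fst d) = Y"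
    using Y by (auto simp: smooth_manifold_def smooth_atlas_def)
  have "f ` X = Y" using bij by (simp add: bij_betw_def)
  have f': "smooth_map X \<A> Y \<B> f"
    using f \<open>f ` X = Y\<close> by (simp add: smooth_map_iff_smooth_in_charts)
  have g': "smooth_map Y \<B> X \<A> (inv_into X f)"
    using g \<open>f ` X = Y\<close> by (auto simp: smooth_map_iff_smooth_in_charts inv_into_into)
  \<comment> \<open>The identity is factored as \<open>f\<close> followed by its inverse.\<close>
  have "smooth_in_charts id c c'" if "c \<in> \<A>" "c' \<in> \<A>" for c c'
  proof (rule smooth_in_charts_compose[where \<B>=\<B> and f=f and g="inv_into X f"])
    show "inj_on (snd c) (fst c)" using \<A> that by (simp add: chart_on_def)
    show "inj_on (snd d) (fst d)" if "d \<in> \<B>" for d using \<B> that by (simp add: chart_on_def)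
    show "id x = inv_into X f (f x)" if "x \<in> fst c" for x
      using that \<A>[OF \<open>c \<in> \<A>\<close>] bij by (auto simp: chart_on_def bij_betw_def intro!: inv_into_f_f[symmetric])
    show "\<exists>d\<in>\<B>. f x \<in> fst d" if "x \<in> fst c" for x
      using that cover coverY \<open>c \<in> \<A>\<close> \<open>f ` X = Y\<close> by fast
  qed (use f g that in auto)
  then have "smooth_atlas X \<A>"
    using \<A> cover by (simp add: smooth_atlas_def compatible_iff_smooth_in_charts)
  have "homeomorphic_maps (atlas_topology X \<A>) (atlas_topology Y \<B>) f (inv_into X f)"
    unfolding homeomorphic_maps_def
    using continuous_map_smooth_map[OF \<A> \<B> coverY f'] continuous_map_smooth_map[OF \<B> \<A> cover g'] bij
    by (auto simp: \<A> \<B> topspace_atlas_topology bij_betw_def inv_into_f_f f_inv_into_f)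
  then have "atlas_topology X \<A> homeomorphic_space atlas_topology Y \<B>"
    by (auto simp: homeomorphic_space_def)
  then have "smooth_manifold X \<A>"
    using Y \<open>smooth_atlas X \<A>\<close> homeomorphic_Hausdorff_space homeomorphic_space_second_countability
    by (auto simp: smooth_manifold_def)
  then show ?thesis using Y bij f' g' by (simp add: diffeomorphism_def)
qed

section \<open>Transport of charts along a bijection\<close>

lemma inv_into_transported:
  assumes "inj_on h X" "U \<subseteq> X" "inj_on \<phi> U" "x \<in> \<phi> ` U"
  shows "inv_into (h ` U) (\<phi> \<circ> inv_into X h) x = h (inv_into U \<phi> x)"
proof -
  from assms(4) obtain u where u: "u \<in> U" "x = \<phi> u" by auto
  have inv: "inv_into X h (h v) = v" if "v \<in> U" for v using that assms by (auto simp: inv_into_f_f)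
  have "inj_on (\<phi> \<circ> inv_into X h) (h ` U)"
    using assms(3) inv by (auto simp: inj_on_def)
  then have "inv_into (h ` U) (\<phi> \<circ> inv_into X h) ((\<phi> \<circ> inv_into X h) (h u)) = h u"
    using u by (intro inv_into_f_f) auto
  then show ?thesis using u inv assms(3) by (simp add: inv_into_f_f)
qed

text \<open>The charts of \<open>M\<close> are those of \<open>X\<close> precomposed with the
  inverse of \<open>h\<close>, so \<open>F\<close> has on them the same local representatives as
  \<open>f\<close> on the charts of \<open>X\<close>.\<close>

lemma diffeomorphism_transported:
  assumes "diffeomorphism X \<A> Y \<B> f" "bij_betw h X M" "\<And>x. x \<in> X \<Longrightarrow> F (h x) = f x"
  shows "diffeomorphism M (transported_atlas h X \<A>) Y \<B> F"
proof (rule diffeomorphism_to_manifold)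
  have \<A>: "\<And>c. c \<in> \<A> \<Longrightarrow> chart_on X c" and cover: "(\<Union>c\<in>\<A>. fst c) = X"
    and bij: "bij_betw f X Y"
    and Y: "smooth_manifold Y \<B>"
    using assms(1) by (auto simp: diffeomorphism_def smooth_manifold_def smooth_atlas_def)
  have inj: "inj_on h X" and im: "h ` X = M" using assms(2) by (auto simp: bij_betw_def)
  have inv: "inv_into X h (h x) = x" if "x \<in> X" for x using inj that by (simp add: inv_into_f_f)
  show "smooth_manifold Y \<B>" by fact
  show bijF: "bij_betw F M Y"
  proof -
    have "bij_betw (f \<circ> inv_into X h) M Y"
      using bij_betw_trans[OF bij_betw_inv_into[OF assms(2)] bij] .
    then show ?thesis
      by (rule bij_betw_cong[THEN iffD1, rotated]) (use assms(3) inv im in auto)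
  qed
  have invF: "inv_into M F y = h (inv_into X f y)" if "y \<in> Y" for y
  proof (rule inv_into_f_eq)
    show "inj_on F M" using bijF by (simp add: bij_betw_def)
    have "inv_into X f y \<in> X" using that bij by (auto simp: bij_betw_def inv_into_into)
    then show "h (inv_into X f y) \<in> M" "F (h (inv_into X f y)) = y"
      using im assms(3) bij that by (auto simp: bij_betw_def f_inv_into_f)
  qed
  show "chart_on M c" if "c \<in> transported_atlas h X \<A>" for c
  proof -
    from that obtain U \<phi> where c: "c = (h ` U, \<phi> \<circ> inv_into X h)" "(U, \<phi>) \<in> \<A>"
      by (auto simp: transported_atlas_def)
    then have U: "U \<subseteq> X" "inj_on \<phi> U" "open (\<phi> ` U)" using \<A>[OF c(2)] by (simp_all add: chart_on_def)
    have "(\<phi> \<circ> inv_into X h) ` h ` U = (\<lambda>u. \<phi> (inv_into X h (h u))) ` U"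
      by (simp add: image_image)
    also have "\<dots> = \<phi> ` U" using U inv by (intro image_cong) auto
    finally have "(\<phi> \<circ> inv_into X h) ` h ` U = \<phi> ` U" .
    moreover have "inj_on (\<phi> \<circ> inv_into X h) (h ` U)"
      using U(1,2) inv by (auto simp: inj_on_def subset_iff)
    ultimately show ?thesis using U im by (auto simp: chart_on_def c(1) simp del: image_comp)
  qed
  show "(\<Union>c\<in>transported_atlas h X \<A>. fst c) = M"
  proof -
    have "(\<Union>c\<in>transported_atlas h X \<A>. fst c) = h ` (\<Union>c\<in>\<A>. fst c)"
      by (force simp: transported_atlas_def)
    then show ?thesis using cover im by simp
  qed
  fix c d assume "c \<in> transported_atlas h X \<A>" and d: "d \<in> \<B>"
  then obtain U \<phi> where c: "c = (h ` U, \<phi> \<circ> inv_into X h)" and U\<phi>: "(U, \<phi>) \<in> \<A>"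
    by (auto simp: transported_atlas_def)
  then have U: "U \<subseteq> X" "inj_on \<phi> U" using \<A>[OF U\<phi>] by (simp_all add: chart_on_def)
  have "smooth_in_charts f (U, \<phi>) d" and g: "smooth_in_charts (inv_into X f) d (U, \<phi>)"
    using assms(1) U\<phi> d by (auto simp: diffeomorphism_def smooth_map_iff_smooth_in_charts)
  then have "smooth_on (snd d \<circ> f \<circ> inv_into U \<phi>) (\<phi> ` (U \<inter> f -` fst d))"
    by (simp add: smooth_in_charts_def)
  moreover have "(\<phi> \<circ> inv_into X h) ` (h ` U \<inter> F -` fst d) = \<phi> ` (U \<inter> f -` fst d)"
  proof -
    have "h ` U \<inter> F -` fst d = h ` (U \<inter> f -` fst d)" using assms(3) U by (auto simp: subset_iff)
    then have "(\<phi> \<circ> inv_into X h) ` (h ` U \<inter> F -` fst d) =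
        (\<lambda>u. \<phi> (inv_into X h (h u))) ` (U \<inter> f -` fst d)"
      by (simp add: image_image)
    also have "\<dots> = \<phi> ` (U \<inter> f -` fst d)" using U inv by (intro image_cong) auto
    finally show ?thesis .
  qed
  moreover have "(snd d \<circ> f \<circ> inv_into U \<phi>) x =
      (snd d \<circ> F \<circ> inv_into (h ` U) (\<phi> \<circ> inv_into X h)) x" if "x \<in> \<phi> ` (U \<inter> f -` fst d)" for x
  proof -
    have "x \<in> \<phi> ` U" using that by auto
    moreover from this have "inv_into U \<phi> x \<in> X" using U by (metis inv_into_into subsetD)
    ultimately show ?thesis using inv_into_transported[OF inj U] assms(3) by simp
  qed
  ultimately show "smooth_in_charts F c d"
    unfolding c smooth_in_charts_def fst_conv snd_conv by (metis smooth_on_cong)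
  have dY: "fst d \<subseteq> Y" and dinj: "inj_on (snd d) (fst d)"
    using Y d by (auto simp: smooth_manifold_def smooth_atlas_def chart_on_def)
  have invX: "inv_into X f y \<in> X" if "y \<in> fst d" for y
    using that dY bij by (auto simp: bij_betw_def inv_into_into)
  have "inv_into M F y \<in> h ` U \<longleftrightarrow> inv_into X f y \<in> U" if "y \<in> fst d" for y
    using that dY invF invX inj_on_image_mem_iff[OF inj _ U(1)] by (metis subsetD)
  then have "fst d \<inter> inv_into M F -` (h ` U) = fst d \<inter> inv_into X f -` U"
    by blast
  moreover have "(\<phi> \<circ> inv_into X f \<circ> inv_into (fst d) (snd d)) x =
      (\<phi> \<circ> inv_into X h \<circ> inv_into M F \<circ> inv_into (fst d) (snd d)) x"
    if "x \<in> snd d ` (fst d \<inter> inv_into X f -` U)" for x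
    using that dinj dY by (auto simp: inv_into_f_f invF inv invX subsetD)
  ultimately show "smooth_in_charts (inv_into M F) d c"
    using g unfolding c smooth_in_charts_def fst_conv snd_conv by (metis smooth_on_cong)
qed

text \<open>On \<open>S\<close> the coordinate change is the ambient one restricted to the plane of
  points \<open>(x, 0)\<close> and then projected to the plane. Flatness of \<open>\<phi>\<close>
  guarantees that a point of \<open>U\<close> with coordinates \<open>(x, 0)\<close> lies in
  \<open>S\<close>.\<close>

lemma smooth_in_charts_slice:
  fixes \<phi> \<kappa> :: "'a \<Rightarrow> (real \<times> real) \<times> real"
  assumes "smooth_in_charts id (U, \<phi>) (V, \<kappa>)" and inj: "inj_on \<phi> U"
    and flat: "\<phi> ` (U \<inter> S) = \<phi> ` U \<inter> (UNIV \<times> {0})"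
  shows "smooth_in_charts id (U \<inter> S, fst \<circ> \<phi>) (V \<inter> S, fst \<circ> \<kappa>)"
proof -
  let ?D = "UNIV \<inter> (\<lambda>x::real \<times> real. (x, 0::real)) -` (\<phi> ` (U \<inter> V))"
  have \<kappa>: "smooth_on (\<kappa> \<circ> inv_into U \<phi>) (\<phi> ` (U \<inter> V))"
    using assms(1) by (simp add: smooth_in_charts_def)
  have op: "open ?D"
    by (rule smooth_on_open_vimage) (use \<kappa> in \<open>auto intro!: smooth_on_intros simp: smooth_on_def[of "_ \<circ> _"]\<close>)
  have D_eq: "\<exists>P. P \<in> U \<inter> V \<inter> S \<and> \<phi> P = (x, 0)" if x: "x \<in> ?D" for x
  proof -
    from x obtain P where P: "P \<in> U" "P \<in> V" "(x, 0) = \<phi> P" by auto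
    then have "\<phi> P \<in> \<phi> ` (U \<inter> S)" unfolding flat by (metis IntI SigmaI UNIV_I imageI singletonI)
    then have "P \<in> S" using inj P by (auto dest: inj_onD)
    then show ?thesis using P by auto
  qed
  have snd0: "snd (\<phi> P) = 0" if "P \<in> U \<inter> S" for P
    using flat that by (metis IntD2 imageI mem_Times_iff singletonD)
  have inj': "inj_on (fst \<circ> \<phi>) (U \<inter> S)"
    using inj snd0 by (auto simp: inj_on_def prod_eq_iff)
  have "(fst \<circ> \<phi>) ` (U \<inter> S \<inter> id -` (V \<inter> S)) = ?D"
  proof (intro equalityI subsetI)
    fix x assume "x \<in> (fst \<circ> \<phi>) ` (U \<inter> S \<inter> id -` (V \<inter> S))"
    then obtain P where P: "P \<in> U" "P \<in> S" "P \<in> V" "x = fst (\<phi> P)" by auto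
    then have "(x, 0) = \<phi> P" using snd0 by (simp add: prod_eq_iff)
    then show "x \<in> ?D" using P by auto
  next
    fix x assume "x \<in> ?D"
    then obtain P where "P \<in> U \<inter> V \<inter> S" "\<phi> P = (x, 0)" using D_eq by blast
    then show "x \<in> (fst \<circ> \<phi>) ` (U \<inter> S \<inter> id -` (V \<inter> S))"
      by (intro image_eqI[of _ _ P]) auto
  qed
  moreover have "smooth_on (\<lambda>x. fst ((\<kappa> \<circ> inv_into U \<phi>) (x, 0))) ?D"
    by (intro smooth_on_fst smooth_on_compose[OF \<kappa>]) (use op in \<open>auto intro!: smooth_on_intros\<close>)
  then have "smooth_on (fst \<circ> \<kappa> \<circ> id \<circ> inv_into (U \<inter> S) (fst \<circ> \<phi>)) ?D"
  proof (rule smooth_on_cong)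
    fix x assume "x \<in> ?D"
    then obtain P where P: "P \<in> U \<inter> V \<inter> S" "\<phi> P = (x, 0)" using D_eq by blast
    have "inv_into U \<phi> (x, 0) = P" using P inj by (intro inv_into_f_eq) auto
    moreover have "inv_into (U \<inter> S) (fst \<circ> \<phi>) x = P" using P inj' by (intro inv_into_f_eq) auto
    ultimately show "fst ((\<kappa> \<circ> inv_into U \<phi>) (x, 0)) = (fst \<circ> \<kappa> \<circ> id \<circ> inv_into (U \<inter> S) (fst \<circ> \<phi>)) x"
      by simp
  qed
  ultimately show ?thesis by (simp add: smooth_in_charts_def)
qed


section \<open>The cylinder\<close>

lemma circle_point_eq_iff: "circle_point s = circle_point t \<longleftrightarrow> (\<exists>k::int. s = t + 2 * of_int k)"
proof
  assume "circle_point s = circle_point t"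
  moreover have "s \<in> circle_point s"
    unfolding circle_point_def by (intro CollectI exI[of _ 0]) simp
  ultimately show "\<exists>k::int. s = t + 2 * of_int k" by (simp add: circle_point_def)
next
  assume "\<exists>k::int. s = t + 2 * of_int k"
  then obtain k :: int where k: "s = t + 2 * of_int k" by blast
  show "circle_point s = circle_point t"
    unfolding circle_point_def
  proof (intro Collect_cong iffI)
    fix u
    show "\<exists>j::int. u = t + 2 * of_int j" if "\<exists>j::int. u = s + 2 * of_int j"
      using that k by (metis add.assoc distrib_left of_int_add)
    show "\<exists>j::int. u = s + 2 * of_int j" if "\<exists>j::int. u = t + 2 * of_int j"
    proof -
      from that obtain j :: int where "u = t + 2 * of_int j" by blast
      then have "u = s + 2 * of_int (j - k)" using k by simp
      then show ?thesis by blast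
    qed
  qed
qed

text \<open>Over \<open>UNIV \<times> {0<..<1}\<close> this is the universal covering of the
  cylinder; the charts of \<open>cylinder_atlas\<close> are its local inverses on strips of width
  2.\<close>

definition cylinder_proj :: "real \<times> real \<Rightarrow> real set \<times> real" where
  "cylinder_proj = (\<lambda>(s, d). (circle_point s, d))"

definition strip :: "real \<Rightarrow> (real \<times> real) set" where
  "strip c = {c<..<c + 2} \<times> {0<..<1}"

definition cylinder_chart :: "real \<Rightarrow> (real set \<times> real, real \<times> real) chart" where
  "cylinder_chart c = (cylinder_proj ` strip c, map_prod (\<lambda>P. the_elem (P \<inter> {c<..<c + 2})) id)"

lemma open_strip: "open (strip c)"
  by (simp add: strip_def open_Times)

lemma cylinder_atlas_eq: "cylinder_atlas = range cylinder_chart"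
proof -
  have "cylinder_proj ` strip c = circle_point ` {c<..<c + 2} \<times> {0<..<1}" for c
    by (auto simp: cylinder_proj_def strip_def)
  then show ?thesis
    by (auto simp: cylinder_atlas_def product_atlas_def circle_atlas_def cylinder_chart_def)
qed

lemma cylinder_eq: "cylinder = cylinder_proj ` (UNIV \<times> {0<..<1})"
  by (force simp: cylinder_def circle_def cylinder_proj_def)

lemma cylinder_chart_cylinder_proj:
  assumes "y \<in> strip c"
  shows "snd (cylinder_chart c) (cylinder_proj y) = y"
proof -
  obtain s d where y: "y = (s, d)" by fastforce
  have "circle_point s \<inter> {c<..<c + 2} = {s}"
  proof (intro equalityI subsetI)
    fix u assume "u \<in> circle_point s \<inter> {c<..<c + 2}"
    then obtain k :: int where k: "u = s + 2 * of_int k" "c < u" "u < c + 2"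
      by (auto simp: circle_point_def)
    moreover have "c < s" "s < c + 2" using assms y by (auto simp: strip_def)
    \<comment> \<open>Two points of an open interval of length 2 differ by less than 2, and the
      difference is \<open>2 * k\<close>.\<close>
    ultimately have "\<bar>real_of_int k\<bar> < 1" by linarith
    then have "k = 0" by linarith
    then show "u \<in> {s}" using k by simp
  next
    fix u assume "u \<in> {s}"
    moreover have "s \<in> circle_point s"
      unfolding circle_point_def by (intro CollectI exI[of _ 0]) simp
    ultimately show "u \<in> circle_point s \<inter> {c<..<c + 2}" using assms y by (auto simp: strip_def)
  qed
  then show ?thesis by (simp add: cylinder_chart_def cylinder_proj_def y)
qed

lemma fst_cylinder_chart: "fst (cylinder_chart c) = cylinder_proj ` strip c"
  by (simp add: cylinder_chart_def)

lemma inj_on_cylinder_chart: "inj_on (snd (cylinder_chart c)) (fst (cylinder_chart c))"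
  by (rule inj_on_inverseI[of _ cylinder_proj]) (auto simp: fst_cylinder_chart cylinder_chart_cylinder_proj)

lemma inv_into_cylinder_chart:
  assumes "y \<in> strip c"
  shows "inv_into (fst (cylinder_chart c)) (snd (cylinder_chart c)) y = cylinder_proj y"
  using assms by (intro inv_into_f_eq inj_on_cylinder_chart) (auto simp: fst_cylinder_chart cylinder_chart_cylinder_proj)

lemma cylinder_chart_image_Int:
  "snd (cylinder_chart c) ` (fst (cylinder_chart c) \<inter> W) = strip c \<inter> cylinder_proj -` W"
proof (intro equalityI subsetI)
  fix y assume "y \<in> snd (cylinder_chart c) ` (fst (cylinder_chart c) \<inter> W)"
  then obtain z where "z \<in> strip c" "cylinder_proj z \<in> W" "y = snd (cylinder_chart c) (cylinder_proj z)"
    unfolding fst_cylinder_chart by blast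
  then show "y \<in> strip c \<inter> cylinder_proj -` W" by (simp add: cylinder_chart_cylinder_proj)
next
  fix y assume "y \<in> strip c \<inter> cylinder_proj -` W"
  then show "y \<in> snd (cylinder_chart c) ` (fst (cylinder_chart c) \<inter> W)"
    by (intro image_eqI[of _ _ "cylinder_proj y"]) (auto simp: cylinder_chart_cylinder_proj fst_cylinder_chart)
qed

lemma cylinder_chart_image: "snd (cylinder_chart c) ` fst (cylinder_chart c) = strip c"
  using cylinder_chart_image_Int[of c UNIV] by simp

lemma strip_subset: "strip c \<subseteq> UNIV \<times> {0<..<1}" and UN_strip: "(\<Union>c. strip c) = UNIV \<times> {0<..<1}"
proof -
  show "strip c \<subseteq> UNIV \<times> {0<..<1}" for c by (auto simp: strip_def)
  have "(s, d) \<in> strip (s - 1)" if "d \<in> {0<..<1}" for s d using that by (simp add: strip_def)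
  then show "(\<Union>c. strip c) = UNIV \<times> {0<..<1}" by (fastforce simp: strip_def)
qed

lemma chart_on_cylinder_chart: "chart_on cylinder (cylinder_chart c)"
  unfolding chart_on_def cylinder_chart_image
  using strip_subset inj_on_cylinder_chart[of c] open_strip by (auto simp: fst_cylinder_chart cylinder_eq)

section \<open>Topology and smooth structure of the cylinder\<close>

lemma cylinder_proj_eq_iff:
  "cylinder_proj (s, d) = cylinder_proj (t, e) \<longleftrightarrow> (\<exists>k::int. s = t + 2 * of_int k) \<and> d = e"
  by (simp add: cylinder_proj_def circle_point_eq_iff)

text \<open>The atlas topology is the quotient topology of the covering, so openness can be decided
  in the plane.\<close>

lemma open_cylinder_iff:
  "openin (atlas_topology cylinder cylinder_atlas) W \<longleftrightarrow>
     W \<subseteq> cylinder \<and> open ((UNIV \<times> {0<..<1}) \<inter> cylinder_proj -` W)"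
proof -
  have "(\<forall>c. open (strip c \<inter> cylinder_proj -` W)) \<longleftrightarrow> open ((UNIV \<times> {0<..<1}) \<inter> cylinder_proj -` W)"
  proof
    assume "\<forall>c. open (strip c \<inter> cylinder_proj -` W)"
    moreover have "(UNIV \<times> {0<..<1}) \<inter> cylinder_proj -` W = (\<Union>c. strip c \<inter> cylinder_proj -` W)"
      using UN_strip by auto
    ultimately show "open ((UNIV \<times> {0<..<1}) \<inter> cylinder_proj -` W)" by (metis open_UN)
  next
    assume *: "open ((UNIV \<times> {0<..<1}) \<inter> cylinder_proj -` W)"
    have "strip c \<inter> cylinder_proj -` W = strip c \<inter> ((UNIV \<times> {0<..<1}) \<inter> cylinder_proj -` W)" for c
      using strip_subset by auto
    then show "\<forall>c. open (strip c \<inter> cylinder_proj -` W)" using * open_strip by (metis open_Int)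
  qed
  then show ?thesis
    by (subst openin_atlas_topology) (auto simp: cylinder_atlas_eq inj_on_cylinder_chart cylinder_chart_image_Int)
qed

text \<open>A coordinate change is locally a translation by \<open>(2 * k, 0)\<close>. The overlap
  of two charts may have two components with different \<open>k\<close>, hence the local
  criterion.\<close>

lemma smooth_atlas_cylinder: "smooth_atlas cylinder cylinder_atlas"
proof -
  have "smooth_in_charts id (cylinder_chart c) (cylinder_chart c')" for c c'
    unfolding smooth_in_charts_def
  proof (rule smooth_on_locally)
    have dom: "snd (cylinder_chart c) ` (fst (cylinder_chart c) \<inter> id -` fst (cylinder_chart c')) =
        strip c \<inter> cylinder_proj -` (cylinder_proj ` strip c')"
      by (subst cylinder_chart_image_Int) (simp add: fst_cylinder_chart)
    fix y assume "y \<in> snd (cylinder_chart c) ` (fst (cylinder_chart c) \<inter> id -` fst (cylinder_chart c'))"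
    then have y: "y \<in> strip c" "cylinder_proj y \<in> cylinder_proj ` strip c'"
      unfolding dom by blast+
    then obtain y' where "y' \<in> strip c'" "cylinder_proj y' = cylinder_proj y" by auto
    then obtain k :: int where k: "(fst y + 2 * of_int k, snd y) \<in> strip c'"
      by (cases y; cases y') (auto simp: cylinder_proj_eq_iff)
    let ?g = "\<lambda>y. (fst y + 2 * of_int k, snd y) :: real \<times> real"
    have pg: "cylinder_proj (?g z) = cylinder_proj z" for z
      by (cases z) (auto simp: cylinder_proj_eq_iff)
    let ?T = "strip c \<inter> ?g -` strip c'"
    have sm: "smooth_on ?g (strip c)"
      by (intro smooth_on_intros open_strip)
    show "\<exists>T g. y \<in> T \<and> T \<subseteq> snd (cylinder_chart c) ` (fst (cylinder_chart c) \<inter> id -` fst (cylinder_chart c')) \<and>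
       smooth_on g T \<and>
       (\<forall>z\<in>T. g z = (snd (cylinder_chart c') \<circ> id \<circ> inv_into (fst (cylinder_chart c)) (snd (cylinder_chart c))) z)"
    proof (intro exI conjI ballI)
      show "y \<in> ?T" using y k by simp
      show "?T \<subseteq> snd (cylinder_chart c) ` (fst (cylinder_chart c) \<inter> id -` fst (cylinder_chart c'))"
        unfolding dom using pg by (metis (no_types, lifting) IntE IntI image_eqI subsetI vimageE vimageI)
      show "smooth_on ?g ?T"
        by (intro smooth_on_subset[OF sm] smooth_on_open_vimage[OF sm] open_strip) auto
      fix z assume z: "z \<in> ?T"
      then show "?g z = (snd (cylinder_chart c') \<circ> id \<circ> inv_into (fst (cylinder_chart c)) (snd (cylinder_chart c))) z"
        using cylinder_chart_cylinder_proj[of "?g z" c'] by (simp add: inv_into_cylinder_chart pg)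
    qed
  qed
  moreover have "(\<Union>c. fst (cylinder_chart c)) = cylinder"
    unfolding fst_cylinder_chart cylinder_eq UN_strip[symmetric] by auto
  ultimately show ?thesis
    by (simp add: smooth_atlas_def compatible_iff_smooth_in_charts cylinder_atlas_eq chart_on_cylinder_chart)
qed

text \<open>Parallel unit vectors are equal or opposite, and the parity of \<open>k\<close> records
  which. This is the source of every integer ambiguity of the angles.\<close>

lemma sin_cos_pi_eq:
  assumes "sin (pi * x) = t * sin (pi * y)" "cos (pi * x) = t * cos (pi * y)"
  obtains k :: int where "x = y + of_int k" "t = (if even k then 1 else - 1)"
proof -
  have "sin (pi * (x - y)) = 0"
    using assms by (simp add: right_diff_distrib sin_diff)
  then obtain k :: int where k: "pi * (x - y) = of_int k * pi" by (auto simp: sin_zero_iff_int2)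
  then have "pi * x = pi * (y + of_int k)" by (simp add: algebra_simps)
  then have x: "x = y + of_int k" by simp
  have "cos (pi * (x - y)) = t * ((sin (pi * y))\<^sup>2 + (cos (pi * y))\<^sup>2)"
    by (simp only: right_diff_distrib cos_diff assms) algebra
  then have "t = cos (pi * (x - y))" by simp
  also have "\<dots> = cos (of_int k * pi)" by (simp only: k)
  also have "\<dots> = (if even k then 1 else - 1)"
  proof (cases "even k")
    case True
    then obtain j where "k = 2 * j" by (elim evenE)
    then have eq: "of_int k * pi = 2 * pi * of_int j" by simp
    show ?thesis unfolding eq using True cos_int_2pin[of j] by simp
  next
    case False
    then obtain j where "k = 2 * j + 1" by (elim oddE)
    then have eq: "of_int k * pi = 2 * pi * of_int j + pi" by (simp add: algebra_simps)
    show ?thesis unfolding eq cos_periodic_pi using False cos_int_2pin[of j] by simp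
  qed
  finally show thesis using that x by blast
qed

text \<open>Hausdorff because the map \<open>H\<close>, which places the cylinder in euclidean space
  as circle times interval, is continuous and injective. Second countable because the covering is an
  open map, so the images of a countable base of the plane form a base.\<close>

lemma smooth_manifold_cylinder: "smooth_manifold cylinder cylinder_atlas"
proof -
  let ?X = "atlas_topology cylinder cylinder_atlas"
  let ?I = "(UNIV :: real set) \<times> {0<..<1::real}"
  have top: "topspace ?X = cylinder"
    using smooth_atlas_cylinder by (intro topspace_atlas_topology) (auto simp: smooth_atlas_def)
  \<comment> \<open>On a coset the 2-periodic pair of functions takes a single value, which
    \<open>the_elem\<close> extracts.\<close>
  define H where "H = (\<lambda>(P, d::real). (the_elem ((\<lambda>x. (cos (pi * x), sin (pi * x))) ` P), d))"
  have H: "H (cylinder_proj (s, d)) = ((cos (pi * s), sin (pi * s)), d)" for s d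
  proof -
    have per: "(cos (pi * (s + 2 * of_int k)), sin (pi * (s + 2 * of_int k))) = (cos (pi * s), sin (pi * s))"
      for k :: int
    proof -
      have "pi * (s + 2 * of_int k) = pi * s + 2 * pi * of_int k" by (simp add: algebra_simps)
      then show ?thesis
        by (simp add: sin_add cos_add cos_int_2pin sin_int_2pin del: mult.assoc)
    qed
    have "(\<lambda>x. (cos (pi * x), sin (pi * x))) ` circle_point s = {(cos (pi * s), sin (pi * s))}"
    proof -
      have "s \<in> circle_point s"
        unfolding circle_point_def by (intro CollectI exI[of _ 0]) simp
      then show ?thesis using per by (auto simp: circle_point_def)
    qed
    then show ?thesis by (simp add: H_def cylinder_proj_def)
  qed
  have "inj_on H cylinder"
    unfolding cylinder_eq
  proof (clarsimp simp: inj_on_def H cylinder_proj_eq_iff)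
    fix s t assume "cos (pi * s) = cos (pi * t)" "sin (pi * s) = sin (pi * t)"
    then obtain k :: int where "s = t + of_int k" "even k"
      using sin_cos_pi_eq[of s 1 t] by (metis one_neq_neg_one mult_1)
    then show "\<exists>k::int. s = t + 2 * of_int k" by (auto elim!: evenE)
  qed
  moreover have "continuous_map ?X euclidean H"
    unfolding continuous_map top
  proof (intro conjI allI impI)
    fix V :: "((real \<times> real) \<times> real) set" assume "openin euclidean V"
    then have "open V" by simp
    have im: "H (cylinder_proj x) = ((cos (pi * fst x), sin (pi * fst x)), snd x)" for x
      by (cases x) (simp add: H)
    have "open ((\<lambda>y. ((cos (pi * fst y), sin (pi * fst y)), snd y)) -` V)"
      by (intro open_vimage \<open>open V\<close> continuous_intros)
    then have "open (?I \<inter> (\<lambda>y. ((cos (pi * fst y), sin (pi * fst y)), snd y)) -` V)"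
      by (intro open_Int open_Times) auto
    also have "?I \<inter> (\<lambda>y. ((cos (pi * fst y), sin (pi * fst y)), snd y)) -` V =
        ?I \<inter> cylinder_proj -` {x \<in> cylinder. H x \<in> V}"
      unfolding cylinder_eq by (intro set_eqI iffI) (simp_all add: im)
    finally show "openin ?X {x \<in> cylinder. H x \<in> V}"
      by (simp add: open_cylinder_iff)
  qed simp
  ultimately have "Hausdorff_space ?X"
    by (intro Hausdorff_space_injective_preimage[of euclidean _ H]) (simp_all add: top)
  moreover have "second_countable ?X"
  proof -
    obtain B :: "(real \<times> real) set set" where B: "countable B" "\<And>b. b \<in> B \<Longrightarrow> open b"
      and base: "\<And>S. open S \<Longrightarrow> \<exists>U. U \<subseteq> B \<and> S = \<Union>U"
      using univ_second_countable by blast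
    \<comment> \<open>The covering is open: the preimage of the image of a set is the union of its
      translates by \<open>(2 * k, 0)\<close>.\<close>
    have "openin ?X (cylinder_proj ` (?I \<inter> b))" if "b \<in> B" for b
    proof -
      have "open ((\<lambda>y. (fst y + 2 * of_int k, snd y)) -` (?I \<inter> b))" for k :: int
        using B(2)[OF that] by (intro open_vimage open_Int open_Times continuous_intros) auto
      then have "open (\<Union>k::int. (\<lambda>y. (fst y + 2 * of_int k, snd y)) -` (?I \<inter> b))" by blast
      also have "(\<Union>k::int. (\<lambda>y. (fst y + 2 * of_int k, snd y)) -` (?I \<inter> b)) =
          ?I \<inter> cylinder_proj -` (cylinder_proj ` (?I \<inter> b))"
      proof (intro equalityI subsetI)
        fix y assume "y \<in> (\<Union>k::int. (\<lambda>y. (fst y + 2 * of_int k, snd y)) -` (?I \<inter> b))"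
        then obtain k :: int where k: "(fst y + 2 * of_int k, snd y) \<in> ?I \<inter> b" by auto
        moreover have "cylinder_proj y = cylinder_proj (fst y + 2 * of_int k, snd y)"
          by (cases y) (auto simp: cylinder_proj_eq_iff intro!: exI[of _ "- k"])
        ultimately show "y \<in> ?I \<inter> cylinder_proj -` (cylinder_proj ` (?I \<inter> b))"
          by (cases y) auto
      next
        fix y assume "y \<in> ?I \<inter> cylinder_proj -` (cylinder_proj ` (?I \<inter> b))"
        then obtain z where z: "z \<in> ?I \<inter> b" "cylinder_proj z = cylinder_proj y" by auto
        then obtain k :: int where "z = (fst y + 2 * of_int k, snd y)"
          by (cases y; cases z) (auto simp: cylinder_proj_eq_iff)
        then show "y \<in> (\<Union>k::int. (\<lambda>y. (fst y + 2 * of_int k, snd y)) -` (?I \<inter> b))"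
          using z by auto
      qed
      finally show ?thesis by (subst open_cylinder_iff) (auto simp: cylinder_eq)
    qed
    moreover have "\<exists>V\<in>(\<lambda>b. cylinder_proj ` (?I \<inter> b)) ` B. x \<in> V \<and> V \<subseteq> W"
      if W: "openin ?X W" and "x \<in> W" for W x
    proof -
      have "open (?I \<inter> cylinder_proj -` W)" and "W \<subseteq> cylinder"
        using W unfolding open_cylinder_iff by simp_all
      then have "x \<in> cylinder_proj ` ?I" using \<open>x \<in> W\<close> unfolding cylinder_eq by auto
      then obtain y where y: "y \<in> ?I" "x = cylinder_proj y" by auto
      obtain U where U: "U \<subseteq> B" "?I \<inter> cylinder_proj -` W = \<Union>U"
        using base[OF \<open>open (?I \<inter> cylinder_proj -` W)\<close>] by auto
      have "y \<in> ?I \<inter> cylinder_proj -` W" using y \<open>x \<in> W\<close> by simp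
      then have "y \<in> \<Union>U" using U by simp
      then obtain b where b: "b \<in> U" "y \<in> b" by blast
      then have "b \<subseteq> ?I \<inter> cylinder_proj -` W" unfolding U by auto
      moreover have "b \<in> B" using b U by auto
      ultimately show ?thesis using b y by (intro bexI[of _ "cylinder_proj ` (?I \<inter> b)"]) auto
    qed
    ultimately show ?thesis
      unfolding second_countable_def
      using B(1) by (intro exI[of _ "(\<lambda>b. cylinder_proj ` (?I \<inter> b)) ` B"]) auto
  qed
  ultimately show ?thesis
    using smooth_atlas_cylinder by (simp add: smooth_manifold_def)
qed


section \<open>Polar charts of projective space\<close>

lemma proj_point_eq_iff: "proj_point v = proj_point w \<longleftrightarrow> (\<exists>t. t \<noteq> 0 \<and> v = t *\<^sub>R w)"
proof
  assume "proj_point v = proj_point w"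
  moreover have "v \<in> proj_point v"
    unfolding proj_point_def by (intro CollectI exI[of _ 1]) simp
  ultimately show "\<exists>t. t \<noteq> 0 \<and> v = t *\<^sub>R w" by (auto simp: proj_point_def)
next
  assume "\<exists>t. t \<noteq> 0 \<and> v = t *\<^sub>R w"
  then obtain t where t: "t \<noteq> 0" "v = t *\<^sub>R w" by blast
  show "proj_point v = proj_point w"
    unfolding proj_point_def
  proof (intro Collect_cong iffI)
    fix u
    show "\<exists>r. u = r *\<^sub>R w \<and> r \<noteq> 0" if "\<exists>r. u = r *\<^sub>R v \<and> r \<noteq> 0"
      using that t by (metis mult_eq_0_iff scaleR_scaleR)
    show "\<exists>r. u = r *\<^sub>R v \<and> r \<noteq> 0" if "\<exists>r. u = r *\<^sub>R w \<and> r \<noteq> 0"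
    proof -
      from that obtain r where "u = r *\<^sub>R w" "r \<noteq> 0" by blast
      then have "u = (r / t) *\<^sub>R v \<and> r / t \<noteq> 0" using t by simp
      then show ?thesis by blast
    qed
  qed
qed

lemma on_points_proj_point:
  assumes "\<And>t. t \<noteq> 0 \<Longrightarrow> g (t *\<^sub>R v) = g v"
  shows "on_points g (proj_point v) = g v"
proof -
  have "v \<in> proj_point v"
    unfolding proj_point_def by (intro CollectI exI[of _ 1]) simp
  then have "g ` proj_point v = {g v}" using assms by (auto simp: proj_point_def)
  then show ?thesis by (simp add: on_points_def)
qed

text \<open>The coordinates are \<open>\<theta> + \<eta>\<close>, \<open>\<theta> - \<eta>\<close> and the ratio of the lengths of \<open>(B, D)\<close> and \<open>(A, C)\<close>
  minus one.\<close>

definition polar_param :: "(real \<times> real) \<times> real \<Rightarrow> homogeneous" where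
  "polar_param y = (sin (pi * ((fst (fst y) + snd (fst y)) / 2)),
            (1 + snd y) * sin (pi * ((fst (fst y) - snd (fst y)) / 2)),
            cos (pi * ((fst (fst y) + snd (fst y)) / 2)),
            (1 + snd y) * cos (pi * ((fst (fst y) - snd (fst y)) / 2)))"

text \<open>The bound on the third coordinate keeps the ratio of lengths \<open>1 + snd y\<close>
  positive, so that its sign cannot be traded against a half turn of the second angle. The surface
  of canonical forms is at height 0.\<close>

definition slab :: "real \<Rightarrow> ((real \<times> real) \<times> real) set" where
  "slab c = strip c \<times> {- 1<..}"

definition rp_chart :: "real \<Rightarrow> (homogeneous set, (real \<times> real) \<times> real) chart" where
  "rp_chart c = ((proj_point \<circ> polar_param) ` slab c, inv_into (slab c) (proj_point \<circ> polar_param))"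

lemma open_slab: "open (slab c)"
  by (simp add: slab_def open_Times open_strip)

lemma smooth_on_polar_param: "open S \<Longrightarrow> smooth_on polar_param S"
  unfolding polar_param_def by (intro smooth_on_intros) auto

text \<open>By \<open>sin_cos_pi_eq\<close> the factors of both vectors are 1 or -1, so the positive
  ratio \<open>(1 + u') / (1 + u)\<close> is 1. The two angles shift by integers \<open>k\<close>
  and \<open>l\<close>, and \<open>d - d' = k - l\<close> has absolute value below 1, so they shift
  together.\<close>

lemma polar_param_eq_scaleR:
  assumes eq: "polar_param ((s, d), u) = t *\<^sub>R polar_param ((s', d'), u')"
    and d: "d \<in> {0<..<1}" "d' \<in> {0<..<1}" and u: "u > - 1" "u' > - 1"
  obtains k :: int where "s = s' + 2 * of_int k" "d = d'" "u = u'"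
proof -
  obtain k :: int where k: "(s + d) / 2 = (s' + d') / 2 + of_int k" "t = (if even k then 1 else - 1)"
    using eq by (auto simp: polar_param_def intro: sin_cos_pi_eq[of "(s + d) / 2" t "(s' + d') / 2"])
  have "sin (pi * ((s - d) / 2)) = (t * (1 + u') / (1 + u)) * sin (pi * ((s' - d') / 2))"
    and "cos (pi * ((s - d) / 2)) = (t * (1 + u') / (1 + u)) * cos (pi * ((s' - d') / 2))"
    using eq u by (auto simp: polar_param_def field_simps)
  then obtain l :: int where l: "(s - d) / 2 = (s' - d') / 2 + of_int l"
      "t * (1 + u') / (1 + u) = (if even l then 1 else - 1)"
    by (rule sin_cos_pi_eq)
  have "u = u' \<and> (even k \<longleftrightarrow> even l)"
    using l(2) k(2) u by (auto simp: field_simps split: if_splits)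
  then have "u = u'" and polar_param: "even (k - l)" by auto
  have "d - d' = of_int (k - l)" using k(1) l(1) by (simp add: field_simps)
  moreover have "\<bar>d - d'\<bar> < 1" using d by auto
  ultimately have "k = l" by linarith
  then show thesis using that[of k] k(1) l(1) \<open>u = u'\<close> by (simp add: field_simps)
qed

lemma inj_on_proj_polar_param: "inj_on (proj_point \<circ> polar_param) (slab c)"
proof (rule inj_onI)
  fix y y' assume y: "y \<in> slab c" "y' \<in> slab c" and eq: "(proj_point \<circ> polar_param) y = (proj_point \<circ> polar_param) y'"
  obtain s d u s' d' u' where [simp]: "y = ((s, d), u)" "y' = ((s', d'), u')" by (metis surj_pair)
  obtain t where "polar_param y = t *\<^sub>R polar_param y'" using eq by (auto simp: proj_point_eq_iff)
  then obtain k :: int where k: "s = s' + 2 * of_int k" "d = d'" "u = u'"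
    using y polar_param_eq_scaleR[of s d u t s' d' u'] by (auto simp: slab_def strip_def)
  then have "\<bar>2 * real_of_int k\<bar> < 2" using y by (auto simp: slab_def strip_def)
  then have "k = 0" by linarith
  then show "y = y'" using k by simp
qed

lemma rp_chart_simps:
  "fst (rp_chart c) = (proj_point \<circ> polar_param) ` slab c"
  "y \<in> slab c \<Longrightarrow> snd (rp_chart c) (proj_point (polar_param y)) = y"
  using inv_into_f_f[OF inj_on_proj_polar_param, of y c] by (auto simp: rp_chart_def)

lemma inj_on_rp_chart: "inj_on (snd (rp_chart c)) (fst (rp_chart c))"
  by (rule inj_on_inverseI[of _ "proj_point \<circ> polar_param"]) (auto simp: rp_chart_simps)

lemma rp_chart_image_Int:
  "snd (rp_chart c) ` (fst (rp_chart c) \<inter> W) = slab c \<inter> (proj_point \<circ> polar_param) -` W"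
proof (intro equalityI subsetI)
  fix y assume "y \<in> snd (rp_chart c) ` (fst (rp_chart c) \<inter> W)"
  then obtain z where "z \<in> slab c" "proj_point (polar_param z) \<in> W" "y = snd (rp_chart c) (proj_point (polar_param z))"
    unfolding rp_chart_simps(1) by auto
  then show "y \<in> slab c \<inter> (proj_point \<circ> polar_param) -` W" by (simp add: rp_chart_simps)
next
  fix y assume "y \<in> slab c \<inter> (proj_point \<circ> polar_param) -` W"
  then show "y \<in> snd (rp_chart c) ` (fst (rp_chart c) \<inter> W)"
    by (intro image_eqI[of _ _ "proj_point (polar_param y)"]) (auto simp: rp_chart_simps)
qed

lemma inv_into_rp_chart:
  assumes "y \<in> slab c"
  shows "inv_into (fst (rp_chart c)) (snd (rp_chart c)) y = proj_point (polar_param y)"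
  using assms by (intro inv_into_f_eq inj_on_rp_chart) (auto simp: rp_chart_simps)

lemma polar_param_nonzero: "polar_param y \<noteq> 0"
proof
  define x where "x = pi * ((fst (fst y) + snd (fst y)) / 2)"
  have "fst (polar_param y) = sin x" "fst (snd (snd (polar_param y))) = cos x" by (simp_all add: polar_param_def x_def)
  moreover assume "polar_param y = 0"
  ultimately show False using sin_cos_squared_add[of x] by simp
qed

lemma chart_on_rp_chart: "chart_on proj_space (rp_chart c)"
  using rp_chart_image_Int[of c UNIV] open_slab[of c] inj_on_rp_chart[of c] polar_param_nonzero
  by (auto simp: chart_on_def rp_chart_simps(1) proj_space_def)

text \<open>The branch \<open>\<phi>\<close> of the polar angle close to a given angle \<open>\<alpha>\<close> is a smooth function of the
  vector; the radius \<open>R\<close> is negative if the vector is nearly opposite to the direction \<open>\<alpha>\<close>.\<close>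

lemma polar_angle_near:
  fixes A C \<alpha> :: real
  defines "a \<equiv> A * sin \<alpha> + C * cos \<alpha>" and "b \<equiv> A * cos \<alpha> - C * sin \<alpha>"
  defines "\<phi> \<equiv> \<alpha> + arctan (b / a)"
  defines "R \<equiv> A * sin \<phi> + C * cos \<phi>"
  assumes a: "a \<noteq> 0"
  shows "R \<noteq> 0" "A = R * sin \<phi>" "C = R * cos \<phi>"
proof -
  define \<tau> where "\<tau> = arctan (b / a)"
  have cs: "(sin x)\<^sup>2 + (cos x)\<^sup>2 = 1" for x :: real by simp
  have "sin \<tau> = (b / a) * cos \<tau>"
    using tan_arctan[of "b / a"] cos_arctan_not_zero[of "b / a"] by (simp add: \<tau>_def tan_def field_simps)
  then have \<tau>: "a * sin \<tau> = b * cos \<tau>" using a by (simp add: field_simps)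
  \<comment> \<open>\<open>a\<close> and \<open>b\<close> are the components of
    \<open>(A, C)\<close> along the direction of angle \<alpha> and perpendicular to it, so \<tau>
    is the deviation of the vector's line from that direction.\<close>
  have A: "A = a * sin \<alpha> + b * cos \<alpha>" and C: "C = a * cos \<alpha> - b * sin \<alpha>"
    using cs[of \<alpha>] unfolding a_def b_def by algebra+
  have \<phi>: "sin \<phi> = sin \<alpha> * cos \<tau> + cos \<alpha> * sin \<tau>" "cos \<phi> = cos \<alpha> * cos \<tau> - sin \<alpha> * sin \<tau>"
    by (simp_all add: \<phi>_def \<tau>_def sin_add cos_add)
  have 0: "A * cos \<phi> = C * sin \<phi>"
    unfolding A C \<phi> using \<tau> cs[of \<alpha>] by algebra
  show "A = R * sin \<phi>" "C = R * cos \<phi>"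
    using 0 cs[of \<phi>] unfolding R_def by algebra+
  \<comment> \<open>Projecting the vector of signed radius \<open>R\<close> and angle \<phi> to the
    direction \<alpha> gives \<open>a\<close> back, so \<open>a\<close> being nonzero forces
    \<open>R\<close> to be.\<close>
  have "R * cos \<tau> = a"
    unfolding R_def A C \<phi> using \<tau> cs[of \<alpha>] cs[of \<tau>] by algebra
  then show "R \<noteq> 0" using a by auto
qed

text \<open>The abstract inverse \<open>rp_chart\<close> is made explicit near each point:
  \<open>G\<close> reads off the two polar angles on branches near those of \<open>y0\<close>, and
  the ratio of the radii. Since \<open>v\<close> is a multiple of \<open>polar_param (G v)\<close>
  and \<open>G v0 = y0\<close>, the value \<open>G v\<close> stays in the slab near
  \<open>v0\<close> and is the value of the chart. The factor \<open>t\<close> may be negative, and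
  then so are both radii.\<close>

lemma smooth_on_rp_chart_proj_point:
  "smooth_on (\<lambda>v. snd (rp_chart c) (proj_point v)) {v. proj_point v \<in> fst (rp_chart c)}"
proof (rule smooth_on_locally)
  fix v0 assume "v0 \<in> {v. proj_point v \<in> fst (rp_chart c)}"
  then obtain y0 where y0: "y0 \<in> slab c" "proj_point v0 = proj_point (polar_param y0)"
    by (auto simp: rp_chart_simps)
  then obtain t where t: "t \<noteq> 0" "v0 = t *\<^sub>R polar_param y0" by (auto simp: proj_point_eq_iff)
  obtain s0 d0 u0 where y0_eq: "y0 = ((s0, d0), u0)" by (metis surj_pair)
  \<comment> \<open>The angles of \<open>y0\<close> itself: with them both \<open>arctan\<close>
    terms vanish at \<open>v0\<close>, so \<open>G\<close> takes the correct branch there.\<close>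
  define \<alpha> \<beta> where "\<alpha> = pi * ((s0 + d0) / 2)" and "\<beta> = pi * ((s0 - d0) / 2)"
  define A B C D :: "homogeneous \<Rightarrow> real" where "A = (\<lambda>v. fst v)" and "B = (\<lambda>v. fst (snd v))"
    and "C = (\<lambda>v. fst (snd (snd v)))" and "D = (\<lambda>v. snd (snd (snd v)))"
  define a where "a = (\<lambda>v. A v * sin \<alpha> + C v * cos \<alpha>)"
  define a' where "a' = (\<lambda>v. B v * sin \<beta> + D v * cos \<beta>)"
  define \<phi> where "\<phi> = (\<lambda>v. \<alpha> + arctan ((A v * cos \<alpha> - C v * sin \<alpha>) / a v))"
  define \<psi> where "\<psi> = (\<lambda>v. \<beta> + arctan ((B v * cos \<beta> - D v * sin \<beta>) / a' v))"
  define R where "R = (\<lambda>v. A v * sin (\<phi> v) + C v * cos (\<phi> v))"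
  define R' where "R' = (\<lambda>v. B v * sin (\<psi> v) + D v * cos (\<psi> v))"
  define G where "G = (\<lambda>v. (((\<phi> v + \<psi> v) / pi, (\<phi> v - \<psi> v) / pi), R' v / R v - 1))"
  define N where "N = {v. a v \<noteq> 0} \<inter> {v. a' v \<noteq> 0}"
  have polar: "R v \<noteq> 0" "A v = R v * sin (\<phi> v)" "C v = R v * cos (\<phi> v)"
      "B v = R' v * sin (\<psi> v)" "D v = R' v * cos (\<psi> v)" if "v \<in> N" for v
    using that polar_angle_near[of "A v" \<alpha> "C v"] polar_angle_near[of "B v" \<beta> "D v"]
    by (simp_all add: N_def a_def a'_def \<phi>_def \<psi>_def R_def R'_def)
  have N: "open N"
    unfolding N_def a_def a'_def A_def B_def C_def D_def
    by (intro open_Int open_Collect_neq continuous_intros)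
  have sm: "smooth_on A N" "smooth_on B N" "smooth_on C N" "smooth_on D N"
    unfolding A_def B_def C_def D_def by (intro smooth_on_intros N)+
  have "smooth_on a N" "smooth_on a' N"
    unfolding a_def a'_def by (intro smooth_on_intros sm N)+
  then have sm': "smooth_on \<phi> N" "smooth_on \<psi> N"
    unfolding \<phi>_def \<psi>_def by (intro smooth_on_intros sm N; simp add: N_def)+
  have "smooth_on R N" "smooth_on R' N"
    unfolding R_def R'_def by (intro smooth_on_intros sm sm')+
  then have G: "smooth_on G N"
    unfolding G_def by (intro smooth_on_intros sm' N) (simp_all add: polar)
  have polar_param_G: "v = R v *\<^sub>R polar_param (G v)" if "v \<in> N" for v
  proof -
    have "pi * (((\<phi> v + \<psi> v) / pi + (\<phi> v - \<psi> v) / pi) / 2) = \<phi> v"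
      "pi * (((\<phi> v + \<psi> v) / pi - (\<phi> v - \<psi> v) / pi) / 2) = \<psi> v"
      by (simp_all add: field_simps)
    then have "R v *\<^sub>R polar_param (G v) = (A v, B v, C v, D v)"
      using polar[OF that] by (simp add: polar_param_def G_def)
    then show ?thesis by (simp add: A_def B_def C_def D_def)
  qed
  have cs: "x * sin z * sin z + x * cos z * cos z = x" for x z :: real
    using sin_cos_squared_add[of z] by algebra
  have v0: "A v0 = t * sin \<alpha>" "C v0 = t * cos \<alpha>"
      "B v0 = t * (1 + u0) * sin \<beta>" "D v0 = t * (1 + u0) * cos \<beta>"
    by (simp_all add: t y0_eq polar_param_def A_def B_def C_def D_def \<alpha>_def \<beta>_def)
  have av0: "a v0 = t" "a' v0 = t * (1 + u0)"
    unfolding a_def a'_def v0 by (simp_all only: cs)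
  have u0: "1 + u0 > 0" using y0 y0_eq by (simp add: slab_def)
  have v0N: "v0 \<in> N" using av0 t u0 by (simp add: N_def)
  have \<phi>v0: "\<phi> v0 = \<alpha>" "\<psi> v0 = \<beta>" by (simp_all add: \<phi>_def \<psi>_def v0)
  have Rv0: "R v0 = t" "R' v0 = t * (1 + u0)"
    unfolding R_def R'_def \<phi>v0 using av0 by (simp_all add: a_def a'_def)
  have "G v0 = y0"
    unfolding G_def \<phi>v0 Rv0 y0_eq using t(1) by (simp add: \<alpha>_def \<beta>_def field_simps)
  have GP: "proj_point v = proj_point (polar_param (G v))" if "v \<in> N" for v
    using polar_param_G[OF that] polar(1)[OF that] proj_point_eq_iff by blast
  show "\<exists>T g. v0 \<in> T \<and> T \<subseteq> {v. proj_point v \<in> fst (rp_chart c)} \<and> smooth_on g T \<and>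
      (\<forall>v\<in>T. g v = snd (rp_chart c) (proj_point v))"
  proof (intro exI conjI ballI)
    let ?T = "N \<inter> G -` slab c"
    show "v0 \<in> ?T" using v0N \<open>G v0 = y0\<close> y0 by simp
    show "?T \<subseteq> {v. proj_point v \<in> fst (rp_chart c)}"
      using GP by (auto simp: rp_chart_simps)
    show "smooth_on G ?T"
      by (intro smooth_on_subset[OF G] smooth_on_open_vimage[OF G] open_slab) auto
    show "G v = snd (rp_chart c) (proj_point v)" if "v \<in> ?T" for v
      using that GP[of v] by (simp add: rp_chart_simps)
  qed
qed

text \<open>The map \<open>s\<close> is the section of the affine chart \<open>g\<close> that sets the nonvanishing homogeneous
  coordinate to one.\<close>

definition homogeneous_chart ::
  "homogeneous set \<Rightarrow> (homogeneous \<Rightarrow> real \<times> real \<times> real) \<Rightarrow> (real \<times> real \<times> real \<Rightarrow> homogeneous) \<Rightarrow> bool" where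
  "homogeneous_chart N g s \<longleftrightarrow> smooth_on g N \<and> smooth_on s UNIV \<and>
     (\<forall>x. s x \<in> N \<and> g (s x) = x) \<and>
     (\<forall>v\<in>N. \<forall>t. t \<noteq> 0 \<longrightarrow> t *\<^sub>R v \<in> N \<and> g (t *\<^sub>R v) = g v) \<and>
     (\<forall>v\<in>N. proj_point (s (g v)) = proj_point v)"

lemma proj_atlas_homogeneous:
  assumes "ch \<in> proj_atlas"
  obtains N g s where "homogeneous_chart N g s" "ch = (proj_point ` N, on_points g)"
proof -
  have open_neq: "open {v::homogeneous. fst v \<noteq> 0}" "open {v::homogeneous. fst (snd v) \<noteq> 0}"
    "open {v::homogeneous. fst (snd (snd v)) \<noteq> 0}" "open {v::homogeneous. snd (snd (snd v)) \<noteq> 0}"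
    by (intro open_Collect_neq continuous_intros)+
  have pp: "proj_point v = proj_point w" if "t \<noteq> 0" "w = t *\<^sub>R v" for v w :: homogeneous and t
    using that proj_point_eq_iff by metis
  \<comment> \<open>\<open>A\<close> stands for the coordinate to be divided by, in each of the four
    positions.\<close>
  have norm: "proj_point (1, B / A, C / A, D / A) = proj_point (A, B, C, D)"
    "proj_point (B / A, 1, C / A, D / A) = proj_point (B, A, C, D)"
    "proj_point (B / A, C / A, 1, D / A) = proj_point (B, C, A, D)"
    "proj_point (B / A, C / A, D / A, 1) = proj_point (B, C, D, A)"
    if "A \<noteq> 0" for A B C D :: real
    by (rule pp[OF that]; use that in simp)+
  have "homogeneous_chart {(A, B, C, D). A \<noteq> 0} (\<lambda>(A, B, C, D). (B / A, C / A, D / A))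
      (\<lambda>x. (1, fst x, fst (snd x), snd (snd x)))"
    unfolding homogeneous_chart_def case_prod_unfold
    by (intro conjI smooth_on_intros open_neq)
      (auto simp: norm)
  moreover have "homogeneous_chart {(A, B, C, D). B \<noteq> 0} (\<lambda>(A, B, C, D). (A / B, C / B, D / B))
      (\<lambda>x. (fst x, 1, fst (snd x), snd (snd x)))"
    unfolding homogeneous_chart_def case_prod_unfold
    by (intro conjI smooth_on_intros open_neq)
      (auto simp: norm)
  moreover have "homogeneous_chart {(A, B, C, D). C \<noteq> 0} (\<lambda>(A, B, C, D). (A / C, B / C, D / C))
      (\<lambda>x. (fst x, fst (snd x), 1, snd (snd x)))"
    unfolding homogeneous_chart_def case_prod_unfold
    by (intro conjI smooth_on_intros open_neq)
      (auto simp: norm)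
  moreover have "homogeneous_chart {(A, B, C, D). D \<noteq> 0} (\<lambda>(A, B, C, D). (A / D, B / D, C / D))
      (\<lambda>x. (fst x, fst (snd x), snd (snd x), 1))"
    unfolding homogeneous_chart_def case_prod_unfold
    by (intro conjI smooth_on_intros open_neq)
      (auto simp: norm)
  ultimately show thesis
    using assms that unfolding proj_atlas_def by blast
qed

lemma proj_space_subset_proj_atlas: "proj_space \<subseteq> (\<Union>ch\<in>proj_atlas. fst ch)"
proof
  fix P assume "P \<in> proj_space"
  then obtain A B C D where P: "P = proj_point (A, B, C, D)" "(A, B, C, D) \<noteq> 0"
    by (auto simp: proj_space_def)
  then have "A \<noteq> 0 \<or> B \<noteq> 0 \<or> C \<noteq> 0 \<or> D \<noteq> 0" by (auto simp: zero_prod_def)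
  then show "P \<in> (\<Union>ch\<in>proj_atlas. fst ch)"
    unfolding P by (fastforce simp: proj_atlas_def)
qed

context
  fixes N g s
  assumes hc: "homogeneous_chart N g s"
begin

lemma homogeneous_chart_on_points: "v \<in> N \<Longrightarrow> on_points g (proj_point v) = g v"
  using hc by (intro on_points_proj_point) (auto simp: homogeneous_chart_def)

lemma homogeneous_chart_mem_iff: "proj_point v \<in> proj_point ` N \<longleftrightarrow> v \<in> N"
proof
  assume "proj_point v \<in> proj_point ` N"
  then obtain w t where "w \<in> N" "t \<noteq> 0" "v = t *\<^sub>R w" by (auto simp: proj_point_eq_iff)
  then show "v \<in> N" using hc by (auto simp: homogeneous_chart_def)
qed simp

lemma inj_on_homogeneous_chart: "inj_on (on_points g) (proj_point ` N)"
  by (rule inj_on_inverseI[of _ "\<lambda>x. proj_point (s x)"])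
    (use hc homogeneous_chart_on_points in \<open>auto simp: homogeneous_chart_def\<close>)

lemma inv_into_homogeneous_chart: "inv_into (proj_point ` N) (on_points g) x = proj_point (s x)"
proof (intro inv_into_f_eq inj_on_homogeneous_chart)
  have "s x \<in> N" "g (s x) = x" using hc unfolding homogeneous_chart_def by blast+
  then show "proj_point (s x) \<in> proj_point ` N" "on_points g (proj_point (s x)) = x"
    using homogeneous_chart_on_points by simp_all
qed

lemma homogeneous_chart_image_Int:
  "on_points g ` (proj_point ` N \<inter> W) = {x. proj_point (s x) \<in> W}"
proof (intro equalityI subsetI)
  fix x assume "x \<in> on_points g ` (proj_point ` N \<inter> W)"
  then obtain v where "v \<in> N" "proj_point v \<in> W" "x = g v" using homogeneous_chart_on_points by auto
  then show "x \<in> {x. proj_point (s x) \<in> W}" using hc by (simp add: homogeneous_chart_def)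
next
  fix x assume "x \<in> {x. proj_point (s x) \<in> W}"
  moreover have "s x \<in> N" "g (s x) = x" using hc unfolding homogeneous_chart_def by blast+
  ultimately show "x \<in> on_points g ` (proj_point ` N \<inter> W)"
    using homogeneous_chart_on_points by (intro image_eqI[of _ _ "proj_point (s x)"]) simp_all
qed

text \<open>Both coordinate changes pass through homogeneous coordinates: one is \<open>g\<close>
  after \<open>polar_param\<close>, the other is the local formula for the polar chart after the
  section \<open>s\<close>.\<close>

lemma compatible_rp_chart_homogeneous: "compatible (rp_chart c) (proj_point ` N, on_points g)"
  unfolding compatible_iff_smooth_in_charts
proof
  have g: "smooth_on g N" and s: "smooth_on s UNIV" using hc by (auto simp: homogeneous_chart_def)
  have dom: "snd (rp_chart c) ` (fst (rp_chart c) \<inter> id -` (proj_point ` N)) = slab c \<inter> polar_param -` N"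
    by (subst rp_chart_image_Int) (simp add: vimage_def homogeneous_chart_mem_iff)
  have "open (slab c \<inter> polar_param -` N)"
    by (rule smooth_on_open_vimage[OF smooth_on_polar_param[OF open_slab]]) (use g in \<open>simp add: smooth_on_def\<close>)
  then have "smooth_on (\<lambda>y. g (polar_param y)) (slab c \<inter> polar_param -` N)"
    by (intro smooth_on_compose[OF g] smooth_on_polar_param) auto
  then show "smooth_in_charts id (rp_chart c) (proj_point ` N, on_points g)"
    unfolding smooth_in_charts_def fst_conv snd_conv dom
    by (rule smooth_on_cong) (simp add: inv_into_rp_chart homogeneous_chart_on_points)
  have "open (UNIV \<inter> s -` {v. proj_point v \<in> fst (rp_chart c)})"
    using smooth_on_rp_chart_proj_point[of c] unfolding smooth_on_def
    by (intro smooth_on_open_vimage[OF s]) blast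
  then have "smooth_on (\<lambda>x. snd (rp_chart c) (proj_point (s x))) {x. proj_point (s x) \<in> fst (rp_chart c)}"
    by (intro smooth_on_compose[OF smooth_on_rp_chart_proj_point] smooth_on_subset[OF s])
      (auto simp: vimage_def)
  then show "smooth_in_charts id (proj_point ` N, on_points g) (rp_chart c)"
    unfolding smooth_in_charts_def fst_conv snd_conv vimage_id id_apply homogeneous_chart_image_Int
    by (rule smooth_on_cong) (simp add: inv_into_homogeneous_chart)
qed

end


section \<open>The surface of canonical forms\<close>

lemma compatible_rp_chart: "ch \<in> proj_atlas \<Longrightarrow> compatible (rp_chart c) ch"
  by (metis proj_atlas_homogeneous compatible_rp_chart_homogeneous)

lemma inj_on_proj_atlas: "ch \<in> proj_atlas \<Longrightarrow> inj_on (snd ch) (fst ch)"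
  by (metis fst_conv inj_on_homogeneous_chart proj_atlas_homogeneous snd_conv)

definition canonical_cone :: "homogeneous set" where
  "canonical_cone = {(A, B, C, D). A\<^sup>2 + C\<^sup>2 = B\<^sup>2 + D\<^sup>2 \<and> A * D - B * C > 0}"

lemma canonical_surface_cone: "canonical_surface = proj_point ` canonical_cone"
  by (simp add: canonical_surface_def canonical_cone_def)

text \<open>The two vectors have length 1, and the determinant is \<open>sin (pi * d)\<close>, which
  is positive for \<open>0 < d < 1\<close>.\<close>

lemma polar_param_in_canonical_cone:
  assumes "y \<in> UNIV \<times> {0<..<1}"
  shows "polar_param (y, 0) \<in> canonical_cone"
proof -
  obtain s d where y: "y = (s, d)" and d: "0 < d" "d < 1" using assms by auto
  have "sin (pi * d) > 0" using d by (intro sin_gt_zero) auto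
  also have "sin (pi * d) = sin (pi * ((s + d) / 2)) * cos (pi * ((s - d) / 2)) -
      sin (pi * ((s - d) / 2)) * cos (pi * ((s + d) / 2))"
    using sin_diff[of "pi * ((s + d) / 2)" "pi * ((s - d) / 2)"] by (simp add: field_simps)
  finally show ?thesis
    unfolding y canonical_cone_def polar_param_def by simp
qed

text \<open>For the inclusion from left to right both vectors are divided by their common length.
  Their angles are free up to full turns, which brings \<open>d\<close> into \<open>{0..<2}\<close>;
  the sign of the determinant then excludes 0 and everything from 1 on.\<close>

lemma canonical_surface_eq:
  "canonical_surface = (\<lambda>y. proj_point (polar_param (y, 0))) ` (UNIV \<times> {0<..<1})"
proof (intro equalityI subsetI)
  fix P assume "P \<in> (\<lambda>y. proj_point (polar_param (y, 0))) ` (UNIV \<times> {0<..<1})"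
  then show "P \<in> canonical_surface"
    unfolding canonical_surface_cone by (elim imageE) (simp add: polar_param_in_canonical_cone)
next
  fix P assume "P \<in> canonical_surface"
  then obtain A B C D where P: "P = proj_point (A, B, C, D)" and eq: "A\<^sup>2 + C\<^sup>2 = B\<^sup>2 + D\<^sup>2"
    and det: "A * D - B * C > 0" by (auto simp: canonical_surface_def)
  define r where "r = sqrt (A\<^sup>2 + C\<^sup>2)"
  have "A \<noteq> 0 \<or> C \<noteq> 0" using det by auto
  then have r: "r > 0" "r\<^sup>2 = A\<^sup>2 + C\<^sup>2" by (auto simp: r_def sum_power2_gt_zero_iff)
  have "(C / r)\<^sup>2 + (A / r)\<^sup>2 = (A\<^sup>2 + C\<^sup>2) / r\<^sup>2"
    "(D / r)\<^sup>2 + (B / r)\<^sup>2 = (B\<^sup>2 + D\<^sup>2) / r\<^sup>2"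
    by (simp_all add: power_divide add_divide_distrib)
  then have "(C / r)\<^sup>2 + (A / r)\<^sup>2 = 1" "(D / r)\<^sup>2 + (B / r)\<^sup>2 = 1"
    using eq r by (metis divide_self_if less_irrefl power_not_zero)+
  then obtain a b where ab: "C / r = cos a" "A / r = sin a" "D / r = cos b" "B / r = sin b"
    by (metis sincos_total_2pi)
  have "sin (a - b) = (A * D - B * C) / r\<^sup>2"
    unfolding sin_diff ab[symmetric]
    by (simp add: power2_eq_square diff_divide_distrib mult.commute)
  then have pos: "sin (a - b) > 0" using det r(1) by (metis diff_gt_0_iff_gt divide_pos_pos zero_less_power)
  \<comment> \<open>The number of full turns in \<open>a - b\<close>; removing them subtracts 2 from
    \<open>d\<close> each time and leaves the vectors unchanged.\<close>
  define k :: int where "k = \<lfloor>(a - b) / (2 * pi)\<rfloor>"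
  define d where "d = (a - b) / pi - 2 * of_int k"
  have pd: "pi * d = a - b + 2 * pi * of_int (- k)" by (simp add: d_def field_simps)
  have "sin (pi * d) = sin (a - b)"
    unfolding pd sin_add by (simp only: sin_int_2pin cos_int_2pin mult_1_right mult_zero_right add_0_right)
  then have sind: "sin (pi * d) > 0" using pos by simp
  have "of_int k \<le> (a - b) / (2 * pi)" "(a - b) / (2 * pi) < of_int k + 1"
    unfolding k_def by linarith+
  then have "0 \<le> d" "d < 2" unfolding d_def by (simp_all add: field_simps)
  moreover have "d \<noteq> 0" using sind by auto
  moreover have "d < 1"
  proof (rule ccontr)
    assume "\<not> d < 1"
    then have "sin (pi * d) \<le> 0" using \<open>d < 2\<close> by (intro sin_le_zero) auto
    then show False using sind by simp
  qed
  ultimately have d: "d \<in> {0<..<1}" by simp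
  \<comment> \<open>Chosen so that the first angle is exactly \<open>a\<close>; the second is then
    \<open>b\<close> up to full turns.\<close>
  define s where "s = 2 * a / pi - d"
  have angles: "pi * ((s + d) / 2) = a" "pi * ((s - d) / 2) = b + 2 * pi * of_int k"
    by (simp_all add: s_def d_def field_simps)
  have "polar_param ((s, d), 0) = (1 / r) *\<^sub>R (A, B, C, D)"
    unfolding polar_param_def fst_conv snd_conv angles sin_add[of b] cos_add[of b] sin_int_2pin cos_int_2pin
    by (simp add: ab[symmetric])
  then have "proj_point (polar_param ((s, d), 0)) = P"
    unfolding P proj_point_eq_iff using r by (intro exI[of _ "1 / r"]) simp
  then show "P \<in> (\<lambda>y. proj_point (polar_param (y, 0))) ` (UNIV \<times> {0<..<1})"
    using d by (intro image_eqI[of _ _ "(s, d)"]) auto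
qed

text \<open>By \<open>polar_param_eq_scaleR\<close> the third coordinate depends only on the
  projective point, and each point of the surface has a representative where it is 0.\<close>

lemma proj_polar_param_in_canonical_surface_iff:
  assumes "y \<in> slab c"
  shows "proj_point (polar_param y) \<in> canonical_surface \<longleftrightarrow> snd y = 0"
proof
  assume "snd y = 0"
  then have "proj_point (polar_param y) = (\<lambda>y. proj_point (polar_param (y, 0))) (fst y)" by (metis prod.collapse)
  moreover have "fst y \<in> UNIV \<times> {0<..<1}" using assms by (auto simp: slab_def strip_def)
  ultimately show "proj_point (polar_param y) \<in> canonical_surface"
    unfolding canonical_surface_eq by (rule image_eqI)
next
  assume "proj_point (polar_param y) \<in> canonical_surface"
  then obtain y' where y': "y' \<in> UNIV \<times> {0<..<1}" "proj_point (polar_param y) = proj_point (polar_param (y', 0))"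
    unfolding canonical_surface_eq by (elim imageE) (rule that)
  then obtain t where t: "polar_param y = t *\<^sub>R polar_param (y', 0)" unfolding proj_point_eq_iff by blast
  obtain s d u s' d' where eqs: "y = ((s, d), u)" "y' = (s', d')" by (metis surj_pair)
  have "d \<in> {0<..<1}" "u > - 1" "d' \<in> {0<..<1}"
    using y' assms by (simp_all add: eqs slab_def strip_def)
  then have "u = 0" using t unfolding eqs by (elim polar_param_eq_scaleR) simp_all
  then show "snd y = 0" by (simp add: eqs)
qed

lemma rp_chart_flat:
  "snd (rp_chart c) ` (fst (rp_chart c) \<inter> canonical_surface) =
     snd (rp_chart c) ` fst (rp_chart c) \<inter> (UNIV \<times> {0})"
proof -
  have "snd (rp_chart c) ` fst (rp_chart c) = slab c"
    using rp_chart_image_Int[of c UNIV] by simp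
  then show ?thesis
    unfolding rp_chart_image_Int
    by (intro set_eqI) (simp add: mem_Times_iff proj_polar_param_in_canonical_surface_iff cong: conj_cong)
qed

definition surface_chart :: "real \<Rightarrow> (homogeneous set, real \<times> real) chart" where
  "surface_chart c = (fst (rp_chart c) \<inter> canonical_surface, fst \<circ> snd (rp_chart c))"

text \<open>Together with \<open>UN_surface_chart\<close> this says that the surface is embedded:
  flattening charts exist around each of its points.\<close>

lemma surface_chart_mem: "surface_chart c \<in> surface_atlas proj_space proj_atlas canonical_surface"
  unfolding surface_atlas_def surface_chart_def
  using chart_on_rp_chart[of c] compatible_rp_chart[of _ c] rp_chart_flat[of c]
  by (intro CollectI exI[of _ "fst (rp_chart c)"] exI[of _ "snd (rp_chart c)"]) simp

lemma surface_chart_simps: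
  "fst (surface_chart c) = (\<lambda>y. proj_point (polar_param (y, 0))) ` strip c"
  "y \<in> strip c \<Longrightarrow> snd (surface_chart c) (proj_point (polar_param (y, 0))) = y"
proof -
  have slab: "(y, 0) \<in> slab c \<longleftrightarrow> y \<in> strip c" for y by (simp add: slab_def)
  show "y \<in> strip c \<Longrightarrow> snd (surface_chart c) (proj_point (polar_param (y, 0))) = y"
    by (simp add: surface_chart_def rp_chart_simps slab)
  show "fst (surface_chart c) = (\<lambda>y. proj_point (polar_param (y, 0))) ` strip c"
  proof (intro equalityI subsetI)
    fix P assume "P \<in> fst (surface_chart c)"
    then obtain z where z: "z \<in> slab c" "P = proj_point (polar_param z)" "P \<in> canonical_surface"
      by (auto simp: surface_chart_def rp_chart_simps)
    then have "z = (fst z, 0)" using proj_polar_param_in_canonical_surface_iff by (simp add: prod_eq_iff)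
    then show "P \<in> (\<lambda>y. proj_point (polar_param (y, 0))) ` strip c" using z slab by (metis imageI)
  next
    fix P assume "P \<in> (\<lambda>y. proj_point (polar_param (y, 0))) ` strip c"
    then obtain y where "y \<in> strip c" "P = proj_point (polar_param (y, 0))" by blast
    then show "P \<in> fst (surface_chart c)"
      using slab[of y] proj_polar_param_in_canonical_surface_iff[of "(y, 0)" c]
      by (auto simp: surface_chart_def rp_chart_simps)
  qed
qed

lemma inj_on_surface_chart: "inj_on (snd (surface_chart c)) (fst (surface_chart c))"
  by (rule inj_on_inverseI[of _ "\<lambda>y. proj_point (polar_param (y, 0))"]) (auto simp: surface_chart_simps)

lemma inv_into_surface_chart:
  assumes "y \<in> strip c"
  shows "inv_into (fst (surface_chart c)) (snd (surface_chart c)) y = proj_point (polar_param (y, 0))"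
  using assms by (intro inv_into_f_eq inj_on_surface_chart) (auto simp: surface_chart_simps)

lemma UN_surface_chart: "(\<Union>c. fst (surface_chart c)) = canonical_surface"
  unfolding surface_chart_simps canonical_surface_eq UN_strip[symmetric] by auto

lemma chart_on_slice:
  assumes "chart_on X (U, \<phi>)" and flat: "\<phi> ` (U \<inter> S) = \<phi> ` U \<inter> (UNIV \<times> {0})"
  shows "chart_on S (U \<inter> S, fst \<circ> (\<phi> :: _ \<Rightarrow> (real \<times> real) \<times> real))"
proof -
  have \<phi>: "inj_on \<phi> U" "open (\<phi> ` U)" using assms by (simp_all add: chart_on_def)
  have snd0: "snd (\<phi> P) = 0" if "P \<in> U \<inter> S" for P
    using flat that by (metis IntD2 imageI mem_Times_iff singletonD)
  then have inj: "inj_on (fst \<circ> \<phi>) (U \<inter> S)"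
    using \<phi> by (auto simp: inj_on_def prod_eq_iff)
  have "(fst \<circ> \<phi>) ` (U \<inter> S) = fst ` (\<phi> ` U \<inter> (UNIV \<times> {0}))"
    by (simp only: image_comp[symmetric] flat)
  also have "\<dots> = (\<lambda>x. (x, 0)) -` (\<phi> ` U)"
  proof (intro equalityI subsetI)
    fix x assume "x \<in> fst ` (\<phi> ` U \<inter> (UNIV \<times> {0}))"
    then show "x \<in> (\<lambda>x. (x, 0)) -` (\<phi> ` U)"
      by (elim imageE) (simp add: mem_Times_iff, metis prod.collapse)
  next
    fix x assume "x \<in> (\<lambda>x. (x, 0)) -` (\<phi> ` U)"
    then have "(x, 0) \<in> \<phi> ` U \<inter> (UNIV \<times> {0})" by simp
    then show "x \<in> fst ` (\<phi> ` U \<inter> (UNIV \<times> {0}))" by (metis fst_conv imageI)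
  qed
  finally have "(fst \<circ> \<phi>) ` (U \<inter> S) = (\<lambda>x. (x, 0)) -` (\<phi> ` U)" .
  then have "open ((fst \<circ> \<phi>) ` (U \<inter> S))"
    using \<phi> by (auto intro!: open_vimage continuous_intros)
  then show ?thesis using inj by (simp add: chart_on_def)
qed

lemma surface_atlas_compatible:
  assumes "ch \<in> surface_atlas proj_space proj_atlas canonical_surface"
  shows "chart_on canonical_surface ch" "compatible ch (surface_chart c)"
proof -
  from assms obtain U and \<phi> :: "homogeneous set \<Rightarrow> (real \<times> real) \<times> real"
    where ch: "ch = (U \<inter> canonical_surface, fst \<circ> \<phi>)"
    and \<phi>: "chart_on proj_space (U, \<phi>)" "\<forall>c\<in>proj_atlas. compatible (U, \<phi>) c"
    and flat: "\<phi> ` (U \<inter> canonical_surface) = \<phi> ` U \<inter> (UNIV \<times> {0})"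
    unfolding surface_atlas_def by blast
  show "chart_on canonical_surface ch" unfolding ch by (rule chart_on_slice[OF \<phi>(1) flat])
  have inj: "inj_on \<phi> U" using \<phi>(1) by (simp add: chart_on_def)
  have "compatible (U, \<phi>) (rp_chart c)"
  proof (rule compatible_trans_cover[where \<B>=proj_atlas])
    show "fst (U, \<phi>) \<inter> fst (rp_chart c) \<subseteq> (\<Union>d\<in>proj_atlas. fst d)"
      using \<phi>(1) proj_space_subset_proj_atlas by (auto simp: chart_on_def)
  qed (use inj \<phi> inj_on_rp_chart inj_on_proj_atlas compatible_rp_chart in auto)
  then have "smooth_in_charts id (U, \<phi>) (fst (rp_chart c), snd (rp_chart c))"
    "smooth_in_charts id (fst (rp_chart c), snd (rp_chart c)) (U, \<phi>)"
    by (simp_all add: compatible_iff_smooth_in_charts)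
  then show "compatible ch (surface_chart c)"
    unfolding ch surface_chart_def compatible_iff_smooth_in_charts
    by (intro conjI smooth_in_charts_slice) (use inj flat inj_on_rp_chart rp_chart_flat in auto)
qed

lemma proj_polar_param_eq_iff:
  assumes "y \<in> UNIV \<times> {0<..<1}" "y' \<in> UNIV \<times> {0<..<1}"
  shows "proj_point (polar_param (y, 0)) = proj_point (polar_param (y', 0)) \<longleftrightarrow> cylinder_proj y = cylinder_proj y'"
proof -
  obtain s d s' d' where eqs: "y = (s, d)" "y' = (s', d')" by (metis surj_pair)
  have d: "d \<in> {0<..<1}" "d' \<in> {0<..<1}" using assms by (simp_all add: eqs)
  show ?thesis
  proof
    assume "proj_point (polar_param (y, 0)) = proj_point (polar_param (y', 0))"
    then obtain t where "polar_param ((s, d), 0) = t *\<^sub>R polar_param ((s', d'), 0)"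
      unfolding proj_point_eq_iff eqs by blast
    then show "cylinder_proj y = cylinder_proj y'"
      unfolding eqs cylinder_proj_eq_iff using d by (elim polar_param_eq_scaleR) auto
  next
    assume "cylinder_proj y = cylinder_proj y'"
    then obtain k :: int where k: "s = s' + 2 * of_int k" "d = d'" by (auto simp: eqs cylinder_proj_eq_iff)
    \<comment> \<open>Adding \<open>2 * k\<close> to \<open>s\<close> adds \<open>k\<close> half
      turns to both angles and so multiplies the whole vector by \<open>cos (k * pi)\<close>, which
      is 1 or -1.\<close>
    have angles: "pi * ((s + d) / 2) = pi * ((s' + d') / 2) + of_int k * pi"
      "pi * ((s - d) / 2) = pi * ((s' - d') / 2) + of_int k * pi"
      using k by (simp_all add: field_simps)
    have "polar_param ((s, d), 0) = cos (of_int k * pi) *\<^sub>R polar_param ((s', d'), 0)"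
      unfolding polar_param_def fst_conv snd_conv angles sin_add cos_add
      using sin_zero_iff_int2[of "of_int k * pi"] by (simp add: mult.commute)
    moreover have "cos (of_int k * pi) \<noteq> 0"
      using sin_zero_iff_int2[of "of_int k * pi"] sin_cos_squared_add[of "of_int k * pi"] by auto
    ultimately show "proj_point (polar_param (y, 0)) = proj_point (polar_param (y', 0))"
      unfolding eqs proj_point_eq_iff by blast
  qed
qed

text \<open>\<open>F\<close> is left abstract, subject only to its values on the parametrization, so
  that this part is independent of rational maps.\<close>

lemma canonical_surface_diffeomorphic_cylinder:
  assumes F: "\<And>y. y \<in> UNIV \<times> {0<..<1} \<Longrightarrow> F (proj_point (polar_param (y, 0))) = cylinder_proj y"
  shows "diffeomorphism canonical_surface (surface_atlas proj_space proj_atlas canonical_surface)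
    cylinder cylinder_atlas F"
proof -
  let ?S = canonical_surface and ?p = "\<lambda>y. proj_point (polar_param (y, 0))"
  have inj: "inj_on F ?S"
  proof (rule inj_onI)
    fix P P' assume "P \<in> ?S" "P' \<in> ?S" "F P = F P'"
    from \<open>P \<in> ?S\<close> obtain y where "y \<in> UNIV \<times> {0<..<1}" "P = ?p y"
      unfolding canonical_surface_eq by (elim imageE) (rule that)
    moreover from \<open>P' \<in> ?S\<close> obtain y' where "y' \<in> UNIV \<times> {0<..<1}" "P' = ?p y'"
      unfolding canonical_surface_eq by (elim imageE) (rule that)
    ultimately show "P = P'" using F \<open>F P = F P'\<close> by (simp add: proj_polar_param_eq_iff)
  qed
  have im: "F ` ?S = cylinder"
    unfolding canonical_surface_eq cylinder_eq image_image using F by (intro image_cong) auto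
  have invF: "inv_into ?S F (cylinder_proj y) = ?p y" if "y \<in> UNIV \<times> {0<..<1}" for y
    using that F by (intro inv_into_f_eq inj) (auto simp: canonical_surface_eq)
  have strip: "y \<in> UNIV \<times> {0<..<1}" if "y \<in> strip c" for y c using that strip_subset by blast
  have dom1: "snd (surface_chart c) ` (fst (surface_chart c) \<inter> F -` fst (cylinder_chart c)) = strip c" for c
  proof -
    have "fst (surface_chart c) \<inter> F -` fst (cylinder_chart c) = ?p ` strip c"
      using F strip by (auto simp: surface_chart_simps fst_cylinder_chart)
    then show ?thesis by (simp add: image_image surface_chart_simps cong: image_cong)
  qed
  have "smooth_in_charts F (surface_chart c) (cylinder_chart c)" for c
    unfolding smooth_in_charts_def dom1
    by (rule smooth_on_cong[OF smooth_on_ident[OF open_strip]])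
      (use F strip in \<open>simp add: inv_into_surface_chart cylinder_chart_cylinder_proj\<close>)
  note F_chart = this
  have dom2: "snd (cylinder_chart c) ` (fst (cylinder_chart c) \<inter> inv_into ?S F -` fst (surface_chart c)) = strip c" for c
    unfolding cylinder_chart_image_Int using invF strip by (auto simp: surface_chart_simps)
  have "smooth_in_charts (inv_into ?S F) (cylinder_chart c) (surface_chart c)" for c
    unfolding smooth_in_charts_def dom2
    by (rule smooth_on_cong[OF smooth_on_ident[OF open_strip]])
      (use invF strip in \<open>simp add: inv_into_cylinder_chart surface_chart_simps\<close>)
  note inv_chart = this
  show ?thesis
  proof (rule diffeomorphism_to_manifold[OF smooth_manifold_cylinder])
    show "bij_betw F ?S cylinder" using inj im by (simp add: bij_betw_def)
    show "chart_on ?S ch" if "ch \<in> surface_atlas proj_space proj_atlas ?S" for ch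
      by (rule surface_atlas_compatible[OF that])
    then have "(\<Union>ch\<in>surface_atlas proj_space proj_atlas ?S. fst ch) \<subseteq> ?S"
      by (simp add: chart_on_def UN_least)
    moreover have "(\<Union>c. fst (surface_chart c)) \<subseteq> (\<Union>ch\<in>surface_atlas proj_space proj_atlas ?S. fst ch)"
      by (intro UN_least UN_upper surface_chart_mem)
    ultimately show "(\<Union>ch\<in>surface_atlas proj_space proj_atlas ?S. fst ch) = ?S"
      by (simp add: UN_surface_chart)
    fix ch d assume ch: "ch \<in> surface_atlas proj_space proj_atlas ?S" and "d \<in> cylinder_atlas"
    then obtain c where d: "d = cylinder_chart c" by (auto simp: cylinder_atlas_eq)
    have chS: "fst ch \<subseteq> ?S" "inj_on (snd ch) (fst ch)"
      using surface_atlas_compatible(1)[OF ch] by (simp_all add: chart_on_def)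
    have comp: "smooth_in_charts id ch (surface_chart c)" "smooth_in_charts id (surface_chart c) ch"
      using surface_atlas_compatible(2)[OF ch] by (simp_all add: compatible_iff_smooth_in_charts)
    show "smooth_in_charts F ch d"
      unfolding d
    proof (rule smooth_in_charts_compose[where \<B>="{surface_chart c}" and f=id and g=F])
      \<comment> \<open>If \<open>F P\<close> lies in the cylinder chart over a strip, then
        \<open>P\<close> lies in the surface chart over the same strip, so one intermediate chart is
        enough.\<close>
      fix P assume P: "P \<in> fst ch" "F P \<in> fst (cylinder_chart c)"
      then obtain y where y: "y \<in> strip c" "F P = cylinder_proj y" by (auto simp: fst_cylinder_chart)
      then have "P = ?p y" using invF[OF strip[OF y(1)]] P chS inj by (metis inv_into_f_f subsetD)
      then show "\<exists>d\<in>{surface_chart c}. id P \<in> fst d" using y by (simp add: surface_chart_simps)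
    qed (use chS inj_on_surface_chart comp F_chart in auto)
    show "smooth_in_charts (inv_into ?S F) d ch"
      unfolding d
    proof (rule smooth_in_charts_compose[where \<B>="{surface_chart c}" and f="inv_into ?S F" and g=id])
      fix x assume "x \<in> fst (cylinder_chart c)"
      then obtain y where y: "y \<in> strip c" "x = cylinder_proj y" by (auto simp: fst_cylinder_chart)
      then show "\<exists>d\<in>{surface_chart c}. inv_into ?S F x \<in> fst d"
        using invF strip by (simp add: surface_chart_simps)
    qed (use inj_on_cylinder_chart inj_on_surface_chart comp inv_chart in auto)
  qed
qed


section \<open>Moebius maps and critical points\<close>

text \<open>The point with homogeneous coordinates \<open>x\<close> and \<open>y\<close>; the value at \<open>(0, 0)\<close> is junk.\<close>

definition sphere_point :: "complex \<Rightarrow> complex \<Rightarrow> riemann_sphere" where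
  "sphere_point x y = (if y = 0 then Infty else Fin (x / y))"

lemma sphere_point_eq_iff:
  assumes "a \<noteq> 0 \<or> b \<noteq> 0" "c \<noteq> 0 \<or> d \<noteq> 0"
  shows "sphere_point a b = sphere_point c d \<longleftrightarrow> a * d = c * b"
  using assms by (auto simp: sphere_point_def field_simps)

lemma sphere_point_scale: "t \<noteq> 0 \<Longrightarrow> sphere_point (t * a) (t * b) = sphere_point a b"
  by (simp add: sphere_point_def)

lemma sphere_point_cases:
  obtains x y where "w = sphere_point x y" "x \<noteq> 0 \<or> y \<noteq> 0"
proof (cases w)
  case (Fin z)
  then show thesis using that[of z 1] by (simp add: sphere_point_def)
next
  case Infty
  then show thesis using that[of 1 0] by (simp add: sphere_point_def)
qed

lemma degree_quadratic:
  "degree [:p0, p1, p2:] \<le> 2" "p2 \<noteq> 0 \<Longrightarrow> degree [:p0, p1, p2:] = 2"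
  by (auto simp: degree_pCons_eq_if)

text \<open>Turns the case distinction of \<open>rational_map\<close> into the evaluation of two
  binary forms, so that later identities are plain algebra with no special case at infinity. The
  condition on \<open>p2\<close> and \<open>q2\<close> makes 2 the degree of the
  homogenization.\<close>

lemma rational_map_quadratic:
  assumes "p2 \<noteq> 0 \<or> q2 \<noteq> 0" "x \<noteq> 0 \<or> y \<noteq> 0"
  shows "rational_map [:p0, p1, p2:] [:q0, q1, q2:] (sphere_point x y) =
    sphere_point (of_real p2 * x\<^sup>2 + of_real p1 * x * y + of_real p0 * y\<^sup>2)
       (of_real q2 * x\<^sup>2 + of_real q1 * x * y + of_real q0 * y\<^sup>2)"
proof (cases "y = 0")
  case True
  have "max (degree [:p0, p1, p2:]) (degree [:q0, q1, q2:]) = 2"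
    using assms(1) degree_quadratic(1)[of p0 p1 p2] degree_quadratic(1)[of q0 q1 q2]
      degree_quadratic(2)[of p2 p0 p1] degree_quadratic(2)[of q2 q0 q1] by linarith
  moreover have "coeff [:p0, p1, p2:] 2 = p2" "coeff [:q0, q1, q2:] 2 = q2"
    by (simp_all add: numeral_2_eq_2)
  ultimately show ?thesis
    using True assms(2) by (simp add: rational_map_def sphere_point_def)
next
  case False
  have ev: "poly (map_poly complex_of_real [:c0, c1, c2:]) (x / y) =
      (of_real c2 * x\<^sup>2 + of_real c1 * x * y + of_real c0 * y\<^sup>2) / y\<^sup>2" for c0 c1 c2
    using False by (simp add: map_poly_pCons field_simps power2_eq_square)
  show ?thesis
    using False by (simp add: rational_map_def sphere_point_def ev Let_def)
qed

section \<open>Moebius maps as matrices acting on homogeneous coordinates\<close>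

definition moebius :: "real \<Rightarrow> real \<Rightarrow> real \<Rightarrow> real \<Rightarrow> riemann_sphere \<Rightarrow> riemann_sphere" where
  "moebius a b c d = rational_map [:b, a:] [:d, c:]"

lemma moebius_sphere_point:
  assumes "a * d - b * c \<noteq> 0" "x \<noteq> 0 \<or> y \<noteq> 0"
  shows "moebius a b c d (sphere_point x y) = sphere_point (of_real a * x + of_real b * y) (of_real c * x + of_real d * y)"
proof (cases "y = 0")
  case True
  have "max (degree [:b, a:]) (degree [:d, c:]) = 1"
    using assms(1) by (auto simp: degree_pCons_eq_if)
  then show ?thesis
    using True assms by (simp add: moebius_def rational_map_def sphere_point_def)
next
  case False
  have ev: "poly (map_poly complex_of_real [:c0, c1:]) (x / y) = (of_real c1 * x + of_real c0 * y) / y" for c0 c1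
    using False by (simp add: map_poly_pCons field_simps)
  show ?thesis
    using False by (simp add: moebius_def rational_map_def sphere_point_def ev Let_def)
qed

text \<open>Keeps homogeneous coordinates away from the junk pair \<open>(0, 0)\<close>. With
  squares in place of \<open>x\<close> and \<open>y\<close> it does the same for canonical
  maps.\<close>

lemma linear_nonzero:
  assumes "a * d - b * c \<noteq> 0" "x \<noteq> 0 \<or> y \<noteq> (0::complex)"
  shows "of_real a * x + of_real b * y \<noteq> 0 \<or> of_real c * x + of_real d * y \<noteq> 0"
proof (rule ccontr)
  assume "\<not> ?thesis"
  then have 0: "of_real a * x + of_real b * y = 0" "of_real c * x + of_real d * y = 0" by auto
  then have "(of_real a * of_real d - of_real b * of_real c) * x = 0"
    "(of_real a * of_real d - of_real b * of_real c) * y = 0" by algebra+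
  moreover have "complex_of_real a * of_real d - of_real b * of_real c \<noteq> 0"
    using assms(1) by (metis of_real_diff of_real_eq_0_iff of_real_mult)
  ultimately show False using assms(2) by simp
qed

lemma moebius_comp:
  assumes "a * d - b * c \<noteq> 0" "a' * d' - b' * c' \<noteq> 0"
  shows "moebius a b c d \<circ> moebius a' b' c' d' =
    moebius (a * a' + b * c') (a * b' + b * d') (c * a' + d * c') (c * b' + d * d')"
proof
  fix w obtain x y where w: "w = sphere_point x y" "x \<noteq> 0 \<or> y \<noteq> 0" by (rule sphere_point_cases)
  have "(a * a' + b * c') * (c * b' + d * d') - (a * b' + b * d') * (c * a' + d * c') =
      (a * d - b * c) * (a' * d' - b' * c')" by algebra
  then have nz: "(a * a' + b * c') * (c * b' + d * d') - (a * b' + b * d') * (c * a' + d * c') \<noteq> 0"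
    using assms by simp
  show "(moebius a b c d \<circ> moebius a' b' c' d') w =
    moebius (a * a' + b * c') (a * b' + b * d') (c * a' + d * c') (c * b' + d * d') w"
    unfolding w(1) o_apply moebius_sphere_point[OF assms(2) w(2)] moebius_sphere_point[OF assms(1) linear_nonzero[OF assms(2) w(2)]]
      moebius_sphere_point[OF nz w(2)] by (simp add: algebra_simps)
qed

lemma moebius_scalar:
  assumes "t \<noteq> 0"
  shows "moebius t 0 0 t = id"
proof
  fix w obtain x y where "w = sphere_point x y" "x \<noteq> 0 \<or> y \<noteq> 0" by (rule sphere_point_cases)
  then show "moebius t 0 0 t w = id w" using assms by (simp add: moebius_sphere_point sphere_point_scale)
qed

lemma moebius_adjugate:
  assumes "a * d - b * c \<noteq> 0"
  shows "moebius d (- b) (- c) a \<circ> moebius a b c d = id" "moebius a b c d \<circ> moebius d (- b) (- c) a = id"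
    "inv (moebius a b c d) = moebius d (- b) (- c) a" "bij (moebius a b c d)"
proof -
  have nz: "d * a - - b * - c \<noteq> 0" using assms by (simp add: mult.commute)
  show 1: "moebius d (- b) (- c) a \<circ> moebius a b c d = id" and 2: "moebius a b c d \<circ> moebius d (- b) (- c) a = id"
    using moebius_scalar[OF assms] by (simp_all add: moebius_comp[OF nz assms] moebius_comp[OF assms nz] mult.commute)
  show "inv (moebius a b c d) = moebius d (- b) (- c) a" using inv_unique_comp[OF 2 1] .
  show "bij (moebius a b c d)" using 1 2 by (rule o_bij)
qed

section \<open>Conjugacy of real quadratic maps\<close>

lemma real_moebius_maps_eq: "real_moebius_maps = {moebius a b c d | a b c d. a * d - b * c > 0}"
  by (simp add: real_moebius_maps_def moebius_def)

lemma real_moebius_maps_bij: "L \<in> real_moebius_maps \<Longrightarrow> bij L"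
  using moebius_adjugate(4) by (fastforce simp: real_moebius_maps_eq)

lemma real_moebius_maps_id: "id \<in> real_moebius_maps"
  unfolding real_moebius_maps_eq using moebius_scalar[of 1]
  by (intro CollectI exI[of _ 1] exI[of _ 0] conjI) auto

lemma real_moebius_maps_inv:
  assumes "L \<in> real_moebius_maps"
  shows "inv L \<in> real_moebius_maps"
proof -
  obtain a b c d where L: "L = moebius a b c d" "a * d - b * c > 0"
    using assms by (auto simp: real_moebius_maps_eq)
  then have "inv L = moebius d (- b) (- c) a" using moebius_adjugate(3) by simp
  moreover have "d * a - - b * - c > 0" using L by (simp add: mult.commute)
  ultimately show ?thesis unfolding real_moebius_maps_eq by blast
qed

lemma real_moebius_maps_comp:
  assumes "L \<in> real_moebius_maps" "M \<in> real_moebius_maps"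
  shows "L \<circ> M \<in> real_moebius_maps"
proof -
  obtain a b c d a' b' c' d' where L: "L = moebius a b c d" "a * d - b * c > 0"
    and M: "M = moebius a' b' c' d'" "a' * d' - b' * c' > 0"
    using assms by (auto simp: real_moebius_maps_eq)
  have "(a * a' + b * c') * (c * b' + d * d') - (a * b' + b * d') * (c * a' + d * c') =
      (a * d - b * c) * (a' * d' - b' * c')" by algebra
  then have "(a * a' + b * c') * (c * b' + d * d') - (a * b' + b * d') * (c * a' + d * c') > 0"
    using L M by simp
  moreover have "L \<circ> M = moebius (a * a' + b * c') (a * b' + b * d') (c * a' + d * c') (c * b' + d * d')"
    using L M by (simp add: moebius_comp)
  ultimately show ?thesis unfolding real_moebius_maps_eq by blast
qed

lemma conjugacy_iff:
  "(f, g) \<in> conjugacy \<longleftrightarrow> f \<in> real_quadratic_maps \<and> g \<in> real_quadratic_maps \<and>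
     (\<exists>L\<in>real_moebius_maps. L \<circ> f = g \<circ> L)"
proof -
  have "g = L \<circ> f \<circ> inv L \<longleftrightarrow> L \<circ> f = g \<circ> L" if "L \<in> real_moebius_maps" for L
    using real_moebius_maps_bij[OF that]
    by (metis bij_is_inj bij_is_surj comp_assoc comp_id inv_o_cancel surj_iff)
  then show ?thesis unfolding conjugacy_def by auto
qed

lemma equiv_conjugacy: "equiv real_quadratic_maps conjugacy"
proof (rule equivI)
  show "conjugacy \<subseteq> real_quadratic_maps \<times> real_quadratic_maps" by (auto simp: conjugacy_def)
  show "refl_on real_quadratic_maps conjugacy"
    using real_moebius_maps_id by (auto simp: refl_on_def conjugacy_iff intro!: bexI[of _ id])
  show "sym conjugacy"
  proof (rule symI)
    fix f g assume "(f, g) \<in> conjugacy"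
    then obtain L where L: "f \<in> real_quadratic_maps" "g \<in> real_quadratic_maps"
      "L \<in> real_moebius_maps" "L \<circ> f = g \<circ> L" by (auto simp: conjugacy_iff)
    then have b: "bij L" by (simp add: real_moebius_maps_bij)
    have "inv L \<circ> g = f \<circ> inv L"
    proof
      fix w
      obtain z where z: "w = L z" using b by (metis bij_pointE)
      have "g (L z) = L (f z)" using L(4) by (metis comp_apply)
      then show "(inv L \<circ> g) w = (f \<circ> inv L) w" using b z by (simp add: bij_is_inj)
    qed
    then show "(g, f) \<in> conjugacy" using L real_moebius_maps_inv by (auto simp: conjugacy_iff)
  qed
  show "trans conjugacy"
  proof (rule transI)
    fix f g h assume "(f, g) \<in> conjugacy" "(g, h) \<in> conjugacy"
    then obtain L M where L: "f \<in> real_quadratic_maps" "h \<in> real_quadratic_maps"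
      "L \<in> real_moebius_maps" "L \<circ> f = g \<circ> L" "M \<in> real_moebius_maps" "M \<circ> g = h \<circ> M"
      by (auto simp: conjugacy_iff)
    then have "(M \<circ> L) \<circ> f = h \<circ> (M \<circ> L)" by (metis comp_assoc)
    then show "(f, h) \<in> conjugacy" using L real_moebius_maps_comp conjugacy_iff by metis
  qed
qed

text \<open>In local coordinates the map is \<open>P / Q\<close>, or \<open>Q / P\<close> near a
  pole. The numerators of the two derivatives are the Wronskian and its negative, so one criterion
  covers both cases.\<close>

lemma critical_point_Fin_iff:
  assumes f: "\<And>z. f (Fin z) = sphere_point (P z) (Q z)"
    and P: "(P has_field_derivative P') (at z0)" and Q: "(Q has_field_derivative Q') (at z0)"
    and nz: "P z0 \<noteq> 0 \<or> Q z0 \<noteq> 0"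
  shows "critical_point f (Fin z0) \<longleftrightarrow> P' * Q z0 - P z0 * Q' = 0"
proof -
  have ev: "\<forall>\<^sub>F z in nhds z0. R z \<noteq> 0"
    if "(R has_field_derivative R') (at z0)" "R z0 \<noteq> 0" for R :: "complex \<Rightarrow> complex" and R'
    using DERIV_isCont[OF that(1)] that(2)
    by (metis continuous_at tendsto_at_iff_tendsto_nhds tendsto_imp_eventually_ne)
  show ?thesis
  proof (cases "Q z0 = 0")
    case False
    have "\<forall>\<^sub>F z in nhds z0. finite_part (f (Fin z)) = P z / Q z"
      using ev[OF Q False] by eventually_elim (simp add: f sphere_point_def)
    then have "((\<lambda>z. finite_part (f (Fin z))) has_field_derivative c) (at z0) \<longleftrightarrow>
        ((\<lambda>z. P z / Q z) has_field_derivative c) (at z0)" for c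
      by (intro DERIV_cong_ev) auto
    moreover have D: "((\<lambda>z. P z / Q z) has_field_derivative (P' * Q z0 - P z0 * Q') / (Q z0 * Q z0)) (at z0)"
      by (rule DERIV_divide[OF P Q False])
    ultimately have "critical_point f (Fin z0) \<longleftrightarrow> (P' * Q z0 - P z0 * Q') / (Q z0 * Q z0) = 0"
      using False by (auto simp: critical_point_def f sphere_point_def dest: DERIV_unique)
    then show ?thesis using False by simp
  next
    case True
    then have Pnz: "P z0 \<noteq> 0" using nz by simp
    have "\<forall>\<^sub>F z in nhds z0. finite_part (recip (f (Fin z))) = Q z / P z"
      using ev[OF P Pnz] by eventually_elim (simp add: f sphere_point_def)
    then have "((\<lambda>z. finite_part (recip (f (Fin z)))) has_field_derivative c) (at z0) \<longleftrightarrow>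
        ((\<lambda>z. Q z / P z) has_field_derivative c) (at z0)" for c
      by (intro DERIV_cong_ev) auto
    moreover have D: "((\<lambda>z. Q z / P z) has_field_derivative (Q' * P z0 - Q z0 * P') / (P z0 * P z0)) (at z0)"
      by (rule DERIV_divide[OF Q P Pnz])
    ultimately have "critical_point f (Fin z0) \<longleftrightarrow> (Q' * P z0 - Q z0 * P') / (P z0 * P z0) = 0"
      using True by (auto simp: critical_point_def f sphere_point_def dest: DERIV_unique)
    then show ?thesis using True Pnz by simp
  qed
qed

section \<open>Canonical maps\<close>

lemma canonical_map_sphere_point:
  assumes "A * D - B * C \<noteq> 0" "x \<noteq> 0 \<or> y \<noteq> 0"
  shows "canonical_map A B C D (sphere_point x y) =
    sphere_point (of_real A * x\<^sup>2 + of_real B * y\<^sup>2) (of_real C * x\<^sup>2 + of_real D * y\<^sup>2)"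
proof -
  have "A \<noteq> 0 \<or> C \<noteq> 0" using assms(1) by auto
  then show ?thesis
    unfolding canonical_map_def using rational_map_quadratic[of A C x y B 0 D 0] assms(2) by simp
qed

text \<open>The Wronskian is \<open>2 * z * (A * D - B * C)\<close>, so 0 is the only finite
  critical point. Coprimality holds since a combination of the two polynomials is a nonzero
  constant.\<close>

lemma canonical_map_quadratic:
  assumes "A * D - B * C \<noteq> 0"
  shows "canonical_map A B C D \<in> real_quadratic_maps"
proof -
  have "A \<noteq> 0 \<or> C \<noteq> 0" using assms by auto
  have "coprime [:B, 0, A:] [:D, 0, C:]"
  proof (rule coprimeI)
    fix r assume "r dvd [:B, 0, A:]" "r dvd [:D, 0, C:]"
    then have "r dvd smult C [:B, 0, A:] - smult A [:D, 0, C:]" by (intro dvd_diff dvd_smult)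
    also have "smult C [:B, 0, A:] - smult A [:D, 0, C:] = [:B * C - A * D:]"
      by (simp add: mult.commute)
    also have "[:B * C - A * D:] dvd 1" using assms by (simp add: is_unit_const_poly_iff dvd_field_iff)
    finally show "is_unit r" .
  qed
  moreover have "max (degree [:B, 0, A:]) (degree [:D, 0, C:]) = 2"
    using \<open>A \<noteq> 0 \<or> C \<noteq> 0\<close> by (auto simp: degree_pCons_eq_if)
  moreover have "w \<in> extended_reals" if w: "critical_point (canonical_map A B C D) w" for w
  proof (cases w)
    case (Fin z)
    let ?P = "\<lambda>z. of_real A * z\<^sup>2 + complex_of_real B" and ?Q = "\<lambda>z. of_real C * z\<^sup>2 + complex_of_real D"
    have det: "complex_of_real A * of_real D - of_real B * of_real C \<noteq> 0"
      using assms by (metis of_real_diff of_real_eq_0_iff of_real_mult)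
    have f: "canonical_map A B C D (Fin z) = sphere_point (?P z) (?Q z)" for z
      using canonical_map_sphere_point[OF assms, of z 1] by (simp add: sphere_point_def)
    have "of_real C * ?P z - of_real A * ?Q z \<noteq> 0" using det by algebra
    then have "?P z \<noteq> 0 \<or> ?Q z \<noteq> 0" by auto
    moreover have "(?P has_field_derivative 2 * of_real A * z) (at z)"
      "(?Q has_field_derivative 2 * of_real C * z) (at z)"
      by (auto intro!: derivative_eq_intros)
    ultimately have "2 * of_real A * z * ?Q z - ?P z * (2 * of_real C * z) = 0"
      using critical_point_Fin_iff[where P="?P" and Q="?Q", OF f] w Fin by blast
    then have "2 * z * (complex_of_real A * of_real D - of_real B * of_real C) = 0" by algebra
    then have "z = of_real 0" using det by simp
    then show ?thesis unfolding extended_reals_def Fin by blast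
  next
    case Infty
    then show ?thesis by (simp add: extended_reals_def)
  qed
  ultimately show ?thesis unfolding real_quadratic_maps_def canonical_map_def by blast
qed

lemma cross_zero_proportional:
  fixes a b c d :: real
  assumes "a * d = c * b" "a \<noteq> 0 \<or> b \<noteq> 0" "c \<noteq> 0 \<or> d \<noteq> 0"
  obtains l where "l \<noteq> 0" "c = l * a" "d = l * b"
proof (cases "a = 0")
  case True
  then show thesis using assms by (intro that[of "d / b"]) auto
next
  case False
  then show thesis using assms by (intro that[of "c / a"]) (auto simp: field_simps)
qed

text \<open>Three values suffice: the value at infinity gives a factor \<open>l\<close> for the
  first column, the value at 0 a factor \<open>m\<close> for the second, and the value at 1 forces
  \<open>l = m\<close>. Stated for forms because it is also applied to both sides of a conjugacy
  equation, which are diagonal but not balanced.\<close>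

lemma diagonal_forms_proportional:
  fixes A B C D A' B' C' D' :: real
  assumes det: "A * D - B * C \<noteq> 0" "A' * D' - B' * C' \<noteq> 0"
    and eq: "\<And>x y :: complex. x \<noteq> 0 \<or> y \<noteq> 0 \<Longrightarrow>
      sphere_point (of_real A * x\<^sup>2 + of_real B * y\<^sup>2) (of_real C * x\<^sup>2 + of_real D * y\<^sup>2) =
      sphere_point (of_real A' * x\<^sup>2 + of_real B' * y\<^sup>2) (of_real C' * x\<^sup>2 + of_real D' * y\<^sup>2)"
  obtains t where "t \<noteq> 0" "A' = t * A" "B' = t * B" "C' = t * C" "D' = t * D"
proof -
  have sphere_point_real: "a * d = c * b" if "sphere_point (of_real a) (of_real b) = sphere_point (of_real c) (of_real d)"
    "a \<noteq> 0 \<or> b \<noteq> 0" "c \<noteq> 0 \<or> d \<noteq> 0" for a b c d :: real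
    using that by (subst (asm) sphere_point_eq_iff) (auto simp flip: of_real_mult)
  have nz: "A \<noteq> 0 \<or> C \<noteq> 0" "B \<noteq> 0 \<or> D \<noteq> 0" "A' \<noteq> 0 \<or> C' \<noteq> 0" "B' \<noteq> 0 \<or> D' \<noteq> 0"
    using det by auto
  have nz1: "A + B \<noteq> 0 \<or> C + D \<noteq> 0" "A' + B' \<noteq> 0 \<or> C' + D' \<noteq> 0"
    using det by (metis add_diff_cancel_left' add_eq_0_iff2 mult_minus_left mult_minus_right
        eq_iff_diff_eq_0 mult.commute)+
  have "A * C' = A' * C" using eq[of 1 0] nz by (intro sphere_point_real) simp_all
  then obtain l where l: "l \<noteq> 0" "A' = l * A" "C' = l * C" using cross_zero_proportional nz by metis
  have "B * D' = B' * D" using eq[of 0 1] nz by (intro sphere_point_real) simp_all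
  then obtain m where m: "m \<noteq> 0" "B' = m * B" "D' = m * D" using cross_zero_proportional nz by metis
  have "(A + B) * (C' + D') = (A' + B') * (C + D)"
    using eq[of 1 1] nz1 by (intro sphere_point_real) simp_all
  then have "(l - m) * (A * D - B * C) = 0" unfolding l m by algebra
  then have "l = m" using det by simp
  then show thesis using that l m by blast
qed

lemma canonical_map_eq_iff:
  assumes "A * D - B * C \<noteq> 0" "A' * D' - B' * C' \<noteq> 0"
  shows "canonical_map A B C D = canonical_map A' B' C' D' \<longleftrightarrow>
    (\<exists>t. t \<noteq> 0 \<and> (A', B', C', D') = t *\<^sub>R (A, B, C, D))"
proof
  assume eq: "canonical_map A B C D = canonical_map A' B' C' D'"
  obtain t where "t \<noteq> 0" "A' = t * A" "B' = t * B" "C' = t * C" "D' = t * D"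
    by (rule diagonal_forms_proportional[OF assms])
      (use eq canonical_map_sphere_point assms in metis)
  then show "\<exists>t. t \<noteq> 0 \<and> (A', B', C', D') = t *\<^sub>R (A, B, C, D)" by auto
next
  assume "\<exists>t. t \<noteq> 0 \<and> (A', B', C', D') = t *\<^sub>R (A, B, C, D)"
  then obtain t where t: "t \<noteq> 0" "A' = t * A" "B' = t * B" "C' = t * C" "D' = t * D" by auto
  show "canonical_map A B C D = canonical_map A' B' C' D'"
  proof
    fix w obtain x y where w: "w = sphere_point x y" "x \<noteq> 0 \<or> y \<noteq> 0" by (rule sphere_point_cases)
    have "sphere_point (of_real A' * x\<^sup>2 + of_real B' * y\<^sup>2) (of_real C' * x\<^sup>2 + of_real D' * y\<^sup>2) =
        sphere_point (of_real t * (of_real A * x\<^sup>2 + of_real B * y\<^sup>2)) (of_real t * (of_real C * x\<^sup>2 + of_real D * y\<^sup>2))"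
      by (simp add: t algebra_simps)
    then show "canonical_map A B C D w = canonical_map A' B' C' D' w"
      unfolding w(1) canonical_map_sphere_point[OF assms(1) w(2)] canonical_map_sphere_point[OF assms(2) w(2)]
      using t(1) by (simp add: sphere_point_scale)
  qed
qed


section \<open>Existence and uniqueness of canonical forms\<close>

text \<open>If the resultant vanishes, the Wronskian has a double zero. When \<alpha> is nonzero,
  this zero is - \<beta> / \<alpha> and is a common root; when \<alpha> = 0, also \<beta> = 0, so
  the polynomials satisfy a proportionality by which one divides the other.\<close>

lemma coprime_quadratic_discriminant:
  fixes p0 p1 p2 q0 q1 q2 :: real
  assumes "coprime [:p0, p1, p2:] [:q0, q1, q2:]" "p2 \<noteq> 0 \<or> q2 \<noteq> 0"
  shows "(p2 * q0 - p0 * q2)\<^sup>2 - (p2 * q1 - p1 * q2) * (p1 * q0 - p0 * q1) \<noteq> 0"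
proof
  let ?p = "[:p0, p1, p2:]" and ?q = "[:q0, q1, q2:]"
  define \<alpha> \<beta> \<gamma> where "\<alpha> = p2 * q1 - p1 * q2" and "\<beta> = p2 * q0 - p0 * q2" and "\<gamma> = p1 * q0 - p0 * q1"
  note defs = \<alpha>_def \<beta>_def \<gamma>_def
  assume "(p2 * q0 - p0 * q2)\<^sup>2 - (p2 * q1 - p1 * q2) * (p1 * q0 - p0 * q1) = 0"
  then have R: "\<beta>\<^sup>2 - \<alpha> * \<gamma> = 0" by (simp add: defs)
  have no_common: False if "r dvd ?p" "r dvd ?q" "degree r > 0" for r
    using coprime_common_divisor[OF assms(1) that(1,2)] that(3) by (metis is_unit_iff_degree less_irrefl not_is_unit_0)
  show False
  proof (cases "\<alpha> = 0")
    case False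
    have root: "r2 * (- \<beta> / \<alpha>)\<^sup>2 + r1 * (- \<beta> / \<alpha>) + r0 = 0"
      if "r2 * \<beta>\<^sup>2 - r1 * \<beta> * \<alpha> + r0 * \<alpha>\<^sup>2 = 0" for r0 r1 r2
      using that False by (simp add: field_simps power2_eq_square)
    \<comment> \<open>The left sides are the values of the two polynomials at - \<beta> / \<alpha>,
      times \<open>\<alpha>\<^sup>2\<close>.\<close>
    have "p2 * \<beta>\<^sup>2 - p1 * \<beta> * \<alpha> + p0 * \<alpha>\<^sup>2 = p2 * (\<beta>\<^sup>2 - \<alpha> * \<gamma>)"
      "q2 * \<beta>\<^sup>2 - q1 * \<beta> * \<alpha> + q0 * \<alpha>\<^sup>2 = q2 * (\<beta>\<^sup>2 - \<alpha> * \<gamma>)"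
      unfolding defs by algebra+
    moreover have "poly [:r0, r1, r2:] x = r2 * x\<^sup>2 + r1 * x + r0" for r0 r1 r2 x :: real
      by (simp add: algebra_simps power2_eq_square)
    ultimately have "poly ?p (- \<beta> / \<alpha>) = 0" "poly ?q (- \<beta> / \<alpha>) = 0"
      using root[of p2 p1 p0] root[of q2 q1 q0] R by (simp_all only: mult_zero_right)
    then have "[:- (- \<beta> / \<alpha>), 1:] dvd ?p" "[:- (- \<beta> / \<alpha>), 1:] dvd ?q"
      unfolding poly_eq_0_iff_dvd by blast+
    then show False by (rule no_common) simp
  next
    case True
    then have 0: "p2 * q1 = p1 * q2" "p2 * q0 = p0 * q2" using R by (simp_all add: defs)
    show False
    proof (cases "q2 = 0")
      case False
      have "smult q2 ?p = smult p2 ?q" using 0 by (simp add: mult.commute)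
      then have "?q dvd smult q2 ?p" by (metis dvd_refl dvd_smult)
      then have "?q dvd ?p" using False by (rule dvd_smult_cancel)
      then show False using no_common[of ?q] False by simp
    next
      case True
      then have "p2 \<noteq> 0" using assms(2) by simp
      have "smult p2 ?q = smult q2 ?p" using 0 by (simp add: mult.commute)
      then have "?p dvd smult p2 ?q" by (metis dvd_refl dvd_smult)
      then have "?p dvd ?q" using \<open>p2 \<noteq> 0\<close> by (rule dvd_smult_cancel)
      then show False using no_common[of ?p] \<open>p2 \<noteq> 0\<close> by simp
    qed
  qed
qed

text \<open>A negative discriminant would give the Wronskian a nonreal zero, which is a nonreal
  critical point.\<close>

lemma real_quadratic_mapE:
  assumes "f \<in> real_quadratic_maps"
  obtains p0 p1 p2 q0 q1 q2 where "f = rational_map [:p0, p1, p2:] [:q0, q1, q2:]"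
    "p2 \<noteq> 0 \<or> q2 \<noteq> 0"
    "(p2 * q0 - p0 * q2)\<^sup>2 - (p2 * q1 - p1 * q2) * (p1 * q0 - p0 * q1) > 0"
proof -
  from assms obtain p q where pq: "coprime p q" "max (degree p) (degree q) = 2" "f = rational_map p q"
    and crit: "\<And>w. critical_point f w \<Longrightarrow> w \<in> extended_reals"
    unfolding real_quadratic_maps_def by blast
  have quad: "r = [:coeff r 0, coeff r 1, coeff r 2:]" if "degree r \<le> 2" for r :: "real poly"
  proof (rule poly_eqI)
    fix n :: nat
    consider "n = 0" | "n = 1" | "n = 2" | "n > 2" by linarith
    then show "coeff r n = coeff [:coeff r 0, coeff r 1, coeff r 2:] n"
      using that by cases (auto simp: numeral_2_eq_2 coeff_eq_0 coeff_pCons split: nat.split)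
  qed
  obtain p0 p1 p2 q0 q1 q2 where p: "p = [:p0, p1, p2:]" and q: "q = [:q0, q1, q2:]"
    using quad[of p] quad[of q] pq(2) by (metis max.cobounded1 max.cobounded2)
  have nz: "p2 \<noteq> 0 \<or> q2 \<noteq> 0"
    using pq(2) by (auto simp: p q degree_pCons_eq_if split: if_splits)
  define \<alpha> \<beta> \<gamma> where "\<alpha> = p2 * q1 - p1 * q2" and "\<beta> = p2 * q0 - p0 * q2" and "\<gamma> = p1 * q0 - p0 * q1"
  note defs = \<alpha>_def \<beta>_def \<gamma>_def
  have "\<beta>\<^sup>2 - \<alpha> * \<gamma> \<noteq> 0"
    using coprime_quadratic_discriminant pq(1) nz unfolding defs p q by blast
  moreover have "\<not> \<beta>\<^sup>2 - \<alpha> * \<gamma> < 0"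
  proof
    assume neg: "\<beta>\<^sup>2 - \<alpha> * \<gamma> < 0"
    have \<alpha>: "\<alpha> \<noteq> 0" using neg by (auto simp: not_less)
    define s where "s = sqrt (\<alpha> * \<gamma> - \<beta>\<^sup>2)"
    have s: "s > 0" "s\<^sup>2 = \<alpha> * \<gamma> - \<beta>\<^sup>2" using neg by (simp_all add: s_def)
    define z where "z = Complex (- \<beta> / \<alpha>) (s / \<alpha>)"
    have az: "of_real \<alpha> * z + of_real \<beta> = \<i> * of_real s"
      using \<alpha> by (simp add: z_def complex_eq_iff)
    have "(\<i> * complex_of_real s)\<^sup>2 = of_real (\<beta>\<^sup>2 - \<alpha> * \<gamma>)"
      using s(2) by (simp add: power_mult_distrib flip: of_real_power)
    then have "(of_real \<alpha> * z + of_real \<beta>)\<^sup>2 = of_real \<beta> ^ 2 - of_real \<alpha> * of_real \<gamma>"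
      unfolding az by simp
    then have "of_real \<alpha> * (of_real \<alpha> * z\<^sup>2 + 2 * of_real \<beta> * z + of_real \<gamma>) = 0" by algebra
    then have W: "of_real \<alpha> * z\<^sup>2 + 2 * of_real \<beta> * z + of_real \<gamma> = 0" using \<alpha> by simp
    let ?P = "\<lambda>z. of_real p2 * z\<^sup>2 + of_real p1 * z + complex_of_real p0"
      and ?Q = "\<lambda>z. of_real q2 * z\<^sup>2 + of_real q1 * z + complex_of_real q0"
    have f: "f (Fin z) = sphere_point (?P z) (?Q z)" for z
      using rational_map_quadratic[OF nz, of z 1 p0 p1 q0 q1] by (simp add: pq(3) p q sphere_point_def)
    \<comment> \<open>Eliminating the quadratic terms leaves the half derivative of the Wronskian,
      which is nonzero at a simple zero; hence numerator and denominator do not both vanish at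
      \<open>z\<close>.\<close>
    have "of_real p2 * ?Q z - of_real q2 * ?P z = of_real \<alpha> * z + of_real \<beta>"
      by (simp add: defs algebra_simps)
    also have "\<dots> \<noteq> 0" using s az by simp
    finally have "?P z \<noteq> 0 \<or> ?Q z \<noteq> 0" by auto
    moreover have "(?P has_field_derivative 2 * of_real p2 * z + of_real p1) (at z)"
      "(?Q has_field_derivative 2 * of_real q2 * z + of_real q1) (at z)"
      by (auto intro!: derivative_eq_intros)
    moreover have "(2 * of_real p2 * z + of_real p1) * ?Q z - ?P z * (2 * of_real q2 * z + of_real q1) =
        of_real \<alpha> * z\<^sup>2 + 2 * of_real \<beta> * z + of_real \<gamma>"
      unfolding defs of_real_diff of_real_mult by algebra
    ultimately have "critical_point f (Fin z)"
      using critical_point_Fin_iff[where P="?P" and Q="?Q", OF f] W by simp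
    then have "Fin z \<in> extended_reals" by (rule crit)
    then have "Im z = 0" by (auto simp: extended_reals_def)
    then show False using s \<alpha> by (simp add: z_def)
  qed
  ultimately have "\<beta>\<^sup>2 - \<alpha> * \<gamma> > 0" by linarith
  then show thesis using that[OF pq(3)[unfolded p q] nz] by (simp add: defs)
qed

text \<open>The form of interest is the Wronskian of a quadratic map, whose zeros are the critical points.
  The sign of its polar form at the two zeros, which depends on their order, becomes the sign of
  \<open>AD - BC\<close>.\<close>

lemma binary_form_isotropic_basis:
  fixes \<alpha> \<beta> \<gamma> :: real
  assumes R: "\<beta>\<^sup>2 - \<alpha> * \<gamma> > 0"
  obtains x1 y1 x2 y2 where "x1 * y2 - x2 * y1 > 0"
    "\<alpha> * x1\<^sup>2 + 2 * \<beta> * x1 * y1 + \<gamma> * y1\<^sup>2 = 0" "\<alpha> * x2\<^sup>2 + 2 * \<beta> * x2 * y2 + \<gamma> * y2\<^sup>2 = 0"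
    "\<alpha> * x1 * x2 + \<beta> * (x1 * y2 + x2 * y1) + \<gamma> * y1 * y2 > 0"
proof -
  obtain x1 y1 x2 y2 where d: "x1 * y2 - x2 * y1 \<noteq> 0"
    and r1: "\<alpha> * x1\<^sup>2 + 2 * \<beta> * x1 * y1 + \<gamma> * y1\<^sup>2 = 0" and r2: "\<alpha> * x2\<^sup>2 + 2 * \<beta> * x2 * y2 + \<gamma> * y2\<^sup>2 = 0"
  proof (cases "\<alpha> = 0")
    case True
    then have "\<beta> \<noteq> 0" using R by auto
    \<comment> \<open>The isotropic vectors are \<open>(1, 0)\<close> and
      \<open>(- \<gamma>, 2 * \<beta>)\<close>; the instantiation follows the order
      \<open>x1\<close>, \<open>y2\<close>, \<open>x2\<close>, \<open>y1\<close> in which the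
      variables occur.\<close>
    show thesis
      by (rule that[of 1 "2 * \<beta>" "- \<gamma>" 0]) (use True \<open>\<beta> \<noteq> 0\<close> in \<open>simp_all add: power2_eq_square\<close>)
  next
    case False
    define s where "s = sqrt (\<beta>\<^sup>2 - \<alpha> * \<gamma>)"
    have s: "s > 0" "s\<^sup>2 = \<beta>\<^sup>2 - \<alpha> * \<gamma>" using R by (simp_all add: s_def)
    show thesis
    proof (rule that[of "- \<beta> + s" \<alpha> "- \<beta> - s" \<alpha>])
      have "(- \<beta> + s) * \<alpha> - (- \<beta> - s) * \<alpha> = 2 * \<alpha> * s" by algebra
      then show "(- \<beta> + s) * \<alpha> - (- \<beta> - s) * \<alpha> \<noteq> 0" using s False by simp
      show "\<alpha> * (- \<beta> + s)\<^sup>2 + 2 * \<beta> * (- \<beta> + s) * \<alpha> + \<gamma> * \<alpha>\<^sup>2 = 0"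
        "\<alpha> * (- \<beta> - s)\<^sup>2 + 2 * \<beta> * (- \<beta> - s) * \<alpha> + \<gamma> * \<alpha>\<^sup>2 = 0"
        using s(2) by algebra+
    qed
  qed
  define e where "e = sgn (x1 * y2 - x2 * y1)"
  have e: "e\<^sup>2 = 1" "e * (x1 * y2 - x2 * y1) > 0"
    using d by (auto simp: e_def sgn_if)
  let ?q = "\<alpha> * x1 * (e * x2) + \<beta> * (x1 * (e * y2) + (e * x2) * y1) + \<gamma> * y1 * (e * y2)"
  have r2': "\<alpha> * (e * x2)\<^sup>2 + 2 * \<beta> * (e * x2) * (e * y2) + \<gamma> * (e * y2)\<^sup>2 = 0"
    using r2 by algebra
  have d': "x1 * (e * y2) - (e * x2) * y1 > 0" using e(2) by (simp add: algebra_simps)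
  \<comment> \<open>The Gram determinant in the new basis is the old one times the square of the
    change of basis; on isotropic vectors this says that the polar form does not vanish.\<close>
  have "?q\<^sup>2 = (\<beta>\<^sup>2 - \<alpha> * \<gamma>) * (x1 * (e * y2) - (e * x2) * y1)\<^sup>2 +
      (\<alpha> * x1\<^sup>2 + 2 * \<beta> * x1 * y1 + \<gamma> * y1\<^sup>2) * (\<alpha> * (e * x2)\<^sup>2 + 2 * \<beta> * (e * x2) * (e * y2) + \<gamma> * (e * y2)\<^sup>2)"
    by algebra
  moreover have "(\<beta>\<^sup>2 - \<alpha> * \<gamma>) * (x1 * (e * y2) - (e * x2) * y1)\<^sup>2 > 0"
    by (intro mult_pos_pos R zero_less_power d')
  ultimately have "?q\<^sup>2 > 0" by (simp only: r1 mult_zero_left add_0_right)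
  then have "?q \<noteq> 0" by auto
  then consider "?q > 0" | "?q < 0" by linarith
  then show thesis
  proof cases
    case 1
    then show thesis using that d' r1 r2' by blast
  next
    case 2
    \<comment> \<open>Exchanging the vectors and negating one of them keeps the determinant and
      reverses the sign of the polar form.\<close>
    show thesis
    proof (rule that[of "e * x2" "- y1" "- x1" "e * y2"])
      show "e * x2 * - y1 - - x1 * (e * y2) > 0" using d' by (simp add: algebra_simps)
      show "\<alpha> * (e * x2)\<^sup>2 + 2 * \<beta> * (e * x2) * (e * y2) + \<gamma> * (e * y2)\<^sup>2 = 0" by (rule r2')
      show "\<alpha> * (- x1)\<^sup>2 + 2 * \<beta> * - x1 * - y1 + \<gamma> * (- y1)\<^sup>2 = 0" using r1 by simp
      show "\<alpha> * (e * x2) * - x1 + \<beta> * (e * x2 * - y1 + - x1 * (e * y2)) + \<gamma> * (e * y2) * - y1 > 0"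
        using 2 by (simp add: algebra_simps)
    qed
  qed
qed

text \<open>\<open>?M\<close> has the isotropic vectors as columns, so it sends infinity and 0 to
  the critical points. \<open>P2\<close> to \<open>Q0\<close> are the coefficients of numerator and
  denominator after substituting \<open>?M\<close>; their minors are, up to the determinant of
  \<open>?M\<close>, the values of the Wronskian and of its polar form on the new basis.\<close>

lemma conjugate_to_diagonal:
  assumes "f \<in> real_quadratic_maps"
  obtains A B C D where "A * D - B * C > 0" "(f, canonical_map A B C D) \<in> conjugacy"
proof -
  obtain p0 p1 p2 q0 q1 q2 where f: "f = rational_map [:p0, p1, p2:] [:q0, q1, q2:]"
    and nz: "p2 \<noteq> 0 \<or> q2 \<noteq> 0"
    and R: "(p2 * q0 - p0 * q2)\<^sup>2 - (p2 * q1 - p1 * q2) * (p1 * q0 - p0 * q1) > 0"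
    using assms by (rule real_quadratic_mapE)
  obtain x1 y1 x2 y2 where d: "x1 * y2 - x2 * y1 > 0"
    and r1: "(p2 * q1 - p1 * q2) * x1\<^sup>2 + 2 * (p2 * q0 - p0 * q2) * x1 * y1 + (p1 * q0 - p0 * q1) * y1\<^sup>2 = 0"
    and r2: "(p2 * q1 - p1 * q2) * x2\<^sup>2 + 2 * (p2 * q0 - p0 * q2) * x2 * y2 + (p1 * q0 - p0 * q1) * y2\<^sup>2 = 0"
    and pol: "(p2 * q1 - p1 * q2) * x1 * x2 + (p2 * q0 - p0 * q2) * (x1 * y2 + x2 * y1) +
      (p1 * q0 - p0 * q1) * y1 * y2 > 0"
    using binary_form_isotropic_basis[OF R] by metis
  define P2 P1 P0 where "P2 = p2 * x1\<^sup>2 + p1 * x1 * y1 + p0 * y1\<^sup>2"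
    and "P1 = 2 * p2 * x1 * x2 + p1 * (x1 * y2 + x2 * y1) + 2 * p0 * y1 * y2"
    and "P0 = p2 * x2\<^sup>2 + p1 * x2 * y2 + p0 * y2\<^sup>2"
  define Q2 Q1 Q0 where "Q2 = q2 * x1\<^sup>2 + q1 * x1 * y1 + q0 * y1\<^sup>2"
    and "Q1 = 2 * q2 * x1 * x2 + q1 * (x1 * y2 + x2 * y1) + 2 * q0 * y1 * y2"
    and "Q0 = q2 * x2\<^sup>2 + q1 * x2 * y2 + q0 * y2\<^sup>2"
  note defs = P2_def P1_def P0_def Q2_def Q1_def Q0_def
  have "P2 * Q1 - P1 * Q2 = (x1 * y2 - x2 * y1) *
      ((p2 * q1 - p1 * q2) * x1\<^sup>2 + 2 * (p2 * q0 - p0 * q2) * x1 * y1 + (p1 * q0 - p0 * q1) * y1\<^sup>2)"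
    unfolding defs by algebra
  then have a: "P2 * Q1 = P1 * Q2" using r1 by simp
  have "P1 * Q0 - P0 * Q1 = (x1 * y2 - x2 * y1) *
      ((p2 * q1 - p1 * q2) * x2\<^sup>2 + 2 * (p2 * q0 - p0 * q2) * x2 * y2 + (p1 * q0 - p0 * q1) * y2\<^sup>2)"
    unfolding defs by algebra
  then have c: "P1 * Q0 = P0 * Q1" using r2 by simp
  have b: "P2 * Q0 - P0 * Q2 = (x1 * y2 - x2 * y1) *
      ((p2 * q1 - p1 * q2) * x1 * x2 + (p2 * q0 - p0 * q2) * (x1 * y2 + x2 * y1) + (p1 * q0 - p0 * q1) * y1 * y2)"
    unfolding defs by algebra
  then have b': "P2 * Q0 - P0 * Q2 > 0" using d pol by simp
  \<comment> \<open>\<open>(P1, Q1)\<close> is parallel to both \<open>(P2, Q2)\<close> and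
    \<open>(P0, Q0)\<close>, which are independent; so it vanishes and with it the linear
    terms.\<close>
  have "P1 * (P2 * Q0 - P0 * Q2) = 0" "Q1 * (P2 * Q0 - P0 * Q2) = 0" using a c by algebra+
  then have 0: "P1 = 0" "Q1 = 0" using b' by auto
  \<comment> \<open>The diagonal pair of forms multiplied from the left by the adjugate matrix of
    \<open>?M\<close>.\<close>
  define A B C D where "A = y2 * P2 - x2 * Q2" and "B = y2 * P0 - x2 * Q0"
    and "C = x1 * Q2 - y1 * P2" and "D = x1 * Q0 - y1 * P0"
  have "A * D - B * C = (x1 * y2 - x2 * y1) * (P2 * Q0 - P0 * Q2)"
    unfolding A_def B_def C_def D_def by algebra
  then have det: "A * D - B * C > 0" using d b' by simp
  let ?M = "moebius x1 x2 y1 y2"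
  have dM: "x1 * y2 - x2 * y1 \<noteq> 0" using d by simp
  have dL: "y2 * x1 - - x2 * - y1 > 0" using d by (simp add: mult.commute)
  let ?L = "moebius y2 (- x2) (- y1) x1"
  have conj: "?L \<circ> f \<circ> ?M = canonical_map A B C D"
  proof
    fix w obtain x y where w: "w = sphere_point x y" "x \<noteq> 0 \<or> y \<noteq> 0" by (rule sphere_point_cases)
    let ?X = "of_real x1 * x + of_real x2 * y" and ?Y = "of_real y1 * x + of_real y2 * y"
    have XY: "?X \<noteq> 0 \<or> ?Y \<noteq> 0" by (rule linear_nonzero[OF dM w(2)])
    have P: "of_real p2 * ?X\<^sup>2 + of_real p1 * ?X * ?Y + of_real p0 * ?Y\<^sup>2 = of_real P2 * x\<^sup>2 + of_real P0 * y\<^sup>2"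
    proof -
      have "of_real p2 * ?X\<^sup>2 + of_real p1 * ?X * ?Y + of_real p0 * ?Y\<^sup>2 =
          of_real P2 * x\<^sup>2 + of_real P1 * x * y + of_real P0 * y\<^sup>2"
        unfolding defs of_real_add of_real_mult of_real_power of_real_numeral by algebra
      then show ?thesis by (simp add: 0)
    qed
    have Q: "of_real q2 * ?X\<^sup>2 + of_real q1 * ?X * ?Y + of_real q0 * ?Y\<^sup>2 = of_real Q2 * x\<^sup>2 + of_real Q0 * y\<^sup>2"
    proof -
      have "of_real q2 * ?X\<^sup>2 + of_real q1 * ?X * ?Y + of_real q0 * ?Y\<^sup>2 =
          of_real Q2 * x\<^sup>2 + of_real Q1 * x * y + of_real Q0 * y\<^sup>2"
        unfolding defs of_real_add of_real_mult of_real_power of_real_numeral by algebra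
      then show ?thesis by (simp add: 0)
    qed
    have nzPQ: "of_real P2 * x\<^sup>2 + of_real P0 * y\<^sup>2 \<noteq> 0 \<or> of_real Q2 * x\<^sup>2 + of_real Q0 * y\<^sup>2 \<noteq> 0"
      using linear_nonzero[of P2 Q0 P0 Q2 "x\<^sup>2" "y\<^sup>2"] b' w(2) by simp
    have "(?L \<circ> f \<circ> ?M) w = ?L (sphere_point (of_real P2 * x\<^sup>2 + of_real P0 * y\<^sup>2) (of_real Q2 * x\<^sup>2 + of_real Q0 * y\<^sup>2))"
      unfolding o_apply w(1) moebius_sphere_point[OF dM w(2)] f rational_map_quadratic[OF nz XY] P Q ..
    also have "\<dots> = canonical_map A B C D w"
      unfolding w(1) canonical_map_sphere_point[OF less_imp_neq[OF det, symmetric] w(2)]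
        moebius_sphere_point[OF less_imp_neq[OF dL, symmetric] nzPQ]
      by (simp add: A_def B_def C_def D_def algebra_simps)
    finally show "(?L \<circ> f \<circ> ?M) w = canonical_map A B C D w" .
  qed
  have "?L \<circ> f = ?L \<circ> f \<circ> (?M \<circ> ?L)" using moebius_adjugate(2)[OF dM] by simp
  also have "\<dots> = canonical_map A B C D \<circ> ?L" using conj by (simp add: comp_assoc[symmetric])
  finally have "?L \<circ> f = canonical_map A B C D \<circ> ?L" .
  moreover have "?L \<in> real_moebius_maps" unfolding real_moebius_maps_eq using dL by blast
  ultimately have "(f, canonical_map A B C D) \<in> conjugacy"
    using assms canonical_map_quadratic det by (auto simp: conjugacy_iff)
  then show thesis using that det by blast
qed

text \<open>The dilation \<open>z -> l * z\<close> changes the coefficients into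
  \<open>A / l\<close>, \<open>l * B\<close>, \<open>C / l\<^sup>2\<close>, \<open>D\<close>. With
  \<open>m = l\<^sup>2\<close> and denominators cleared, balance becomes the cubic equation
  \<open>?h m = 0\<close>, solved by the intermediate value theorem.\<close>

lemma balancing_dilation:
  fixes A B C D :: real
  assumes "A \<noteq> 0 \<or> C \<noteq> 0" "B \<noteq> 0 \<or> D \<noteq> 0"
  obtains l where "l > 0" "(A / l)\<^sup>2 + (C / l\<^sup>2)\<^sup>2 = (l * B)\<^sup>2 + D\<^sup>2"
proof -
  let ?h = "\<lambda>m. m ^ 3 * B\<^sup>2 + m\<^sup>2 * D\<^sup>2 - (A\<^sup>2 * m + C\<^sup>2)"
  define u v q where "u = A\<^sup>2 + C\<^sup>2" and "v = B\<^sup>2 + D\<^sup>2" and "q = u / v"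
  have uv: "u > 0" "v > 0" using assms by (auto simp: u_def v_def sum_power2_gt_zero_iff)
  then have q: "q > 0" "u = q * v" by (simp_all add: q_def)
  \<comment> \<open>Below 1 the function \<open>?h\<close> is at most
    \<open>m * v * (m - q)\<close>, above 1 at least that. So a point below both 1 and
    \<open>q\<close> and a point above both bracket a zero.\<close>
  define a b where "a = q / (1 + q)" and "b = 1 + q"
  have a: "0 < a" "a < 1" "a < q" using q by (auto simp: a_def field_simps)
  have "a ^ 3 \<le> a\<^sup>2" using a by (intro power_decreasing) auto
  then have "a ^ 3 * B\<^sup>2 \<le> a\<^sup>2 * B\<^sup>2" by (rule mult_right_mono) simp
  moreover have "C\<^sup>2 * a \<le> C\<^sup>2" using a by (simp add: mult_left_le)
  ultimately have "?h a \<le> a\<^sup>2 * v - a * u" by (simp add: u_def v_def algebra_simps)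
  also have "\<dots> = a * v * (a - q)" unfolding q(2) by algebra
  also have "\<dots> \<le> 0" using a uv by (simp add: mult_nonneg_nonpos)
  finally have ha: "?h a \<le> 0" .
  have b: "b > 1" "b > q" using q by (simp_all add: b_def)
  have "b\<^sup>2 \<le> b ^ 3" using b by (intro power_increasing) auto
  then have "b\<^sup>2 * B\<^sup>2 \<le> b ^ 3 * B\<^sup>2" by (rule mult_right_mono) simp
  moreover have "C\<^sup>2 \<le> C\<^sup>2 * b" using b by (simp add: mult_le_cancel_left1)
  ultimately have "b\<^sup>2 * v - b * u \<le> ?h b" by (simp add: u_def v_def algebra_simps)
  moreover have "b\<^sup>2 * v - b * u = b * v * (b - q)" unfolding q(2) by algebra
  moreover have "b * v * (b - q) \<ge> 0" using b uv by simp
  ultimately have hb: "0 \<le> ?h b" by linarith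
  have "\<exists>m\<ge>a. m \<le> b \<and> ?h m = 0"
    using ha hb a b by (intro IVT') (auto intro!: continuous_intros)
  then obtain m where m: "m > 0" "?h m = 0" using a by (metis less_le_trans)
  define l where "l = sqrt m"
  have l: "l > 0" "l\<^sup>2 = m" using m by (simp_all add: l_def)
  have "(A / l)\<^sup>2 + (C / l\<^sup>2)\<^sup>2 = A\<^sup>2 / m + C\<^sup>2 / m\<^sup>2"
    by (simp add: power_divide l)
  also have "\<dots> = m * B\<^sup>2 + D\<^sup>2" using m by (simp add: field_simps power2_eq_square power3_eq_cube)
  also have "\<dots> = (l * B)\<^sup>2 + D\<^sup>2" by (simp add: power_mult_distrib l)
  finally show thesis using that l(1) by blast
qed

lemma conjugate_to_canonical:
  assumes "f \<in> real_quadratic_maps"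
  obtains g where "g \<in> canonical_maps" "(f, g) \<in> conjugacy"
proof -
  obtain A B C D where det: "A * D - B * C > 0" and fg: "(f, canonical_map A B C D) \<in> conjugacy"
    using conjugate_to_diagonal[OF assms] .
  have "A \<noteq> 0 \<or> C \<noteq> 0" "B \<noteq> 0 \<or> D \<noteq> 0" using det by auto
  then obtain l where l: "l > 0" "(A / l)\<^sup>2 + (C / l\<^sup>2)\<^sup>2 = (l * B)\<^sup>2 + D\<^sup>2"
    by (rule balancing_dilation)
  have "A / l * D - l * B * (C / l\<^sup>2) = (A * D - B * C) / l"
    using l by (simp add: field_simps power2_eq_square)
  then have det': "A / l * D - l * B * (C / l\<^sup>2) > 0" using det l by simp
  let ?g = "canonical_map (A / l) (l * B) (C / l\<^sup>2) D" and ?L = "moebius l 0 0 1"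
  have "?L \<circ> canonical_map A B C D = ?g \<circ> ?L"
  proof
    fix w obtain x y where w: "w = sphere_point x y" "x \<noteq> 0 \<or> y \<noteq> 0" by (rule sphere_point_cases)
    have L: "moebius l 0 0 1 (sphere_point x y) = sphere_point (of_real l * x) y" if "x \<noteq> 0 \<or> y \<noteq> 0" for x y
      using moebius_sphere_point[of l 1 0 0 x y] that l by simp
    have lw: "of_real l * x \<noteq> 0 \<or> y \<noteq> 0" using w(2) l by auto
    have nz: "of_real A * x\<^sup>2 + of_real B * y\<^sup>2 \<noteq> 0 \<or> of_real C * x\<^sup>2 + of_real D * y\<^sup>2 \<noteq> 0"
      using linear_nonzero[of A D B C "x\<^sup>2" "y\<^sup>2"] det w(2) by simp
    have "(?L \<circ> canonical_map A B C D) w =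
        sphere_point (of_real l * (of_real A * x\<^sup>2 + of_real B * y\<^sup>2)) (of_real C * x\<^sup>2 + of_real D * y\<^sup>2)"
      unfolding w(1) o_apply canonical_map_sphere_point[OF less_imp_neq[OF det, symmetric] w(2)] L[OF nz] ..
    also have "\<dots> = (?g \<circ> ?L) w"
      unfolding w(1) o_apply L[OF w(2)] canonical_map_sphere_point[OF less_imp_neq[OF det', symmetric] lw]
      using l(1) by (simp add: field_simps power2_eq_square)
    finally show "(?L \<circ> canonical_map A B C D) w = (?g \<circ> ?L) w" .
  qed
  moreover have "?L \<in> real_moebius_maps"
    unfolding real_moebius_maps_eq using l by (intro CollectI exI conjI) (rule refl, simp)
  ultimately have "(canonical_map A B C D, ?g) \<in> conjugacy"
    using canonical_map_quadratic det det' by (auto simp: conjugacy_iff)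
  then have "(f, ?g) \<in> conjugacy" using fg equiv_conjugacy by (meson equiv_def transD)
  moreover have "?g \<in> canonical_maps" unfolding canonical_maps_def using l(2) det' by blast
  ultimately show thesis using that by blast
qed

section \<open>Uniqueness of the canonical form\<close>

lemma canonical_map_fibre:
  assumes "A * D - B * C \<noteq> 0" "x \<noteq> 0 \<or> y \<noteq> 0"
    "\<And>w. canonical_map A B C D w = canonical_map A B C D (sphere_point x y) \<Longrightarrow> w = sphere_point x y"
  shows "x = 0 \<or> y = 0"
proof -
  \<comment> \<open>Canonical maps are even, so a point alone in its fibre is fixed by
    \<open>z -> - z\<close>.\<close>
  have "canonical_map A B C D (sphere_point (- x) y) = canonical_map A B C D (sphere_point x y)"
    using assms by (simp add: canonical_map_sphere_point)
  then have "sphere_point (- x) y = sphere_point x y" by (rule assms(3))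
  then have "- x * y = x * y" using assms(2) by (subst (asm) sphere_point_eq_iff) auto
  then show ?thesis by simp
qed

lemma canonical_map_fibre_axis:
  assumes "A * D - B * C \<noteq> 0" "x = 0 \<or> y = 0" "x \<noteq> 0 \<or> y \<noteq> 0"
    "canonical_map A B C D w = canonical_map A B C D (sphere_point x y)"
  shows "w = sphere_point x y"
proof -
  obtain u v where w: "w = sphere_point u v" "u \<noteq> 0 \<or> v \<noteq> 0" by (rule sphere_point_cases)
  have nz: "of_real A * u\<^sup>2 + of_real B * v\<^sup>2 \<noteq> 0 \<or> of_real C * u\<^sup>2 + of_real D * v\<^sup>2 \<noteq> 0"
    if "u \<noteq> 0 \<or> v \<noteq> 0" for u v :: complex
    using linear_nonzero[of A D B C "u\<^sup>2" "v\<^sup>2"] assms(1) that by simp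
  have "(of_real A * u\<^sup>2 + of_real B * v\<^sup>2) * (of_real C * x\<^sup>2 + of_real D * y\<^sup>2) =
      (of_real A * x\<^sup>2 + of_real B * y\<^sup>2) * (of_real C * u\<^sup>2 + of_real D * v\<^sup>2)"
    using assms(4) unfolding w(1) canonical_map_sphere_point[OF assms(1) w(2)] canonical_map_sphere_point[OF assms(1,3)]
    by (subst (asm) sphere_point_eq_iff[OF nz[OF w(2)] nz[OF assms(3)]])
  then have "(complex_of_real A * of_real D - of_real B * of_real C) * (u\<^sup>2 * y\<^sup>2 - v\<^sup>2 * x\<^sup>2) = 0"
    by algebra
  moreover have "complex_of_real A * of_real D - of_real B * of_real C \<noteq> 0"
    using assms(1) by (metis of_real_diff of_real_eq_0_iff of_real_mult)
  ultimately have "u\<^sup>2 * y\<^sup>2 = v\<^sup>2 * x\<^sup>2" by simp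
  then have "u * y = x * v" using assms(2,3) w(2) by auto
  then show ?thesis unfolding w(1) by (subst sphere_point_eq_iff[OF w(2) assms(3)])
qed

text \<open>Here \<open>l\<close> is the square of the dilation factor. Subtracting
  \<open>l\<^sup>2\<close> times the balance equation makes the factor \<open>1 - l\<close> appear,
  and the cofactor is positive.\<close>

lemma balanced_dilation_unique:
  fixes A B C D l :: real
  assumes "A \<noteq> 0 \<or> C \<noteq> 0" "A\<^sup>2 + C\<^sup>2 = B\<^sup>2 + D\<^sup>2" "l > 0"
    "A\<^sup>2 * l + C\<^sup>2 = l ^ 3 * B\<^sup>2 + l\<^sup>2 * D\<^sup>2"
  shows "l = 1"
proof -
  have "A\<^sup>2 * l + C\<^sup>2 - l\<^sup>2 * (A\<^sup>2 + C\<^sup>2) = l ^ 3 * B\<^sup>2 + l\<^sup>2 * D\<^sup>2 - l\<^sup>2 * (B\<^sup>2 + D\<^sup>2)"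
    using assms by simp
  then have "(1 - l) * (l * A\<^sup>2 + (1 + l) * C\<^sup>2 + l\<^sup>2 * B\<^sup>2) = 0" by algebra
  moreover have "l * A\<^sup>2 + (1 + l) * C\<^sup>2 + l\<^sup>2 * B\<^sup>2 > 0"
  proof -
    have "l * A\<^sup>2 \<ge> 0" "C\<^sup>2 \<ge> 0" "l * C\<^sup>2 \<ge> 0" "l\<^sup>2 * B\<^sup>2 \<ge> 0" using assms(3) by simp_all
    moreover have "l * A\<^sup>2 > 0 \<or> C\<^sup>2 > 0" using assms(1,3) by auto
    ultimately show ?thesis unfolding distrib_right mult_1_left by linarith
  qed
  ultimately show ?thesis by simp
qed

text \<open>The matrix of \<open>L\<close> is diagonal or antidiagonal. In the first case
  \<open>L\<close> is a positive dilation between balanced maps, hence the identity. In the second,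
  positive orientation of \<open>L\<close> would reverse the sign of
  \<open>A * D - B * C\<close>.\<close>

lemma canonical_maps_conjugate_imp_eq:
  assumes f: "f \<in> canonical_maps" and g: "g \<in> canonical_maps" and conj: "(f, g) \<in> conjugacy"
  shows "f = g"
proof -
  obtain A B C D where f_eq: "f = canonical_map A B C D" and bal: "A\<^sup>2 + C\<^sup>2 = B\<^sup>2 + D\<^sup>2"
    and det: "A * D - B * C > 0" using f by (auto simp: canonical_maps_def)
  obtain A' B' C' D' where g_eq: "g = canonical_map A' B' C' D'" and bal': "A'\<^sup>2 + C'\<^sup>2 = B'\<^sup>2 + D'\<^sup>2"
    and det': "A' * D' - B' * C' > 0" using g by (auto simp: canonical_maps_def)
  obtain L where L: "L \<in> real_moebius_maps" "L \<circ> f = g \<circ> L" using conj by (auto simp: conjugacy_iff)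
  then obtain a b c d where L_eq: "L = moebius a b c d" and dL: "a * d - b * c > 0"
    by (auto simp: real_moebius_maps_eq)
  note nz = less_imp_neq[OF det, symmetric] less_imp_neq[OF det', symmetric] less_imp_neq[OF dL, symmetric]
  have bij: "bij L" using L real_moebius_maps_bij by blast
  have gL: "g (L z) = L (f z)" for z using L(2) by (metis comp_apply)
  have axis: "of_real a * x + of_real b * y = 0 \<or> of_real c * x + of_real d * y = 0"
    if xy: "x = 0 \<or> y = 0" "x \<noteq> 0 \<or> y \<noteq> 0" for x y :: complex
  proof (rule canonical_map_fibre[OF nz(2) linear_nonzero[OF nz(3) xy(2)]])
    fix w
    assume w: "canonical_map A' B' C' D' w =
      canonical_map A' B' C' D' (sphere_point (of_real a * x + of_real b * y) (of_real c * x + of_real d * y))"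
    obtain z where z: "w = L z" using bij by (metis bij_pointE)
    have "L (f z) = L (f (sphere_point x y))"
      using w unfolding moebius_sphere_point[OF nz(3) xy(2), symmetric] z L_eq[symmetric] g_eq[symmetric] gL .
    then have "f z = f (sphere_point x y)" using bij by (meson bij_is_inj injD)
    then have "z = sphere_point x y" unfolding f_eq by (rule canonical_map_fibre_axis[OF nz(1) xy])
    then show "w = sphere_point (of_real a * x + of_real b * y) (of_real c * x + of_real d * y)"
      by (simp add: z L_eq moebius_sphere_point[OF nz(3) xy(2)])
  qed
  have "b = 0 \<or> d = 0" "a = 0 \<or> c = 0" using axis[of 0 1] axis[of 1 0] by auto
  then consider "b = 0" "c = 0" | "a = 0" "d = 0" using dL by auto
  then show ?thesis
  proof cases
    case 1
    then have ad: "a * d > 0" using dL by simp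
    then have "a \<noteq> 0" "d \<noteq> 0" by auto
    \<comment> \<open>The coefficient matrices of \<open>L \<circ> f\<close> and
      \<open>g \<circ> L\<close>.\<close>
    have dets: "(a * A) * (d * D) - (a * B) * (d * C) \<noteq> 0"
      "(A' * a\<^sup>2) * (D' * d\<^sup>2) - (B' * d\<^sup>2) * (C' * a\<^sup>2) \<noteq> 0"
    proof -
      have "(a * A) * (d * D) - (a * B) * (d * C) = a * d * (A * D - B * C)"
        "(A' * a\<^sup>2) * (D' * d\<^sup>2) - (B' * d\<^sup>2) * (C' * a\<^sup>2) = (a * d)\<^sup>2 * (A' * D' - B' * C')"
        by algebra+
      then show "(a * A) * (d * D) - (a * B) * (d * C) \<noteq> 0"
        "(A' * a\<^sup>2) * (D' * d\<^sup>2) - (B' * d\<^sup>2) * (C' * a\<^sup>2) \<noteq> 0"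
        using nz \<open>a \<noteq> 0\<close> \<open>d \<noteq> 0\<close> by simp_all
    qed
    obtain t where t: "t \<noteq> 0" "A' * a\<^sup>2 = t * (a * A)" "B' * d\<^sup>2 = t * (a * B)"
      "C' * a\<^sup>2 = t * (d * C)" "D' * d\<^sup>2 = t * (d * D)"
    proof (rule diagonal_forms_proportional[OF dets])
      fix x y :: complex assume xy: "x \<noteq> 0 \<or> y \<noteq> 0"
      have nzL: "of_real a * x \<noteq> 0 \<or> of_real d * y \<noteq> 0" using xy \<open>a \<noteq> 0\<close> \<open>d \<noteq> 0\<close> by auto
      have nzf: "of_real A * x\<^sup>2 + of_real B * y\<^sup>2 \<noteq> 0 \<or> of_real C * x\<^sup>2 + of_real D * y\<^sup>2 \<noteq> 0"
        using linear_nonzero[OF nz(1), of "x\<^sup>2" "y\<^sup>2"] xy by simp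
      have "L (f (sphere_point x y)) = g (L (sphere_point x y))" by (simp add: gL)
      then show "sphere_point (of_real (a * A) * x\<^sup>2 + of_real (a * B) * y\<^sup>2) (of_real (d * C) * x\<^sup>2 + of_real (d * D) * y\<^sup>2) =
          sphere_point (of_real (A' * a\<^sup>2) * x\<^sup>2 + of_real (B' * d\<^sup>2) * y\<^sup>2) (of_real (C' * a\<^sup>2) * x\<^sup>2 + of_real (D' * d\<^sup>2) * y\<^sup>2)"
        unfolding f_eq g_eq L_eq canonical_map_sphere_point[OF nz(1) xy] moebius_sphere_point[OF nz(3) xy] moebius_sphere_point[OF nz(3) nzf]
        using canonical_map_sphere_point[OF nz(2) nzL] 1 by (simp add: algebra_simps power_mult_distrib)
    qed blast
    define l where "l = a / d"
    have l: "l > 0" "a = l * d" using ad \<open>d \<noteq> 0\<close> by (auto simp: l_def zero_less_divide_iff zero_less_mult_iff)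
    \<comment> \<open>The factor normalized so that \<open>C' = r * C\<close>; the remaining
      coefficients then differ only by powers of \<open>l\<close>.\<close>
    define r where "r = t / (l\<^sup>2 * d)"
    have r: "r \<noteq> 0" "A' = r * (l * A)" "B' = r * (l ^ 3 * B)" "C' = r * C" "D' = r * (l\<^sup>2 * D)"
      using t l \<open>d \<noteq> 0\<close> by (auto simp: r_def field_simps power2_eq_square power3_eq_cube)
    have "r\<^sup>2 * ((A\<^sup>2 * l\<^sup>2 + C\<^sup>2) - ((l\<^sup>2) ^ 3 * B\<^sup>2 + (l\<^sup>2)\<^sup>2 * D\<^sup>2)) = 0"
      using bal' unfolding r(2-) by algebra
    then have "A\<^sup>2 * l\<^sup>2 + C\<^sup>2 = (l\<^sup>2) ^ 3 * B\<^sup>2 + (l\<^sup>2)\<^sup>2 * D\<^sup>2" using r(1) by simp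
    moreover have "A \<noteq> 0 \<or> C \<noteq> 0" using det by auto
    ultimately have "l\<^sup>2 = 1" using bal l(1) by (intro balanced_dilation_unique) auto
    then have "l = 1" using l(1) by (simp add: power2_eq_1_iff)
    then show ?thesis
      unfolding f_eq g_eq canonical_map_eq_iff[OF nz(1,2)] using r by (intro exI[of _ r]) simp
  next
    case 2
    then have bc: "b * c < 0" using dL by simp
    then have "b \<noteq> 0" "c \<noteq> 0" by auto
    have dets: "(b * C) * (c * B) - (b * D) * (c * A) \<noteq> 0"
      "(B' * c\<^sup>2) * (C' * b\<^sup>2) - (A' * b\<^sup>2) * (D' * c\<^sup>2) \<noteq> 0"
      and eqs: "(b * C) * (c * B) - (b * D) * (c * A) = - (b * c) * (A * D - B * C)"
      "(B' * c\<^sup>2) * (C' * b\<^sup>2) - (A' * b\<^sup>2) * (D' * c\<^sup>2) = - ((b * c)\<^sup>2 * (A' * D' - B' * C'))"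
    proof -
      show eqs: "(b * C) * (c * B) - (b * D) * (c * A) = - (b * c) * (A * D - B * C)"
        "(B' * c\<^sup>2) * (C' * b\<^sup>2) - (A' * b\<^sup>2) * (D' * c\<^sup>2) = - ((b * c)\<^sup>2 * (A' * D' - B' * C'))"
        by algebra+
      show "(b * C) * (c * B) - (b * D) * (c * A) \<noteq> 0"
        "(B' * c\<^sup>2) * (C' * b\<^sup>2) - (A' * b\<^sup>2) * (D' * c\<^sup>2) \<noteq> 0"
        unfolding eqs using nz \<open>b \<noteq> 0\<close> \<open>c \<noteq> 0\<close> by simp_all
    qed
    obtain t where t: "t \<noteq> 0" "B' * c\<^sup>2 = t * (b * C)" "A' * b\<^sup>2 = t * (b * D)"
      "D' * c\<^sup>2 = t * (c * A)" "C' * b\<^sup>2 = t * (c * B)"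
    proof (rule diagonal_forms_proportional[OF dets])
      fix x y :: complex assume xy: "x \<noteq> 0 \<or> y \<noteq> 0"
      have nzL: "of_real b * y \<noteq> 0 \<or> of_real c * x \<noteq> 0" using xy \<open>b \<noteq> 0\<close> \<open>c \<noteq> 0\<close> by auto
      have nzf: "of_real A * x\<^sup>2 + of_real B * y\<^sup>2 \<noteq> 0 \<or> of_real C * x\<^sup>2 + of_real D * y\<^sup>2 \<noteq> 0"
        using linear_nonzero[OF nz(1), of "x\<^sup>2" "y\<^sup>2"] xy by simp
      have "L (f (sphere_point x y)) = g (L (sphere_point x y))" by (simp add: gL)
      then show "sphere_point (of_real (b * C) * x\<^sup>2 + of_real (b * D) * y\<^sup>2) (of_real (c * A) * x\<^sup>2 + of_real (c * B) * y\<^sup>2) =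
          sphere_point (of_real (B' * c\<^sup>2) * x\<^sup>2 + of_real (A' * b\<^sup>2) * y\<^sup>2) (of_real (D' * c\<^sup>2) * x\<^sup>2 + of_real (C' * b\<^sup>2) * y\<^sup>2)"
        unfolding f_eq g_eq L_eq canonical_map_sphere_point[OF nz(1) xy] moebius_sphere_point[OF nz(3) xy] moebius_sphere_point[OF nz(3) nzf]
        using canonical_map_sphere_point[OF nz(2) nzL] 2 by (simp add: algebra_simps power_mult_distrib)
    qed blast
    \<comment> \<open>The determinants of two proportional matrices differ by
      \<open>t\<^sup>2\<close>; but that of \<open>g \<circ> L\<close> is negative, and that of
      \<open>L \<circ> f\<close> is positive because \<open>b * c < 0\<close>.\<close>
    have "- ((b * c)\<^sup>2 * (A' * D' - B' * C')) = t\<^sup>2 * (- (b * c) * (A * D - B * C))"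
      unfolding eqs[symmetric] t by algebra
    moreover have "t\<^sup>2 * (- (b * c) * (A * D - B * C)) > 0"
      using t(1) bc det by (intro mult_pos_pos) auto
    moreover have "(b * c)\<^sup>2 * (A' * D' - B' * C') > 0"
      using \<open>b \<noteq> 0\<close> \<open>c \<noteq> 0\<close> det' by (intro mult_pos_pos) auto
    ultimately show ?thesis by linarith
  qed
qed


section \<open>The invariants\<close>

definition canonical_map_of :: "homogeneous \<Rightarrow> riemann_sphere \<Rightarrow> riemann_sphere" where
  "canonical_map_of = (\<lambda>(A, B, C, D). canonical_map A B C D)"

lemma canonical_maps_cone: "canonical_maps = canonical_map_of ` canonical_cone"
proof (intro equalityI subsetI)
  fix f assume "f \<in> canonical_maps"
  then obtain A B C D where "(A, B, C, D) \<in> canonical_cone" "f = canonical_map_of (A, B, C, D)"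
    by (auto simp: canonical_maps_def canonical_map_of_def canonical_cone_def)
  then show "f \<in> canonical_map_of ` canonical_cone" by blast
qed (auto simp: canonical_maps_def canonical_map_of_def canonical_cone_def)

lemma canonical_map_of_eq_iff:
  assumes "v \<in> canonical_cone" "w \<in> canonical_cone"
  shows "canonical_map_of v = canonical_map_of w \<longleftrightarrow> proj_point v = proj_point w"
proof -
  obtain A B C D where v: "v = (A, B, C, D)" "A * D - B * C \<noteq> 0"
    using assms(1) by (auto simp: canonical_cone_def)
  obtain A' B' C' D' where w: "w = (A', B', C', D')" "A' * D' - B' * C' \<noteq> 0"
    using assms(2) by (auto simp: canonical_cone_def)
  have "canonical_map_of v = canonical_map_of w \<longleftrightarrow> proj_point w = proj_point v"
    unfolding v w canonical_map_of_def prod.case canonical_map_eq_iff[OF v(2) w(2)] proj_point_eq_iff ..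
  then show ?thesis by auto
qed

lemma canonical_maps_quadratic: "f \<in> canonical_maps \<Longrightarrow> f \<in> real_quadratic_maps"
  using canonical_map_quadratic by (fastforce simp: canonical_maps_def)

lemma canonical_maps_polar_param:
  assumes "f \<in> canonical_maps"
  obtains y where "y \<in> UNIV \<times> {0<..<1}" "f = canonical_map_of (polar_param (y, 0))"
proof -
  obtain v where v: "v \<in> canonical_cone" "f = canonical_map_of v" using assms by (auto simp: canonical_maps_cone)
  then have "proj_point v \<in> canonical_surface" by (simp add: canonical_surface_cone)
  then obtain y where y: "y \<in> UNIV \<times> {0<..<1}" "proj_point v = proj_point (polar_param (y, 0))"
    unfolding canonical_surface_eq by (elim imageE) (rule that)
  then have "f = canonical_map_of (polar_param (y, 0))" using v by (simp add: canonical_map_of_eq_iff polar_param_in_canonical_cone)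
  then show thesis using that y by blast
qed

lemma canonical_map_of_polar_param_eq_iff:
  assumes "y \<in> UNIV \<times> {0<..<1}" "y' \<in> UNIV \<times> {0<..<1}"
  shows "canonical_map_of (polar_param (y, 0)) = canonical_map_of (polar_param (y', 0)) \<longleftrightarrow> cylinder_proj y = cylinder_proj y'"
  using assms by (simp add: canonical_map_of_eq_iff polar_param_in_canonical_cone proj_polar_param_eq_iff)

text \<open>The change of variables from \<theta>, \<eta> to their sum and difference, so that
  existence and uniqueness of the invariants become statements about the parametrization.\<close>

lemma has_invariants_iff:
  "has_invariants f x \<longleftrightarrow> (\<exists>y\<in>UNIV \<times> {0<..<1}. f = canonical_map_of (polar_param (y, 0)) \<and> x = cylinder_proj y)"
proof
  assume "has_invariants f x"
  then obtain \<theta> \<eta> where "0 < \<theta> - \<eta>" "\<theta> - \<eta> < 1"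
    and f: "f = canonical_map (sin (pi * \<theta>)) (sin (pi * \<eta>)) (cos (pi * \<theta>)) (cos (pi * \<eta>))"
    and x: "x = (circle_point (\<theta> + \<eta>), \<theta> - \<eta>)"
    unfolding has_invariants_def by blast
  have "(\<theta> + \<eta> + (\<theta> - \<eta>)) / 2 = \<theta>" "(\<theta> + \<eta> - (\<theta> - \<eta>)) / 2 = \<eta>" by simp_all
  then have "f = canonical_map_of (polar_param ((\<theta> + \<eta>, \<theta> - \<eta>), 0))"
    unfolding f canonical_map_of_def polar_param_def fst_conv snd_conv by (simp del: diff_add_eq)
  then show "\<exists>y\<in>UNIV \<times> {0<..<1}. f = canonical_map_of (polar_param (y, 0)) \<and> x = cylinder_proj y"
    using x \<open>0 < \<theta> - \<eta>\<close> \<open>\<theta> - \<eta> < 1\<close>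
    by (intro bexI[of _ "(\<theta> + \<eta>, \<theta> - \<eta>)"]) (auto simp: cylinder_proj_def)
next
  assume "\<exists>y\<in>UNIV \<times> {0<..<1}. f = canonical_map_of (polar_param (y, 0)) \<and> x = cylinder_proj y"
  then obtain s d where d: "0 < d" "d < 1" and fx: "f = canonical_map_of (polar_param ((s, d), 0))" "x = cylinder_proj (s, d)"
    by auto
  have "(s + d) / 2 - (s - d) / 2 = d" "(s + d) / 2 + (s - d) / 2 = s" by (simp_all add: field_simps)
  then show "has_invariants f x"
    unfolding has_invariants_def
    using d by (intro exI[of _ "(s + d) / 2"] exI[of _ "(s - d) / 2"])
      (simp add: fx canonical_map_of_def polar_param_def cylinder_proj_def)
qed

lemma ex1_has_invariants:
  assumes "f \<in> canonical_maps"
  shows "\<exists>!x. has_invariants f x"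
proof -
  obtain y where "y \<in> UNIV \<times> {0<..<1}" "f = canonical_map_of (polar_param (y, 0))"
    using assms by (rule canonical_maps_polar_param)
  then show ?thesis
    unfolding has_invariants_iff by (intro ex1I[of _ "cylinder_proj y"]) (auto simp: canonical_map_of_polar_param_eq_iff)
qed

lemma invariants_canonical_map_of_polar_param:
  assumes "y \<in> UNIV \<times> {0<..<1}"
  shows "invariants (canonical_map_of (polar_param (y, 0))) = cylinder_proj y"
  unfolding invariants_def has_invariants_iff
  using assms by (intro the_equality) (auto simp: canonical_map_of_polar_param_eq_iff)

lemma inj_on_invariants: "inj_on invariants canonical_maps"
proof (rule inj_onI)
  fix f g assume fg: "f \<in> canonical_maps" "g \<in> canonical_maps" "invariants f = invariants g"
  obtain y where y: "y \<in> UNIV \<times> {0<..<1}" "f = canonical_map_of (polar_param (y, 0))"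
    using fg(1) by (rule canonical_maps_polar_param)
  obtain z where z: "z \<in> UNIV \<times> {0<..<1}" "g = canonical_map_of (polar_param (z, 0))"
    using fg(2) by (rule canonical_maps_polar_param)
  show "f = g" using fg(3) y z by (simp add: invariants_canonical_map_of_polar_param canonical_map_of_polar_param_eq_iff)
qed

lemma ex1_canonical_map:
  assumes "c \<in> moduli_space"
  shows "\<exists>!f. f \<in> c \<and> f \<in> canonical_maps"
proof -
  obtain f where f: "f \<in> real_quadratic_maps" "c = conjugacy `` {f}"
    using assms unfolding moduli_space_def by (rule quotientE)
  obtain g where g: "g \<in> canonical_maps" "(f, g) \<in> conjugacy"
    using f(1) by (rule conjugate_to_canonical)
  have "h = g" if h: "h \<in> canonical_maps" "(f, h) \<in> conjugacy" for h
  proof -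
    have "(h, g) \<in> conjugacy" using g h equiv_conjugacy by (meson equiv_def symD transD)
    then show ?thesis using canonical_maps_conjugate_imp_eq g h by blast
  qed
  then show ?thesis using f g by blast
qed

lemma class_of_point_proj_point:
  assumes "v \<in> canonical_cone"
  shows "class_of_point (proj_point v) = conjugacy `` {canonical_map_of v}"
proof -
  have "conjugacy `` {canonical_map_of (t *\<^sub>R v)} = conjugacy `` {canonical_map_of v}" if "t \<noteq> 0" for t
  proof -
    obtain A B C D where v: "v = (A, B, C, D)" "A * D - B * C \<noteq> 0"
      using assms by (auto simp: canonical_cone_def)
    have "(t * A) * (t * D) - (t * B) * (t * C) = t\<^sup>2 * (A * D - B * C)" by algebra
    then have nz: "(t * A) * (t * D) - (t * B) * (t * C) \<noteq> 0" using that v by simp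
    have "canonical_map A B C D = canonical_map (t * A) (t * B) (t * C) (t * D)"
      unfolding canonical_map_eq_iff[OF v(2) nz] using that by auto
    then show ?thesis by (simp add: v canonical_map_of_def)
  qed
  moreover have "(\<lambda>(A, B, C, D). conjugacy `` {canonical_map A B C D}) = (\<lambda>v. conjugacy `` {canonical_map_of v})"
    by (auto simp: canonical_map_of_def)
  ultimately show ?thesis unfolding class_of_point_def by (simp add: on_points_proj_point)
qed

lemma canonical_rep_class_of_point:
  assumes "v \<in> canonical_cone"
  shows "class_of_point (proj_point v) \<in> moduli_space"
    "canonical_rep (class_of_point (proj_point v)) = canonical_map_of v"
proof -
  have v: "canonical_map_of v \<in> canonical_maps" using assms by (simp add: canonical_maps_cone)
  then have q: "canonical_map_of v \<in> real_quadratic_maps" by (rule canonical_maps_quadratic)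
  then show c: "class_of_point (proj_point v) \<in> moduli_space"
    unfolding class_of_point_proj_point[OF assms] moduli_space_def by (rule quotientI)
  have "canonical_map_of v \<in> class_of_point (proj_point v)"
    unfolding class_of_point_proj_point[OF assms] using equiv_class_self[OF equiv_conjugacy q] .
  then show "canonical_rep (class_of_point (proj_point v)) = canonical_map_of v"
    unfolding canonical_rep_def using v ex1_canonical_map[OF c] by (intro the1_equality) auto
qed

text \<open>Injective because the canonical representative of a class recovers the projective point;
  surjective because every map has a canonical form.\<close>

lemma bij_betw_class_of_point: "bij_betw class_of_point canonical_surface moduli_space"
  unfolding bij_betw_def
proof (intro conjI equalityI subsetI)
  show "inj_on class_of_point canonical_surface"
    unfolding canonical_surface_cone
  proof (rule inj_onI)
    fix P Q assume PQ: "P \<in> proj_point ` canonical_cone" "Q \<in> proj_point ` canonical_cone"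
      "class_of_point P = class_of_point Q"
    then obtain v w where vw: "v \<in> canonical_cone" "w \<in> canonical_cone" "P = proj_point v" "Q = proj_point w"
      by (elim imageE) (rule that)
    then have "canonical_map_of v = canonical_map_of w" using PQ(3) canonical_rep_class_of_point(2) by metis
    then show "P = Q" using vw by (simp add: canonical_map_of_eq_iff)
  qed
next
  fix c assume "c \<in> class_of_point ` canonical_surface"
  then show "c \<in> moduli_space"
    unfolding canonical_surface_cone by (elim imageE) (simp add: canonical_rep_class_of_point)
next
  fix c assume c: "c \<in> moduli_space"
  then obtain f where f: "f \<in> real_quadratic_maps" "c = conjugacy `` {f}"
    unfolding moduli_space_def by (rule quotientE)
  obtain g where g: "g \<in> canonical_maps" "(f, g) \<in> conjugacy"
    using f(1) by (rule conjugate_to_canonical)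
  then obtain v where v: "v \<in> canonical_cone" "g = canonical_map_of v" unfolding canonical_maps_cone by blast
  have "c = class_of_point (proj_point v)"
    unfolding class_of_point_proj_point[OF v(1)] f(2) v(2)[symmetric]
    using equiv_class_eq[OF equiv_conjugacy g(2)] .
  then show "c \<in> class_of_point ` canonical_surface"
    unfolding canonical_surface_cone using v(1) by blast
qed

theorem corollary6p2:
  shows "(\<forall>f\<in>canonical_maps. \<exists>!x. has_invariants f x) \<and>
         inj_on invariants canonical_maps \<and>
         (\<forall>c\<in>moduli_space. \<exists>!f. f \<in> c \<and> f \<in> canonical_maps) \<and>
         diffeomorphism moduli_space moduli_atlas cylinder cylinder_atlas
           (\<lambda>c. invariants (canonical_rep c))"
proof (intro conjI ballI)
  \<comment> \<open>The map of the theorem read on the surface; \<open>moduli_atlas\<close> is by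
    definition the surface atlas transported along \<open>class_of_point\<close>.\<close>
  let ?F = "\<lambda>P. invariants (canonical_rep (class_of_point P))"
  show "\<exists>!x. has_invariants f x" if "f \<in> canonical_maps" for f
    using that by (rule ex1_has_invariants)
  show "inj_on invariants canonical_maps" by (rule inj_on_invariants)
  show "\<exists>!f. f \<in> c \<and> f \<in> canonical_maps" if "c \<in> moduli_space" for c
    using that by (rule ex1_canonical_map)
  have "?F (proj_point (polar_param (y, 0))) = cylinder_proj y" if "y \<in> UNIV \<times> {0<..<1}" for y
    using that by (simp add: canonical_rep_class_of_point polar_param_in_canonical_cone invariants_canonical_map_of_polar_param)
  then have "diffeomorphism canonical_surface (surface_atlas proj_space proj_atlas canonical_surface)
      cylinder cylinder_atlas ?F"
    by (rule canonical_surface_diffeomorphic_cylinder)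
  then show "diffeomorphism moduli_space moduli_atlas cylinder cylinder_atlas
      (\<lambda>c. invariants (canonical_rep c))"
    unfolding moduli_atlas_def
    by (rule diffeomorphism_transported[OF _ bij_betw_class_of_point]) (rule refl)
qed

end
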